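(* Let $M$ be the number of snapshot pairs and $N$ the dimension of the dictionary subspace $\mathcal{F}_{\mathcal{D}}=\mathrm{span}\{\psi_1,\dots,\psi_N\}$. If $M,N\to\infty$, then the following convergences hold: as the number of snapshots $M\to\infty$, $$A_{ij}\xrightarrow{a.s.}\hat A_{ij},\qquad G_{ij}\xrightarrow{a.s.}\hat G_{ij},\qquad \mathcal{K}_{M,N}\xrightarrow{a.s.}\mathcal{K}_N,$$ and, as $N\to\infty$, $\mathcal{K}_N\to\mathcal{K}$ strongly in $L^2(\nu)$ (in the sense that $\int_{\mathcal{M}}|\mathcal{K}_NP_N^{\nu}g-\mathcal{K}g|^2\,d\nu\to0$ for every $g\in\mathcal{F}$). Consequently, the approximation $$p_N(x,t)=\sum_{i=1}^{N}\tilde c_i(0)\,e^{\lambda_{N_i}t}\,\varphi_{N_i}(x)\,p_s(x)$$ converges weakly in $L^2(\mathcal{M};p_s^{-1})$, for every $t>0$, to the probability density function $$p(x,t)=\sum_{i}c_i(0)\,e^{\lambda_i t}\,\varphi_i(x)\,p_s(x)$$ solving the Fokker–Planck equation $\partial_tp=\mathcal{L}^*p$, $p(x,0)=p_0(x)$.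
   Context: **Setting.** $X_t\in\mathcal{M}\subseteq\mathbb{R}^d$ solves the autonomous SDE $dX_t=b(X_t)dt+\sigma(X_t)dW_t$ with flow map $\Phi^t(x)=X_t^x$ (the solution started at $x$), $\Sigma=\sigma\sigma^T$. The process is ergodic and time-reversible (detailed balance), with unique invariant measure $\nu$ having density $p_s$, and vanishing stationary flux $bp_s=\frac12\nabla\cdot(\Sigma p_s)$. The generator is $\mathcal{L}v=b\cdot\nabla v+\frac12\Sigma:\nabla\nabla v$ and the Fokker–Planck operator is its formal $L^2$-adjoint $\mathcal{L}^*v=-\nabla\cdot(bv)+\frac12\nabla\cdot\nabla\cdot(\Sigma v)$. **Spaces.** $L^2(\mathcal{M};p_s)=L^2(\nu)$ has inner product $\langle f,g\rangle_{p_s}=\int_{\mathcal{M}}fg\,p_s\,dx$ and norm $\|\cdot\|_{0,p_s}$; $L^2(\mathcal{M};p_s^{-1})$ has inner product $\langle f,g\rangle_{p_s^{-1}}=\int_{\mathcal{M}}fg\,p_s^{-1}dx$. The observable space is $\mathcal{F}=L^2(\mathcal{M};p_s)$. **Koopman operator.** For a fixed sampling interval $\Delta t>0$, $\mathcal{K}g(x)=\mathbb{E}[g(\Phi^{\Delta t}(x))]$, i.e. $\mathcal{K}=e^{\Delta t\mathcal{L}}$. It is assumed that $\mathcal{K}:\mathcal{F}\to\mathcal{F}$ is bounded and that the dictionary functions $\psi_1,\dots,\psi_N$ are the first $N$ elements of an orthonormal basis $\{\psi_i\}_{i=1}^\infty$ of $\mathcal{F}$. **Exact spectral data.** $\mathcal{L}$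 is assumed to have discrete spectrum on $L^2(\mathcal{M};p_s)$, with real non-positive eigenvalues $\lambda_i$ sorted in descending order and eigenfunctions $\varphi_i$ forming an orthonormal basis of $L^2(\mathcal{M};p_s)$; then $\mathcal{K}\varphi_i=\mu_i\varphi_i$ with $\mu_i=e^{\lambda_i\Delta t}$. The initial density is $p_0\in L^2(\mathcal{M};p_s^{-1})$ and $c_i(0)=\langle p_0,\varphi_ip_s\rangle_{p_s^{-1}}=\int_{\mathcal{M}} p_0\varphi_i\,dx$. **Data and EDMD.** Snapshot pairs $(x_m,y_m)$, $m=1,\dots,M$, have $x_m$ drawn independently from $\nu$ and $y_m=\Phi^{\Delta t}(x_m)$ (one realization of the flow). Set $$A_{ij}=\frac1M\sum_{m=1}^M\psi_i(y_m)\psi_j(x_m),\quad G_{ij}=\frac1M\sum_{m=1}^M\psi_i(x_m)\psi_j(x_m),\quad \hat A_{ij}=\langle\mathcal{K}\psi_i,\psi_j\rangle_{p_s},\quad \hat G_{ij}=\langle\psi_i,\psi_j\rangle_{p_s}.$$ With $\bm{\psi}=(\psi_1,\dots,\psi_N)^T$, the EDMD operator $\mathcal{K}_{M,N}:\mathcal{F}_{\mathcal{D}}\to\mathcal{F}_{\mathcal{D}}$ is $\mathcal{K}_{M,N}(a^T\bm{\psi})=a^TAG^{\dagger}\bm{\psi}$ ($a\in\mathbb{R}^N$, $\dagger$ the pseudoinverse), and the Galerkin operator $\mathcal{K}_N:\mathcal{F}_{\mathcal{D}}\to\mathcal{F}_{\mathcal{D}}$ is $\mathcal{K}_N(a^T\bm{\psi})=a^T\hat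 A\hat G^{-1}\bm{\psi}$, i.e. $\mathcal{K}_N=P_N^{\nu}\mathcal{K}|_{\mathcal{F}_{\mathcal{D}}}$, where $P_N^{\nu}$ is the $L^2(\mathcal{M};p_s)$-orthogonal projection onto $\mathcal{F}_{\mathcal{D}}$. **Approximate spectral data.** $(\mu_{N_i},\varphi_{N_i})$ are eigenpairs of $\mathcal{K}_N$ with $\|\varphi_{N_i}\|_{0,p_s}=1$, $\lambda_{N_i}=\frac{\log\mu_{N_i}}{\Delta t}$, chosen (along a subsequence, as is possible by a known theorem on spectral convergence of EDMD) so that for each $i$, $\mu_{N_i}\to\mu_i$ (hence $\lambda_{N_i}\to\lambda_i$) and $\varphi_{N_i}\rightharpoonup\varphi_i$ weakly as $N\to\infty$. The coefficient $\tilde c_i(0)$ is the Monte Carlo (importance sampling) estimator of $c_i(0)$ from the stationary samples, $$\tilde c_i(0)=\frac1M\sum_{m=1}^M\varphi_i(x_m)\,\frac{p_0(x_m)}{p_s(x_m)} .$$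
   Formalization: Eigenfunctions of K_N for a repeated eigenvalue are assumed mutually orthogonal (if one eigenpair may be listed repeatedly, the claim on p_N fails); for p_N, M,N→∞ is read as first M then N, or jointly with M large enough relative to N. *)

theory Defs
  imports "HOL-Probability.Probability" "Jordan_Normal_Form.Matrix"
begin

(* Both Finite_Cartesian_Product.vec_nth and Matrix.vec_index are written $; here $ is the former. *)
no_notation vec_index (infixl \<open>$\<close> 100)


section \<open>Square-integrable functions\<close>

text \<open>Elements of \<open>L\<^sup>2(N)\<close> are represented by functions; equality in \<open>L\<^sup>2(N)\<close> is equality
  \<open>N\<close>-almost everywhere.\<close>

definition l2 :: "'x measure \<Rightarrow> ('x \<Rightarrow> real) \<Rightarrow> bool" where
  "l2 N f \<longleftrightarrow> f \<in> borel_measurable N \<and> integrable N (\<lambda>x. (f x)\<^sup>2)"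

definition l2_inner :: "'x measure \<Rightarrow> ('x \<Rightarrow> real) \<Rightarrow> ('x \<Rightarrow> real) \<Rightarrow> real" where
  "l2_inner N f g = (\<integral>x. f x * g x \<partial>N)"

definition l2_norm :: "'x measure \<Rightarrow> ('x \<Rightarrow> real) \<Rightarrow> real" where
  "l2_norm N f = sqrt (l2_inner N f f)"

definition l2_lim ::
  "'x measure \<Rightarrow> ('t \<Rightarrow> 'x \<Rightarrow> real) \<Rightarrow> ('x \<Rightarrow> real) \<Rightarrow> 't filter \<Rightarrow> bool" where
  "l2_lim N u f \<F> \<longleftrightarrow> l2 N f \<and> (\<forall>\<^sub>F n in \<F>. l2 N (u n)) \<and>
     ((\<lambda>n. l2_norm N (\<lambda>x. u n x - f x)) \<longlongrightarrow> 0) \<F>"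

definition weak_l2_lim :: "'x measure \<Rightarrow> (nat \<Rightarrow> 'x \<Rightarrow> real) \<Rightarrow> ('x \<Rightarrow> real) \<Rightarrow> bool" where
  "weak_l2_lim N u f \<longleftrightarrow> l2 N f \<and> (\<forall>\<^sub>F n in sequentially. l2 N (u n)) \<and>
     (\<forall>h. l2 N h \<longrightarrow> (\<lambda>n. l2_inner N (u n) h) \<longlonglongrightarrow> l2_inner N f h)"

definition l2_orthonormal_basis :: "'x measure \<Rightarrow> (nat \<Rightarrow> 'x \<Rightarrow> real) \<Rightarrow> bool" where
  "l2_orthonormal_basis N e \<longleftrightarrow>
     (\<forall>i. l2 N (e i)) \<and>
     (\<forall>i j. l2_inner N (e i) (e j) = (if i = j then 1 else 0)) \<and>
     (\<forall>f. l2 N f \<longrightarrow> l2_lim N (\<lambda>n x. \<Sum>i<n. l2_inner N f (e i) * e i x) f sequentially)"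

definition l2_bounded_operator ::
  "'x measure \<Rightarrow> (('x \<Rightarrow> real) \<Rightarrow> 'x \<Rightarrow> real) \<Rightarrow> bool" where
  "l2_bounded_operator N T \<longleftrightarrow>
     (\<exists>C. \<forall>g. l2 N g \<longrightarrow> l2 N (T g) \<and> l2_norm N (T g) \<le> C * l2_norm N g)"

text \<open>Strongly continuous semigroups on \<open>L\<^sup>2(N)\<close> and their generators. The statement \<open>T t = e\<^bsup>tL\<^esup>\<close>
  for an unbounded operator \<open>L\<close> means that \<open>T\<close> is such a semigroup and \<open>L\<close> is its generator;
  \<open>l2_generator N T f g\<close> says that \<open>f\<close> lies in the domain of \<open>L\<close> and \<open>L f = g\<close>.\<close>

definition l2_semigroup ::
  "'x measure \<Rightarrow> (real \<Rightarrow> ('x \<Rightarrow> real) \<Rightarrow> 'x \<Rightarrow> real) \<Rightarrow> bool" where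
  "l2_semigroup N T \<longleftrightarrow>
     (\<forall>t\<ge>0. l2_bounded_operator N (T t)) \<and>
     (\<forall>g. l2 N g \<longrightarrow>
        (AE x in N. T 0 g x = g x) \<and>
        (\<forall>s\<ge>0. \<forall>t\<ge>0. AE x in N. T (s + t) g x = T s (T t g) x) \<and>
        l2_lim N (\<lambda>t. T t g) g (at_right 0))"

definition l2_generator ::
  "'x measure \<Rightarrow> (real \<Rightarrow> ('x \<Rightarrow> real) \<Rightarrow> 'x \<Rightarrow> real) \<Rightarrow> ('x \<Rightarrow> real) \<Rightarrow> ('x \<Rightarrow> real) \<Rightarrow> bool" where
  "l2_generator N T f g \<longleftrightarrow> l2 N f \<and> l2_lim N (\<lambda>t x. (T t f x - f x) / t) g (at_right 0)"

text \<open>For eigenvalues listed with multiplicity: each one is isolated and of finite multiplicity, and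
  there is no finite accumulation point.\<close>

definition discrete_spectrum :: "(nat \<Rightarrow> real) \<Rightarrow> bool" where
  "discrete_spectrum lam \<longleftrightarrow> (\<forall>B. finite {i. \<bar>lam i\<bar> \<le> B})"


section \<open>The generator and the Fokker-Planck operator\<close>

definition partial_deriv :: "'d::finite \<Rightarrow> (real^'d \<Rightarrow> real) \<Rightarrow> real^'d \<Rightarrow> real" where
  "partial_deriv i f x = frechet_derivative f (at x) (axis i 1)"

primrec cont_diff :: "nat \<Rightarrow> (real^'d::finite \<Rightarrow> real) \<Rightarrow> bool" where
  "cont_diff 0 f \<longleftrightarrow> continuous_on UNIV f"
| "cont_diff (Suc k) f \<longleftrightarrow> f differentiable_on UNIV \<and> (\<forall>i. cont_diff k (partial_deriv i f))"

definition test_functions :: "(real^'d::finite) set \<Rightarrow> (real^'d \<Rightarrow> real) set" where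
  "test_functions S = {v. (\<forall>k. cont_diff k v) \<and> compact (closure {x. v x \<noteq> 0}) \<and>
     closure {x. v x \<noteq> 0} \<subseteq> interior S}"

definition diffusion_matrix :: "(real^'d::finite \<Rightarrow> real^'w::finite^'d) \<Rightarrow> real^'d \<Rightarrow> real^'d^'d" where
  "diffusion_matrix \<sigma> x = \<sigma> x ** Finite_Cartesian_Product.transpose (\<sigma> x)"

definition generator ::
  "(real^'d::finite \<Rightarrow> real^'d) \<Rightarrow> (real^'d \<Rightarrow> real^'w::finite^'d) \<Rightarrow> (real^'d \<Rightarrow> real) \<Rightarrow> real^'d \<Rightarrow> real"
  where
  "generator b \<sigma> v x =
     (\<Sum>i\<in>UNIV. b x $ i * partial_deriv i v x) +
     1/2 * (\<Sum>i\<in>UNIV. \<Sum>j\<in>UNIV. diffusion_matrix \<sigma> x $ i $ j * partial_deriv i (partial_deriv j v) x)"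

text \<open>\<open>q = L\<^sup>* u\<close>, that is \<open>q = -\<nabla>\<cdot>(b u) + 1/2 \<nabla>\<cdot>\<nabla>\<cdot>(\<Sigma> u)\<close> in the sense of distributions on the
  interior of \<open>S\<close>: shifting the derivatives onto the test function gives the identity below, which
  also expresses that \<open>L\<^sup>*\<close> is the formal adjoint of \<open>generator b \<sigma>\<close> with respect to Lebesgue measure.\<close>

definition fokker_planck_operator ::
  "(real^'d::finite) set \<Rightarrow> (real^'d \<Rightarrow> real^'d) \<Rightarrow> (real^'d \<Rightarrow> real^'w::finite^'d) \<Rightarrow>
     (real^'d \<Rightarrow> real) \<Rightarrow> (real^'d \<Rightarrow> real) \<Rightarrow> bool" where
  "fokker_planck_operator S b \<sigma> u q \<longleftrightarrow>
     (\<forall>v\<in>test_functions S.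
        integrable (restrict_space lborel S) (\<lambda>x. q x * v x) \<and>
        integrable (restrict_space lborel S) (\<lambda>x. u x * generator b \<sigma> v x) \<and>
        (\<integral>x. q x * v x \<partial>restrict_space lborel S) =
        (\<integral>x. u x * generator b \<sigma> v x \<partial>restrict_space lborel S))"


section \<open>The stochastic differential equation\<close>

definition brownian_motion ::
  "'a measure \<Rightarrow> (real \<Rightarrow> 'a measure) \<Rightarrow> (real \<Rightarrow> 'a \<Rightarrow> real^'w::finite) \<Rightarrow> bool" where
  "brownian_motion P F W \<longleftrightarrow>
     prob_space P \<and> filtration (space P) F \<and> (\<forall>t. subalgebra P (F t)) \<and>
     (\<forall>t\<ge>0. W t \<in> borel_measurable (F t)) \<and>
     (AE \<omega> in P. W 0 \<omega> = 0) \<and>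
     (\<forall>\<omega>\<in>space P. continuous_on {0..} (\<lambda>t. W t \<omega>)) \<and>
     (\<forall>s t. 0 \<le> s \<and> s < t \<longrightarrow>
        prob_space.indep_set P (sets (F s))
          {(\<lambda>\<omega>. W t \<omega> - W s \<omega>) -` A \<inter> space P |A. A \<in> sets borel} \<and>
        prob_space.indep_vars P (\<lambda>_. borel) (\<lambda>i \<omega>. (W t \<omega> - W s \<omega>) $ i) UNIV \<and>
        (\<forall>i. distributed P lborel (\<lambda>\<omega>. (W t \<omega> - W s \<omega>) $ i) (normal_density 0 (sqrt (t - s)))))"

text \<open>For an adapted integrand with continuous paths (the only case used) the Ito integral over
  \<open>[0,t]\<close> is the limit in probability of the left-endpoint Riemann sums.\<close>

definition ito_sum ::
  "(real \<Rightarrow> 'a \<Rightarrow> real^'w::finite^'d::finite) \<Rightarrow> (real \<Rightarrow> 'a \<Rightarrow> real^'w) \<Rightarrow> real \<Rightarrow> nat \<Rightarrow> 'a \<Rightarrow> real^'d"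
  where
  "ito_sum H W t n \<omega> =
     (\<Sum>k<n. H (real k * t / real n) \<omega> *v (W (real (Suc k) * t / real n) \<omega> - W (real k * t / real n) \<omega>))"

definition has_ito_integral ::
  "'a measure \<Rightarrow> (real \<Rightarrow> 'a \<Rightarrow> real^'w::finite^'d::finite) \<Rightarrow> (real \<Rightarrow> 'a \<Rightarrow> real^'w) \<Rightarrow> real \<Rightarrow>
     ('a \<Rightarrow> real^'d) \<Rightarrow> bool" where
  "has_ito_integral P H W t I \<longleftrightarrow> I \<in> borel_measurable P \<and>
     (\<forall>\<epsilon>>0. (\<lambda>n. measure P {\<omega>\<in>space P. norm (ito_sum H W t n \<omega> - I \<omega>) > \<epsilon>}) \<longlonglongrightarrow> 0)"

text \<open>\<open>\<Phi> t x\<close> is the solution at time \<open>t\<close> of \<open>dX = b(X) dt + \<sigma>(X) dW\<close> with \<open>X\<^sub>0 = x\<close>.\<close>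

definition sde_flow ::
  "(real^'d::finite) set \<Rightarrow> (real^'d \<Rightarrow> real^'d) \<Rightarrow> (real^'d \<Rightarrow> real^'w::finite^'d) \<Rightarrow>
     'a measure \<Rightarrow> (real \<Rightarrow> 'a measure) \<Rightarrow> (real \<Rightarrow> 'a \<Rightarrow> real^'w) \<Rightarrow>
     (real \<Rightarrow> real^'d \<Rightarrow> 'a \<Rightarrow> real^'d) \<Rightarrow> bool" where
  "sde_flow S b \<sigma> P F W \<Phi> \<longleftrightarrow>
     (\<forall>x\<in>S.
        (\<forall>\<omega>\<in>space P. \<Phi> 0 x \<omega> = x \<and> continuous_on {0..} (\<lambda>t. \<Phi> t x \<omega>) \<and> (\<forall>t\<ge>0. \<Phi> t x \<omega> \<in> S)) \<and>
        (\<forall>t\<ge>0. \<Phi> t x \<in> borel_measurable (F t)) \<and>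
        (\<forall>t\<ge>0. has_ito_integral P (\<lambda>s \<omega>. \<sigma> (\<Phi> s x \<omega>)) W t
           (\<lambda>\<omega>. \<Phi> t x \<omega> - x - integral {0..t} (\<lambda>s. b (\<Phi> s x \<omega>)))))"

definition koopman ::
  "'a measure \<Rightarrow> (real \<Rightarrow> 'x \<Rightarrow> 'a \<Rightarrow> 'x) \<Rightarrow> real \<Rightarrow> ('x \<Rightarrow> real) \<Rightarrow> 'x \<Rightarrow> real" where
  "koopman P \<Phi> t g x = (\<integral>\<omega>. g (\<Phi> t x \<omega>) \<partial>P)"

definition invariant_measure ::
  "'a measure \<Rightarrow> (real \<Rightarrow> 'x \<Rightarrow> 'a \<Rightarrow> 'x) \<Rightarrow> 'x measure \<Rightarrow> bool" where
  "invariant_measure P \<Phi> N \<longleftrightarrow> (\<forall>t\<ge>0. distr (N \<Otimes>\<^sub>M P) N (\<lambda>(x, \<omega>). \<Phi> t x \<omega>) = N)"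

definition ergodic ::
  "'a measure \<Rightarrow> (real \<Rightarrow> 'x \<Rightarrow> 'a \<Rightarrow> 'x) \<Rightarrow> 'x measure \<Rightarrow> bool" where
  "ergodic P \<Phi> N \<longleftrightarrow>
     (\<forall>f. l2 N f \<and> (\<forall>t\<ge>0. AE x in N. koopman P \<Phi> t f x = f x) \<longrightarrow> (\<exists>c. AE x in N. f x = c))"

text \<open>Detailed balance: for \<open>X\<^sub>0 \<sim> N\<close> the pairs \<open>(X\<^sub>0, X\<^sub>t)\<close> and \<open>(X\<^sub>t, X\<^sub>0)\<close> have the same law.\<close>

definition time_reversible ::
  "'a measure \<Rightarrow> (real \<Rightarrow> 'x \<Rightarrow> 'a \<Rightarrow> 'x) \<Rightarrow> 'x measure \<Rightarrow> bool" where
  "time_reversible P \<Phi> N \<longleftrightarrow>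
     (\<forall>t\<ge>0. distr (N \<Otimes>\<^sub>M P) (N \<Otimes>\<^sub>M N) (\<lambda>(x, \<omega>). (x, \<Phi> t x \<omega>)) =
            distr (N \<Otimes>\<^sub>M P) (N \<Otimes>\<^sub>M N) (\<lambda>(x, \<omega>). (\<Phi> t x \<omega>, x)))"

text \<open>The measure \<open>w dx\<close> on the state space \<open>S\<close>; its \<open>L\<^sup>2\<close>-space is \<open>L\<^sup>2(S; w)\<close>.\<close>

definition weighted :: "(real^'d::finite) set \<Rightarrow> (real^'d \<Rightarrow> real) \<Rightarrow> (real^'d) measure" where
  "weighted S w = density (restrict_space lborel S) (\<lambda>x. ennreal (w x))"

locale reversible_diffusion =
  fixes S :: "(real^'d::finite) set"
    and b :: "real^'d \<Rightarrow> real^'d"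
    and \<sigma> :: "real^'d \<Rightarrow> real^'w::finite^'d"
    and P :: "'a measure"
    and F :: "real \<Rightarrow> 'a measure"
    and W :: "real \<Rightarrow> 'a \<Rightarrow> real^'w"
    and \<Phi> :: "real \<Rightarrow> real^'d \<Rightarrow> 'a \<Rightarrow> real^'d"
    and p\<^sub>s :: "real^'d \<Rightarrow> real"
  assumes S_borel: "S \<in> sets borel"
    and continuous_b: "continuous_on S b"
    and continuous_\<sigma>: "continuous_on S \<sigma>"
    and brownian: "brownian_motion P F W"
    and flow: "sde_flow S b \<sigma> P F W \<Phi>"
    and p\<^sub>s_measurable: "p\<^sub>s \<in> borel_measurable (restrict_space lborel S)"
    and p\<^sub>s_pos: "\<And>x. x \<in> S \<Longrightarrow> 0 < p\<^sub>s x"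
    and prob_p\<^sub>s: "prob_space (weighted S p\<^sub>s)"
    and flow_measurable: "\<And>t. 0 \<le> t \<Longrightarrow>
      (\<lambda>(x, \<omega>). \<Phi> t x \<omega>) \<in> measurable (weighted S p\<^sub>s \<Otimes>\<^sub>M P) (weighted S p\<^sub>s)"
    and invariant: "invariant_measure P \<Phi> (weighted S p\<^sub>s)"
    and invariant_unique: "\<And>N. prob_space N \<Longrightarrow> sets N = sets (weighted S p\<^sub>s) \<Longrightarrow>
      invariant_measure P \<Phi> N \<Longrightarrow> N = weighted S p\<^sub>s"
    and ergodicity: "ergodic P \<Phi> (weighted S p\<^sub>s)"
    and detailed_balance: "time_reversible P \<Phi> (weighted S p\<^sub>s)"
    and flux_differentiable: "\<And>x i j. x \<in> interior S \<Longrightarrow>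
      (\<lambda>y. diffusion_matrix \<sigma> y $ i $ j * p\<^sub>s y) differentiable at x"
    and zero_flux: "\<And>x i. x \<in> interior S \<Longrightarrow>
      b x $ i * p\<^sub>s x = 1/2 * (\<Sum>j\<in>UNIV. partial_deriv j (\<lambda>y. diffusion_matrix \<sigma> y $ i $ j * p\<^sub>s y) x)"
    \<comment> \<open>\<open>koopman P \<Phi> t = e\<^bsup>tL\<^esup>\<close>, where \<open>L\<close> acts as \<open>generator b \<sigma>\<close> on test functions\<close>
    and koopman_semigroup: "l2_semigroup (weighted S p\<^sub>s) (koopman P \<Phi>)"
    and koopman_generator: "\<And>v. v \<in> test_functions S \<Longrightarrow>
      l2_generator (weighted S p\<^sub>s) (koopman P \<Phi>) v (generator b \<sigma> v)"

text \<open>The Fokker-Planck equation \<open>\<partial>\<^sub>t p = L\<^sup>* p\<close>, \<open>p(\<cdot>,0) = p\<^sub>0\<close>, for \<open>L\<^sup>2(S; 1/p\<^sub>s)\<close>-valued \<open>p\<close>: the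
  time derivative exists in the norm of that space and \<open>L\<^sup>*\<close> is taken in the sense of distributions.\<close>

definition solves_fokker_planck ::
  "(real^'d::finite) set \<Rightarrow> (real^'d \<Rightarrow> real^'d) \<Rightarrow> (real^'d \<Rightarrow> real^'w::finite^'d) \<Rightarrow>
     (real^'d \<Rightarrow> real) \<Rightarrow> (real^'d \<Rightarrow> real) \<Rightarrow> (real \<Rightarrow> real^'d \<Rightarrow> real) \<Rightarrow> bool" where
  "solves_fokker_planck S b \<sigma> p\<^sub>s p\<^sub>0 p \<longleftrightarrow>
     (\<forall>t\<ge>0. l2 (weighted S (\<lambda>x. 1 / p\<^sub>s x)) (p t)) \<and>
     (AE x in restrict_space lborel S. p 0 x = p\<^sub>0 x) \<and>
     l2_lim (weighted S (\<lambda>x. 1 / p\<^sub>s x)) p p\<^sub>0 (at_right 0) \<and>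
     (\<forall>t>0. \<exists>q. l2_lim (weighted S (\<lambda>x. 1 / p\<^sub>s x)) (\<lambda>h x. (p (t + h) x - p t x) / h) q (at 0) \<and>
        fokker_planck_operator S b \<sigma> (p t) q)"

text \<open>For every \<open>t \<ge> 0\<close>, \<open>p t\<close> is a probability density of \<open>\<Phi> t X\<^sub>0\<close>, where \<open>X\<^sub>0\<close> has density \<open>p\<^sub>0\<close>
  and is independent of the driving noise.\<close>

definition evolved_density ::
  "(real^'d::finite) set \<Rightarrow> 'a measure \<Rightarrow> (real \<Rightarrow> real^'d \<Rightarrow> 'a \<Rightarrow> real^'d) \<Rightarrow>
     (real^'d \<Rightarrow> real) \<Rightarrow> (real \<Rightarrow> real^'d \<Rightarrow> real) \<Rightarrow> bool" where
  "evolved_density S P \<Phi> p\<^sub>0 p \<longleftrightarrow>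
     (\<forall>t\<ge>0. (AE x in restrict_space lborel S. 0 \<le> p t x) \<and>
        distr (weighted S p\<^sub>0 \<Otimes>\<^sub>M P) (restrict_space lborel S) (\<lambda>(x, \<omega>). \<Phi> t x \<omega>) = weighted S (p t))"


section \<open>Extended dynamic mode decomposition\<close>

text \<open>The initial states \<open>X m \<sim> \<nu>\<close> and the realizations \<open>\<Xi> m\<close> of the driving noise are all
  independent; the second snapshot of the \<open>m\<close>-th pair is \<open>\<Phi> \<Delta>t (X m) (\<Xi> m)\<close>.\<close>

definition snapshot_data ::
  "'q measure \<Rightarrow> 'x measure \<Rightarrow> 'a measure \<Rightarrow> (nat \<Rightarrow> 'q \<Rightarrow> 'x) \<Rightarrow> (nat \<Rightarrow> 'q \<Rightarrow> 'a) \<Rightarrow> bool" where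
  "snapshot_data Q \<nu> P X \<Xi> \<longleftrightarrow> prob_space Q \<and>
     prob_space.indep_vars Q (\<lambda>_. \<nu> \<Otimes>\<^sub>M P) (\<lambda>m \<omega>. (X m \<omega>, \<Xi> m \<omega>)) UNIV \<and>
     (\<forall>m. distr Q (\<nu> \<Otimes>\<^sub>M P) (\<lambda>\<omega>. (X m \<omega>, \<Xi> m \<omega>)) = \<nu> \<Otimes>\<^sub>M P)"

text \<open>Indices start at 0, so the dictionary of size \<open>N\<close> is \<open>\<psi> 0, \<dots>, \<psi> (N - 1)\<close>.\<close>

definition emp_A ::
  "(nat \<Rightarrow> 'x \<Rightarrow> real) \<Rightarrow> nat \<Rightarrow> (nat \<Rightarrow> 'x) \<Rightarrow> (nat \<Rightarrow> 'x) \<Rightarrow> nat \<Rightarrow> nat \<Rightarrow> real" where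
  "emp_A \<psi> M x y i j = 1 / real M * (\<Sum>m<M. \<psi> i (y m) * \<psi> j (x m))"

definition emp_G :: "(nat \<Rightarrow> 'x \<Rightarrow> real) \<Rightarrow> nat \<Rightarrow> (nat \<Rightarrow> 'x) \<Rightarrow> nat \<Rightarrow> nat \<Rightarrow> real" where
  "emp_G \<psi> M x i j = 1 / real M * (\<Sum>m<M. \<psi> i (x m) * \<psi> j (x m))"

definition gal_A ::
  "'x measure \<Rightarrow> (('x \<Rightarrow> real) \<Rightarrow> 'x \<Rightarrow> real) \<Rightarrow> (nat \<Rightarrow> 'x \<Rightarrow> real) \<Rightarrow> nat \<Rightarrow> nat \<Rightarrow> real" where
  "gal_A \<nu> K \<psi> i j = l2_inner \<nu> (K (\<psi> i)) (\<psi> j)"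

definition gal_G :: "'x measure \<Rightarrow> (nat \<Rightarrow> 'x \<Rightarrow> real) \<Rightarrow> nat \<Rightarrow> nat \<Rightarrow> real" where
  "gal_G \<nu> \<psi> i j = l2_inner \<nu> (\<psi> i) (\<psi> j)"

definition matrix_of :: "nat \<Rightarrow> (nat \<Rightarrow> nat \<Rightarrow> real) \<Rightarrow> real mat" where
  "matrix_of N B = Matrix.mat N N (\<lambda>(i, j). B i j)"

definition mat_inv :: "real mat \<Rightarrow> real mat" where
  "mat_inv B = (THE C. C \<in> carrier_mat (dim_col B) (dim_row B) \<and> inverts_mat B C \<and> inverts_mat C B)"

text \<open>The Moore-Penrose pseudoinverse.\<close>

definition pinv :: "real mat \<Rightarrow> real mat" where
  "pinv B = (THE C. C \<in> carrier_mat (dim_col B) (dim_row B) \<and>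
     B * C * B = B \<and> C * B * C = C \<and>
     transpose_mat (B * C) = B * C \<and> transpose_mat (C * B) = C * B)"

definition dict_comb :: "(nat \<Rightarrow> 'x \<Rightarrow> real) \<Rightarrow> real Matrix.vec \<Rightarrow> 'x \<Rightarrow> real" where
  "dict_comb \<psi> a x = (\<Sum>i<dim_vec a. vec_index a i * \<psi> i x)"

definition dict_span :: "(nat \<Rightarrow> 'x \<Rightarrow> real) \<Rightarrow> nat \<Rightarrow> ('x \<Rightarrow> real) set" where
  "dict_span \<psi> N = dict_comb \<psi> ` carrier_vec N"

text \<open>The operator \<open>a\<^sup>T \<psi> \<mapsto> a\<^sup>T B \<psi>\<close> on the span of the first \<open>N\<close> dictionary functions, for an
  \<open>N \<times> N\<close> matrix \<open>B\<close>; the row vector \<open>a\<^sup>T B\<close> is encoded as the vector \<open>B\<^sup>T a\<close>.\<close>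

definition dict_operator ::
  "(nat \<Rightarrow> 'x \<Rightarrow> real) \<Rightarrow> nat \<Rightarrow> real mat \<Rightarrow> ('x \<Rightarrow> real) \<Rightarrow> 'x \<Rightarrow> real" where
  "dict_operator \<psi> N B g =
     dict_comb \<psi> (transpose_mat B *\<^sub>v (THE a. a \<in> carrier_vec N \<and> dict_comb \<psi> a = g))"

definition edmd ::
  "(nat \<Rightarrow> 'x \<Rightarrow> real) \<Rightarrow> nat \<Rightarrow> nat \<Rightarrow> (nat \<Rightarrow> 'x) \<Rightarrow> (nat \<Rightarrow> 'x) \<Rightarrow> ('x \<Rightarrow> real) \<Rightarrow> 'x \<Rightarrow> real" where
  "edmd \<psi> M N x y =
     dict_operator \<psi> N (matrix_of N (emp_A \<psi> M x y) * pinv (matrix_of N (emp_G \<psi> M x)))"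

definition galerkin ::
  "'x measure \<Rightarrow> (('x \<Rightarrow> real) \<Rightarrow> 'x \<Rightarrow> real) \<Rightarrow> (nat \<Rightarrow> 'x \<Rightarrow> real) \<Rightarrow> nat \<Rightarrow> ('x \<Rightarrow> real) \<Rightarrow> 'x \<Rightarrow> real"
  where
  "galerkin \<nu> K \<psi> N =
     dict_operator \<psi> N (matrix_of N (gal_A \<nu> K \<psi>) * mat_inv (matrix_of N (gal_G \<nu> \<psi>)))"

definition dict_proj ::
  "'x measure \<Rightarrow> (nat \<Rightarrow> 'x \<Rightarrow> real) \<Rightarrow> nat \<Rightarrow> ('x \<Rightarrow> real) \<Rightarrow> 'x \<Rightarrow> real" where
  "dict_proj \<nu> \<psi> N g =
     (THE f. f \<in> dict_span \<psi> N \<and> (\<forall>h\<in>dict_span \<psi> N. l2_inner \<nu> (\<lambda>x. g x - f x) h = 0))"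

text \<open>Convergence in operator norm on the span of the first \<open>N\<close> dictionary functions.\<close>

definition dict_operator_lim ::
  "'x measure \<Rightarrow> (nat \<Rightarrow> 'x \<Rightarrow> real) \<Rightarrow> nat \<Rightarrow> (nat \<Rightarrow> ('x \<Rightarrow> real) \<Rightarrow> 'x \<Rightarrow> real) \<Rightarrow>
     (('x \<Rightarrow> real) \<Rightarrow> 'x \<Rightarrow> real) \<Rightarrow> bool" where
  "dict_operator_lim \<nu> \<psi> N T T' \<longleftrightarrow>
     (\<forall>\<epsilon>>0. \<forall>\<^sub>F M in sequentially. \<forall>g\<in>dict_span \<psi> N.
        l2_norm \<nu> (\<lambda>x. T M g x - T' g x) \<le> \<epsilon> * l2_norm \<nu> g)"

text \<open>The eigenpairs \<open>(\<mu> i, f i)\<close>, \<open>i < N\<close>, of an operator \<open>T\<close> that is self-adjoint on the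
  \<open>N\<close>-dimensional span of the dictionary. Each eigenvalue is listed according to its multiplicity, and
  the unit eigenfunctions chosen for one and the same eigenvalue are orthogonal to each other (those
  for distinct eigenvalues are so automatically).\<close>

definition dict_eigenpairs ::
  "'x measure \<Rightarrow> (nat \<Rightarrow> 'x \<Rightarrow> real) \<Rightarrow> nat \<Rightarrow> (('x \<Rightarrow> real) \<Rightarrow> 'x \<Rightarrow> real) \<Rightarrow>
     (nat \<Rightarrow> real) \<Rightarrow> (nat \<Rightarrow> 'x \<Rightarrow> real) \<Rightarrow> bool" where
  "dict_eigenpairs \<nu> \<psi> N T \<mu> f \<longleftrightarrow>
     (\<forall>i<N. f i \<in> dict_span \<psi> N \<and> l2_norm \<nu> (f i) = 1 \<and> T (f i) = (\<lambda>x. \<mu> i * f i x)) \<and>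
     (\<forall>i<N. \<forall>j<N. i \<noteq> j \<and> \<mu> i = \<mu> j \<longrightarrow> l2_inner \<nu> (f i) (f j) = 0)"


section \<open>Exact and approximate densities\<close>

definition density_coeff ::
  "(real^'d::finite) set \<Rightarrow> (real^'d \<Rightarrow> real) \<Rightarrow> (real^'d \<Rightarrow> real) \<Rightarrow> (real^'d \<Rightarrow> real) \<Rightarrow> real" where
  "density_coeff S p\<^sub>s p\<^sub>0 f = l2_inner (weighted S (\<lambda>x. 1 / p\<^sub>s x)) p\<^sub>0 (\<lambda>x. f x * p\<^sub>s x)"

definition mc_coeff ::
  "nat \<Rightarrow> (nat \<Rightarrow> 'x) \<Rightarrow> ('x \<Rightarrow> real) \<Rightarrow> ('x \<Rightarrow> real) \<Rightarrow> ('x \<Rightarrow> real) \<Rightarrow> real" where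
  "mc_coeff M x p\<^sub>s p\<^sub>0 f = 1 / real M * (\<Sum>m<M. f (x m) * (p\<^sub>0 (x m) / p\<^sub>s (x m)))"

definition spectral_density ::
  "nat \<Rightarrow> (nat \<Rightarrow> real) \<Rightarrow> (nat \<Rightarrow> real) \<Rightarrow> (nat \<Rightarrow> 'x \<Rightarrow> real) \<Rightarrow> ('x \<Rightarrow> real) \<Rightarrow> real \<Rightarrow> 'x \<Rightarrow> real"
  where
  "spectral_density N c lam f p\<^sub>s t x = (\<Sum>i<N. c i * exp (lam i * t) * f i x * p\<^sub>s x)"

end

theory Submission
  imports Defs "Jordan_Normal_Form.Determinant"
begin

text \<open>Everything takes place in \<open>L\<^sup>2(\<nu>)\<close>, where reversibility makes the Koopman semigroup
  \<open>T\<close> symmetric and invariance makes it contractive (\<open>koopman_symmetric\<close>, \<open>koopman_l2_bound\<close>).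
  Multiplication by \<open>p\<^sub>s\<close> is an isometry onto \<open>L\<^sup>2(1/p\<^sub>s)\<close>. It carries \<open>T t f\<^sub>0\<close>, where
  \<open>f\<^sub>0 = p\<^sub>0/p\<^sub>s\<close>, to the law of the process at time \<open>t\<close>, because under detailed balance a density
  relative to \<open>\<nu>\<close> evolves under \<open>T\<close> itself (\<open>distr_density_flow\<close>).

  The limit in the number of samples is the strong law of large numbers for integrable functions
  of the snapshot pairs. It is proved by Garsia's maximal ergodic argument on the space of streams
  (\<open>AE_running_max_bounded\<close>); second moments cannot be used, since products of two \<open>L\<^sup>2\<close> functions are
  only integrable. As the dictionary is orthonormal, the empirical Gram matrices converge to
  the identity, so they are eventually invertible and their pseudoinverses converge as well
  (\<open>tendsto_pinv_one\<close>). The Galerkin operator is the compression \<open>P\<^sub>n K P\<^sub>n\<close>, and its strong convergence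
  follows from \<open>\<parallel>K\<parallel> \<le> 1\<close> (\<open>galerkin_strong_limit\<close>).

  The eigenfunctions of the generator are eigenfunctions of every \<open>T t\<close> (\<open>T_eigenfunction\<close>), so the
  Fourier coefficients of \<open>T t f\<^sub>0\<close> are \<open>c\<^sub>i exp (\<lambda>\<^sub>i t)\<close>. For \<open>t > 0\<close> these decay so fast that the orbit is
  differentiable in norm, and symmetry lets the generator act on test functions instead
  (\<open>T_differentiable\<close>); this is the Fokker-Planck equation in the sense of distributions.

  For the approximate densities, symmetry of the Galerkin operator makes its eigenfunctions
  orthonormal, and \<open>\<langle>T \<Delta>t g, g\<rangle> = \<parallel>T (\<Delta>t/2) g\<parallel>\<^sup>2\<close> places its eigenvalues in \<open>(0,1]\<close>
  (\<open>galerkin_eigenpairs\<close>). Bessel's inequality then bounds the tails of the approximate series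
  uniformly, and the termwise limits may be summed (\<open>approx_spectral_limit\<close>). The Monte Carlo
  coefficients are absorbed by taking, for each dictionary size, enough samples to make their total
  error small.\<close>

section \<open>The Hilbert space structure of square-integrable functions\<close>

lemma l2_measurable: "l2 N f \<Longrightarrow> f \<in> borel_measurable N"
  by (simp add: l2_def)

lemma l2_integrable_mult:
  assumes "l2 N f" "l2 N g"
  shows "integrable N (\<lambda>x. f x * g x)"
proof (rule Bochner_Integration.integrable_bound)
  show "integrable N (\<lambda>x. (f x)\<^sup>2 + (g x)\<^sup>2)"
    using assms by (simp add: l2_def)
  show "(\<lambda>x. f x * g x) \<in> borel_measurable N"
    using assms by (auto simp: l2_def)
  have "\<bar>a * b\<bar> \<le> a\<^sup>2 + b\<^sup>2" for a b :: real
    using sum_squares_bound[of "\<bar>a\<bar>" "\<bar>b\<bar>"] zero_le_mult_iff[of "\<bar>a\<bar>" "\<bar>b\<bar>"]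
    by (simp only: abs_mult power2_abs) linarith
  then show "AE x in N. norm (f x * g x) \<le> norm ((f x)\<^sup>2 + (g x)\<^sup>2)"
    by auto
qed

lemma l2_scale: "l2 N f \<Longrightarrow> l2 N (\<lambda>x. a * f x)"
  by (auto simp: l2_def power_mult_distrib)

lemma l2_add:
  assumes "l2 N f" "l2 N g"
  shows "l2 N (\<lambda>x. f x + g x)"
proof -
  have "integrable N (\<lambda>x. (f x)\<^sup>2 + (g x)\<^sup>2 + 2 * (f x * g x))"
    using assms l2_integrable_mult[OF assms] by (simp add: l2_def)
  then show ?thesis
    using assms by (auto simp: l2_def power2_eq_square algebra_simps)
qed

lemma l2_diff:
  assumes "l2 N f" "l2 N g"
  shows "l2 N (\<lambda>x. f x - g x)"
  using l2_add[OF assms(1) l2_scale[OF assms(2), of "-1"]] by simp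

lemma l2_zero: "l2 N (\<lambda>x. 0)"
  by (simp add: l2_def)

lemma l2_sum: "(\<And>i. i \<in> I \<Longrightarrow> l2 N (f i)) \<Longrightarrow> l2 N (\<lambda>x. \<Sum>i\<in>I. f i x)"
  by (induction I rule: infinite_finite_induct) (auto intro: l2_zero l2_add)

lemma l2_inner_commute: "l2_inner N f g = l2_inner N g f"
  by (simp add: l2_inner_def mult.commute)

lemma l2_inner_add_left:
  "l2 N f \<Longrightarrow> l2 N g \<Longrightarrow> l2 N h \<Longrightarrow>
    l2_inner N (\<lambda>x. f x + g x) h = l2_inner N f h + l2_inner N g h"
  by (simp add: l2_inner_def distrib_right l2_integrable_mult)

lemma l2_inner_diff_left:
  "l2 N f \<Longrightarrow> l2 N g \<Longrightarrow> l2 N h \<Longrightarrow>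
    l2_inner N (\<lambda>x. f x - g x) h = l2_inner N f h - l2_inner N g h"
  by (simp add: l2_inner_def left_diff_distrib l2_integrable_mult)

lemma l2_inner_scale_left: "l2_inner N (\<lambda>x. a * f x) h = a * l2_inner N f h"
  by (simp add: l2_inner_def mult.assoc)

lemma l2_inner_sum_left:
  assumes "\<And>i. i \<in> I \<Longrightarrow> l2 N (f i)" "l2 N h"
  shows "l2_inner N (\<lambda>x. \<Sum>i\<in>I. f i x) h = (\<Sum>i\<in>I. l2_inner N (f i) h)"
  using assms
  by (simp add: l2_inner_def sum_distrib_right l2_integrable_mult)

lemma l2_inner_add_right:
  "l2 N f \<Longrightarrow> l2 N g \<Longrightarrow> l2 N h \<Longrightarrow>
    l2_inner N h (\<lambda>x. f x + g x) = l2_inner N h f + l2_inner N h g"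
  using l2_inner_add_left[of N f g h] by (simp add: l2_inner_commute[of N h])

lemma l2_inner_diff_right:
  "l2 N f \<Longrightarrow> l2 N g \<Longrightarrow> l2 N h \<Longrightarrow>
    l2_inner N h (\<lambda>x. f x - g x) = l2_inner N h f - l2_inner N h g"
  using l2_inner_diff_left[of N f g h] by (simp add: l2_inner_commute[of N h])

lemma l2_inner_scale_right: "l2_inner N h (\<lambda>x. a * f x) = a * l2_inner N h f"
  using l2_inner_scale_left[of N a f h] by (simp add: l2_inner_commute[of N h])

lemma l2_inner_sum_right:
  assumes "\<And>i. i \<in> I \<Longrightarrow> l2 N (f i)" "l2 N h"
  shows "l2_inner N h (\<lambda>x. \<Sum>i\<in>I. f i x) = (\<Sum>i\<in>I. l2_inner N h (f i))"
  using l2_inner_sum_left[of I N f h] assms by (simp add: l2_inner_commute)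

lemma l2_inner_zero_left [simp]: "l2_inner N (\<lambda>x. 0) h = 0"
  by (simp add: l2_inner_def)

lemma l2_inner_cong_AE:
  assumes "AE x in N. f x = f' x" "AE x in N. g x = g' x"
    "f \<in> borel_measurable N" "f' \<in> borel_measurable N"
    "g \<in> borel_measurable N" "g' \<in> borel_measurable N"
  shows "l2_inner N f g = l2_inner N f' g'"
  unfolding l2_inner_def using assms by (intro integral_cong_AE) auto

lemma l2_inner_self_nonneg: "0 \<le> l2_inner N f f"
  by (simp add: l2_inner_def)

lemma l2_norm_nonneg [simp]: "0 \<le> l2_norm N f"
  by (simp add: l2_norm_def l2_inner_self_nonneg)

lemma l2_norm_sq: "(l2_norm N f)\<^sup>2 = l2_inner N f f"
  by (simp add: l2_norm_def l2_inner_self_nonneg)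

lemma l2_norm_sq_integral: "(l2_norm N f)\<^sup>2 = (\<integral>x. (f x)\<^sup>2 \<partial>N)"
  unfolding l2_norm_sq by (simp add: l2_inner_def power2_eq_square)

lemma l2_norm_cong_AE:
  assumes "AE x in N. f x = g x" "f \<in> borel_measurable N" "g \<in> borel_measurable N"
  shows "l2_norm N f = l2_norm N g"
  unfolding l2_norm_def using l2_inner_cong_AE[OF assms(1,1)] assms by simp

lemma l2_norm_scale: "l2_norm N (\<lambda>x. a * f x) = \<bar>a\<bar> * l2_norm N f"
  by (simp add: l2_norm_def l2_inner_scale_left l2_inner_scale_right real_sqrt_mult
      flip: mult.assoc power2_eq_square)

lemma l2_norm_minus_commute: "l2_norm N (\<lambda>x. f x - g x) = l2_norm N (\<lambda>x. g x - f x)"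
  using l2_norm_scale[of N "-1" "\<lambda>x. f x - g x"] by simp

text \<open>The discriminant of the nonnegative quadratic polynomial \<open>\<parallel>f\<parallel>\<^sup>2 - 2 s \<langle>f, g\<rangle> + s\<^sup>2 \<parallel>g\<parallel>\<^sup>2\<close>
  in \<open>s\<close> is not positive.\<close>

lemma l2_Cauchy_Schwarz:
  assumes f: "l2 N f" and g: "l2 N g"
  shows "\<bar>l2_inner N f g\<bar> \<le> l2_norm N f * l2_norm N g"
proof -
  define A B C where "A = l2_inner N f f" and "B = l2_inner N f g" and "C = l2_inner N g g"
  have q: "0 \<le> A - 2 * s * B + s\<^sup>2 * C" for s
  proof -
    have "0 \<le> l2_inner N (\<lambda>x. f x - s * g x) (\<lambda>x. f x - s * g x)"
      by (rule l2_inner_self_nonneg)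
    also have "\<dots> = A - 2 * s * B + s\<^sup>2 * C"
      using f g l2_scale[OF g, of s] l2_diff[OF f l2_scale[OF g, of s]]
      by (simp add: l2_inner_diff_left l2_inner_diff_right l2_inner_scale_left l2_inner_scale_right
          A_def B_def C_def l2_inner_commute[of N g f] power2_eq_square algebra_simps)
    finally show ?thesis .
  qed
  have AC: "0 \<le> A" "0 \<le> C" by (simp_all add: A_def C_def l2_inner_self_nonneg)
  have "B\<^sup>2 \<le> A * C"
  proof (cases "C = 0")
    case True
    have "B = 0"
    proof (rule ccontr)
      assume "B \<noteq> 0"
      then show False using q[of "(A + 1) / (2 * B)"] True by simp
    qed
    then show ?thesis using AC by simp
  next
    case False
    then have "0 < C" using AC by simp
    have "0 \<le> A - B\<^sup>2 / C" using q[of "B / C"] False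
      by (simp add: power2_eq_square)
    then show ?thesis using \<open>0 < C\<close> by (simp add: field_simps)
  qed
  then have "\<bar>B\<bar> \<le> sqrt (A * C)" using real_le_rsqrt[of "\<bar>B\<bar>"] by simp
  then show ?thesis by (simp add: l2_norm_def A_def B_def C_def real_sqrt_mult)
qed

lemma l2_norm_add_le:
  assumes f: "l2 N f" and g: "l2 N g"
  shows "l2_norm N (\<lambda>x. f x + g x) \<le> l2_norm N f + l2_norm N g"
proof (rule power2_le_imp_le)
  have "(l2_norm N (\<lambda>x. f x + g x))\<^sup>2 = l2_inner N f f + 2 * l2_inner N f g + l2_inner N g g"
    using f g l2_add[OF f g]
    by (simp add: l2_norm_sq l2_inner_add_left l2_inner_add_right l2_inner_commute[of N g f])
  also have "\<dots> \<le> (l2_norm N f)\<^sup>2 + 2 * (l2_norm N f * l2_norm N g) + (l2_norm N g)\<^sup>2"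
    using l2_Cauchy_Schwarz[OF f g] by (simp add: l2_norm_sq abs_le_iff)
  also have "\<dots> = (l2_norm N f + l2_norm N g)\<^sup>2" by (simp add: power2_eq_square algebra_simps)
  finally show "(l2_norm N (\<lambda>x. f x + g x))\<^sup>2 \<le> (l2_norm N f + l2_norm N g)\<^sup>2" .
qed simp

lemma l2_norm_diff_le:
  assumes f: "l2 N f" and g: "l2 N g"
  shows "l2_norm N (\<lambda>x. f x - g x) \<le> l2_norm N f + l2_norm N g"
  using l2_norm_add_le[OF f l2_scale[OF g, of "-1"]] l2_norm_scale[of N "-1" g] by simp

lemma l2_norm_diff_triangle:
  assumes "l2 N f" "l2 N g" "l2 N h"
  shows "l2_norm N (\<lambda>x. f x - h x) \<le> l2_norm N (\<lambda>x. f x - g x) + l2_norm N (\<lambda>x. g x - h x)"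
  using l2_norm_add_le[OF l2_diff[OF assms(1,2)] l2_diff[OF assms(2,3)]] by simp

lemma l2_norm_eq_0_iff:
  assumes "l2 N f"
  shows "l2_norm N f = 0 \<longleftrightarrow> (AE x in N. f x = 0)"
proof -
  have "l2_norm N f = 0 \<longleftrightarrow> (\<integral>x. (f x)\<^sup>2 \<partial>N) = 0"
    by (simp add: l2_norm_def l2_inner_def power2_eq_square)
  also have "\<dots> \<longleftrightarrow> (AE x in N. (f x)\<^sup>2 = 0)"
    using assms by (intro integral_nonneg_eq_0_iff_AE) (auto simp: l2_def)
  finally show ?thesis by simp
qed

lemma l2_norm_diff_eq_0_iff:
  assumes "l2 N f" "l2 N g"
  shows "l2_norm N (\<lambda>x. f x - g x) = 0 \<longleftrightarrow> (AE x in N. f x = g x)"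
  using l2_norm_eq_0_iff[OF l2_diff[OF assms]] by simp

lemma l2_limD:
  assumes "l2_lim N u f \<F>"
  shows "l2 N f" "\<forall>\<^sub>F n in \<F>. l2 N (u n)" "((\<lambda>n. l2_norm N (\<lambda>x. u n x - f x)) \<longlongrightarrow> 0) \<F>"
  using assms by (auto simp: l2_lim_def)

lemma l2_lim_inner:
  assumes u: "l2_lim N u f \<F>" and h: "l2 N h"
  shows "((\<lambda>n. l2_inner N (u n) h) \<longlongrightarrow> l2_inner N f h) \<F>"
proof -
  have "((\<lambda>n. l2_norm N (\<lambda>x. u n x - f x) * l2_norm N h) \<longlongrightarrow> 0) \<F>"
    using tendsto_mult_left_zero[OF l2_limD(3)[OF u]] .
  moreover have "\<forall>\<^sub>F n in \<F>.
      norm (l2_inner N (u n) h - l2_inner N f h) \<le> l2_norm N (\<lambda>x. u n x - f x) * l2_norm N h"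
    using l2_limD(2)[OF u]
  proof eventually_elim
    case (elim n)
    then show ?case
      using l2_Cauchy_Schwarz[OF l2_diff[OF elim l2_limD(1)[OF u]] h]
        l2_inner_diff_left[OF elim l2_limD(1)[OF u] h] by simp
  qed
  ultimately have "((\<lambda>n. l2_inner N (u n) h - l2_inner N f h) \<longlongrightarrow> 0) \<F>"
    by (rule Lim_null_comparison[rotated])
  then show ?thesis by (simp add: LIM_zero_iff)
qed

lemma l2_lim_norm:
  assumes u: "l2_lim N u f \<F>"
  shows "((\<lambda>n. l2_norm N (u n)) \<longlongrightarrow> l2_norm N f) \<F>"
proof -
  have "\<forall>\<^sub>F n in \<F>. norm (l2_norm N (u n) - l2_norm N f) \<le> l2_norm N (\<lambda>x. u n x - f x)"
    using l2_limD(2)[OF u]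
  proof eventually_elim
    case (elim n)
    note f = l2_limD(1)[OF u]
    have "l2_norm N (u n) \<le> l2_norm N (\<lambda>x. u n x - f x) + l2_norm N f"
      using l2_norm_add_le[OF l2_diff[OF elim f] f] by simp
    moreover have "l2_norm N f \<le> l2_norm N (\<lambda>x. u n x - f x) + l2_norm N (u n)"
      using l2_norm_add_le[OF l2_diff[OF f elim] elim] l2_norm_minus_commute[of N f "u n"] by simp
    ultimately show ?case by (simp add: abs_le_iff)
  qed
  from Lim_null_comparison[OF this l2_limD(3)[OF u]] show ?thesis
    by (simp add: LIM_zero_iff)
qed

lemma l2_lim_cong_AE:
  assumes u: "l2_lim N u f \<F>"
    and ev: "\<forall>\<^sub>F n in \<F>. l2 N (v n) \<and> (AE x in N. v n x = u n x)"
    and g: "l2 N g" "AE x in N. g x = f x"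
  shows "l2_lim N v g \<F>"
  unfolding l2_lim_def
proof (intro conjI g)
  show "\<forall>\<^sub>F n in \<F>. l2 N (v n)" using ev by (rule eventually_mono) simp
  have "\<forall>\<^sub>F n in \<F>. l2_norm N (\<lambda>x. u n x - f x) = l2_norm N (\<lambda>x. v n x - g x)"
    using ev l2_limD(2)[OF u]
  proof eventually_elim
    case (elim n)
    then have ae: "AE x in N. v n x = u n x" and vn: "l2 N (v n)" by auto
    show ?case
    proof (rule l2_norm_cong_AE)
      show "AE x in N. u n x - f x = v n x - g x" using ae g(2) by eventually_elim simp
    qed (use vn elim(2) g(1) l2_limD(1)[OF u] in \<open>auto simp: l2_def\<close>)
  qed
  from Lim_transform_eventually[OF l2_limD(3)[OF u] this]
  show "((\<lambda>n. l2_norm N (\<lambda>x. v n x - g x)) \<longlongrightarrow> 0) \<F>" .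
qed

section \<open>Orthonormal families\<close>

lemma orthonormal_inner_combination:
  fixes e :: "nat \<Rightarrow> 'x \<Rightarrow> real"
  assumes "\<And>i. i < n \<Longrightarrow> l2 N (e i)"
    and "\<And>i j. i < n \<Longrightarrow> j < n \<Longrightarrow> l2_inner N (e i) (e j) = (if i = j then 1 else 0)"
    and "j < n"
  shows "l2_inner N (\<lambda>x. \<Sum>i<n. a i * e i x) (e j) = a j"
proof -
  have "l2_inner N (\<lambda>x. \<Sum>i<n. a i * e i x) (e j) = (\<Sum>i<n. l2_inner N (\<lambda>x. a i * e i x) (e j))"
    using assms by (intro l2_inner_sum_left) (auto intro: l2_scale)
  also have "\<dots> = (\<Sum>i<n. if i = j then a i else 0)"
    using assms by (intro sum.cong) (auto simp: l2_inner_scale_left)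
  finally show ?thesis using \<open>j < n\<close> by simp
qed

lemma orthonormal_inner_combinations:
  fixes e :: "nat \<Rightarrow> 'x \<Rightarrow> real"
  assumes "\<And>i. i < n \<Longrightarrow> l2 N (e i)"
    and "\<And>i j. i < n \<Longrightarrow> j < n \<Longrightarrow> l2_inner N (e i) (e j) = (if i = j then 1 else 0)"
  shows "l2_inner N (\<lambda>x. \<Sum>i<n. a i * e i x) (\<lambda>x. \<Sum>i<n. b i * e i x) = (\<Sum>i<n. a i * b i)"
proof -
  have "l2_inner N (\<lambda>x. \<Sum>i<n. a i * e i x) (\<lambda>x. \<Sum>i<n. b i * e i x)
    = (\<Sum>j<n. l2_inner N (\<lambda>x. \<Sum>i<n. a i * e i x) (\<lambda>x. b j * e j x))"
    using assms by (intro l2_inner_sum_right) (auto intro!: l2_scale l2_sum)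
  also have "\<dots> = (\<Sum>j<n. a j * b j)"
    using assms by (intro sum.cong refl)
      (simp add: l2_inner_scale_right orthonormal_inner_combination mult.commute)
  finally show ?thesis .
qed

lemma orthonormal_norm_combination:
  fixes e :: "nat \<Rightarrow> 'x \<Rightarrow> real"
  assumes "\<And>i. i < n \<Longrightarrow> l2 N (e i)"
    and "\<And>i j. i < n \<Longrightarrow> j < n \<Longrightarrow> l2_inner N (e i) (e j) = (if i = j then 1 else 0)"
  shows "(l2_norm N (\<lambda>x. \<Sum>i<n. a i * e i x))\<^sup>2 = (\<Sum>i<n. (a i)\<^sup>2)"
  using orthonormal_inner_combinations[of n N e a a] assms
  unfolding l2_norm_sq by (simp add: power2_eq_square)

text \<open>The squared distance of \<open>f\<close> to its projection onto the span is not negative.\<close>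

lemma Bessel_inequality:
  fixes e :: "nat \<Rightarrow> 'x \<Rightarrow> real"
  assumes e: "\<And>i. i < n \<Longrightarrow> l2 N (e i)"
    and on: "\<And>i j. i < n \<Longrightarrow> j < n \<Longrightarrow> l2_inner N (e i) (e j) = (if i = j then 1 else 0)"
    and f: "l2 N f"
  shows "(\<Sum>i<n. (l2_inner N f (e i))\<^sup>2) \<le> (l2_norm N f)\<^sup>2"
proof -
  define g where "g = (\<lambda>x. \<Sum>i<n. l2_inner N f (e i) * e i x)"
  have g: "l2 N g" unfolding g_def using e by (auto intro!: l2_scale l2_sum)
  have fg: "l2_inner N f g = (\<Sum>i<n. (l2_inner N f (e i))\<^sup>2)"
  proof -
    have "l2_inner N f g = (\<Sum>i<n. l2_inner N f (\<lambda>x. l2_inner N f (e i) * e i x))"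
      unfolding g_def using e f by (intro l2_inner_sum_right) (auto intro!: l2_scale)
    then show ?thesis by (simp add: l2_inner_scale_right power2_eq_square)
  qed
  have gg: "l2_inner N g g = (\<Sum>i<n. (l2_inner N f (e i))\<^sup>2)"
    using orthonormal_norm_combination[OF e on] unfolding g_def by (simp add: l2_norm_sq)
  have "0 \<le> l2_inner N (\<lambda>x. f x - g x) (\<lambda>x. f x - g x)" by (rule l2_inner_self_nonneg)
  also have "\<dots> = l2_inner N f f - (\<Sum>i<n. (l2_inner N f (e i))\<^sup>2)"
    using f g l2_diff[OF f g]
    by (simp add: l2_inner_diff_left l2_inner_diff_right l2_inner_commute[of N g f] fg gg)
  finally show ?thesis by (simp add: l2_norm_sq)
qed

lemma l2_orthonormal_basisD:
  assumes "l2_orthonormal_basis N e"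
  shows "l2 N (e i)" "l2_inner N (e i) (e j) = (if i = j then 1 else 0)"
    "l2 N f \<Longrightarrow> l2_lim N (\<lambda>n x. \<Sum>i<n. l2_inner N f (e i) * e i x) f sequentially"
  using assms by (auto simp: l2_orthonormal_basis_def)

lemma Parseval:
  assumes e: "l2_orthonormal_basis N e" and f: "l2 N f"
  shows "(\<lambda>i. (l2_inner N f (e i))\<^sup>2) sums (l2_norm N f)\<^sup>2"
proof -
  note e = l2_orthonormal_basisD[OF e]
  have "(\<lambda>n. (l2_norm N (\<lambda>x. \<Sum>i<n. l2_inner N f (e i) * e i x))\<^sup>2) \<longlonglongrightarrow> (l2_norm N f)\<^sup>2"
    by (intro tendsto_power l2_lim_norm e(3) f)
  then show ?thesis
    by (simp add: sums_def orthonormal_norm_combination[OF e(1,2)])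
qed

lemma l2_eq_0_if_coefficients_eq_0:
  assumes e: "l2_orthonormal_basis N e" and f: "l2 N f" and "\<And>i. l2_inner N f (e i) = 0"
  shows "AE x in N. f x = 0"
  using sums_unique2[OF Parseval[OF e f], of 0] assms(3) l2_norm_eq_0_iff[OF f] by simp

lemma AE_summable_if_integrals_summable:
  fixes f :: "nat \<Rightarrow> 'x \<Rightarrow> real"
  assumes f: "\<And>k. integrable N (f k)" "\<And>k x. 0 \<le> f k x"
    and b: "\<And>k. (\<integral>x. f k x \<partial>N) \<le> B k" "summable B"
  shows "AE x in N. summable (\<lambda>k. f k x)"
proof -
  have [measurable]: "f k \<in> borel_measurable N" for k using f by auto
  have "0 \<le> (\<integral>x. f k x \<partial>N)" for k
    by (rule Bochner_Integration.integral_nonneg) (rule f(2))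
  then have B0: "0 \<le> B k" for k
    using b(1) order_trans by blast
  have "(\<integral>\<^sup>+x. (\<Sum>k. ennreal (f k x)) \<partial>N) = (\<Sum>k. \<integral>\<^sup>+x. ennreal (f k x) \<partial>N)"
    by (rule nn_integral_suminf) simp
  also have "\<dots> = (\<Sum>k. ennreal (\<integral>x. f k x \<partial>N))"
    using f by (intro suminf_cong nn_integral_eq_integral) auto
  also have "\<dots> \<le> (\<Sum>k. ennreal (B k))"
    using b by (intro suminf_le) (auto intro: ennreal_leI)
  also have "\<dots> = ennreal (\<Sum>k. B k)"
    using B0 b by (intro suminf_ennreal2) auto
  finally have "(\<integral>\<^sup>+x. (\<Sum>k. ennreal (f k x)) \<partial>N) \<noteq> \<infinity>"
    by (auto simp: top_unique)
  then have "AE x in N. (\<Sum>k. ennreal (f k x)) \<noteq> \<infinity>"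
    by (intro nn_integral_PInf_AE) auto
  then show ?thesis
  proof eventually_elim
    case (elim x)
    then show ?case using f(2) by (intro summable_suminf_not_top) auto
  qed
qed

text \<open>Along a subsequence whose successive distances are at most \<open>2\<^sup>-\<^sup>k\<close> the increments are absolutely summable almost everywhere; Fatou's lemma turns the
  pointwise limit into a limit in norm.\<close>

lemma l2_complete:
  fixes u :: "nat \<Rightarrow> 'x \<Rightarrow> real"
  assumes fin: "finite_measure N"
    and u: "\<And>n. l2 N (u n)"
    and cauchy: "\<And>e. 0 < e \<Longrightarrow> \<exists>n0. \<forall>m\<ge>n0. \<forall>n\<ge>n0. l2_norm N (\<lambda>x. u m x - u n x) \<le> e"
  obtains g where "l2_lim N u g sequentially"
proof -
  interpret finite_measure N by (rule fin)
  have one: "l2 N (\<lambda>x. 1)" by (simp add: l2_def)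
  have [measurable]: "u n \<in> borel_measurable N" for n using u by (simp add: l2_def)
  have "\<exists>n0. \<forall>k. \<forall>m\<ge>n0 k. \<forall>n\<ge>n0 k. l2_norm N (\<lambda>x. u m x - u n x) \<le> (1/2)^k"
    using cauchy[of "(1/2)^k" for k] by (intro choice) auto
  then obtain n0 where n0: "\<And>k m n. n0 k \<le> m \<Longrightarrow> n0 k \<le> n \<Longrightarrow> l2_norm N (\<lambda>x. u m x - u n x) \<le> (1/2)^k"
    by blast
  \<comment> \<open>increasing, tending to infinity, and dominating \<open>n0\<close>\<close>
  define s where "s k = k + (\<Sum>i\<le>k. n0 i)" for k
  have s_n0: "n0 k \<le> s k" for k
    unfolding s_def using member_le_sum[of k "{..k}" n0] by simp
  have s_Suc: "s k \<le> s (Suc k)" for k by (simp add: s_def)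
  have s_ge: "k \<le> s k" for k by (simp add: s_def)
  define d where "d k x = \<bar>u (s (Suc k)) x - u (s k) x\<bar>" for k x
  have d_l2: "l2 N (d k)" for k
    using l2_diff[OF u u, of "s (Suc k)" "s k"] by (auto simp: d_def[abs_def] l2_def)
  have "AE x in N. summable (\<lambda>k. d k x)"
  proof (rule AE_summable_if_integrals_summable)
    show "integrable N (d k)" for k
      using l2_integrable_mult[OF d_l2 one, of k] by simp
    show "0 \<le> d k x" for k x by (simp add: d_def)
    show "(\<integral>x. d k x \<partial>N) \<le> (1/2)^k * l2_norm N (\<lambda>x. 1)" for k
    proof -
      have "(\<integral>x. d k x \<partial>N) \<le> l2_norm N (d k) * l2_norm N (\<lambda>x. 1)"
        using l2_Cauchy_Schwarz[OF d_l2 one, of k] by (simp add: l2_inner_def abs_le_iff)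
      also have "l2_norm N (d k) = l2_norm N (\<lambda>x. u (s (Suc k)) x - u (s k) x)"
        by (simp add: l2_norm_def l2_inner_def d_def)
      also have "\<dots> \<le> (1/2)^k"
        using n0 s_n0 s_Suc order_trans by metis
      finally show ?thesis by (simp add: mult_right_mono)
    qed
    show "summable (\<lambda>k. (1/2)^k * l2_norm N (\<lambda>x. 1))"
      by (intro summable_mult2 summable_geometric) simp
  qed
  then have conv: "AE x in N. convergent (\<lambda>k. u (s k) x)"
  proof eventually_elim
    case (elim x)
    have "summable (\<lambda>k. u (s (Suc k)) x - u (s k) x)"
      by (rule summable_rabs_cancel) (use elim in \<open>simp add: d_def\<close>)
    then have "convergent (\<lambda>n. \<Sum>k<n. u (s (Suc k)) x - u (s k) x)"
      by (simp add: summable_iff_convergent)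
    then have "convergent (\<lambda>n. u (s n) x - u (s 0) x)"
      by (simp add: sum_lessThan_telescope[of "\<lambda>k. u (s k) x"])
    then show ?case
      using convergent_add_const_iff[of "- u (s 0) x" "\<lambda>n. u (s n) x"] by simp
  qed
  define g where "g x = lim (\<lambda>k. u (s k) x)" for x
  have [measurable]: "g \<in> borel_measurable N"
    unfolding g_def by (rule borel_measurable_lim_metric) simp
  have bound: "l2 N (\<lambda>x. g x - u n x) \<and> l2_norm N (\<lambda>x. g x - u n x) \<le> (1/2)^k"
    if n: "n0 k \<le> n" for k n
  proof -
    have "(\<integral>\<^sup>+x. ennreal ((g x - u n x)\<^sup>2) \<partial>N)
        \<le> (\<integral>\<^sup>+x. liminf (\<lambda>j. ennreal ((u (s j) x - u n x)\<^sup>2)) \<partial>N)"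
    proof (rule nn_integral_mono_AE)
      show "AE x in N. ennreal ((g x - u n x)\<^sup>2) \<le> liminf (\<lambda>j. ennreal ((u (s j) x - u n x)\<^sup>2))"
        using conv
      proof eventually_elim
        case (elim x)
        then have "(\<lambda>j. u (s j) x) \<longlonglongrightarrow> g x" by (simp add: g_def convergent_LIMSEQ_iff)
        then have "(\<lambda>j. ennreal ((u (s j) x - u n x)\<^sup>2)) \<longlonglongrightarrow> ennreal ((g x - u n x)\<^sup>2)"
          by (intro tendsto_intros)
        then show ?case using lim_imp_Liminf[OF sequentially_bot] by (metis order_refl)
      qed
    qed
    also have "\<dots> \<le> liminf (\<lambda>j. \<integral>\<^sup>+x. ennreal ((u (s j) x - u n x)\<^sup>2) \<partial>N)"
      by (rule nn_integral_liminf) simp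
    also have "\<dots> \<le> limsup (\<lambda>j. \<integral>\<^sup>+x. ennreal ((u (s j) x - u n x)\<^sup>2) \<partial>N)"
      by (rule Liminf_le_Limsup) simp
    also have "\<dots> \<le> ennreal (((1/2)^k)\<^sup>2)"
    proof (rule Limsup_bounded)
      show "\<forall>\<^sub>F j in sequentially. (\<integral>\<^sup>+x. ennreal ((u (s j) x - u n x)\<^sup>2) \<partial>N) \<le> ennreal (((1/2)^k)\<^sup>2)"
        using eventually_ge_at_top[of "n0 k"]
      proof eventually_elim
        case (elim j)
        have "(\<integral>\<^sup>+x. ennreal ((u (s j) x - u n x)\<^sup>2) \<partial>N) = ennreal (\<integral>x. (u (s j) x - u n x)\<^sup>2 \<partial>N)"
          using l2_diff[OF u u, of "s j" n] by (intro nn_integral_eq_integral) (auto simp: l2_def)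
        also have "(\<integral>x. (u (s j) x - u n x)\<^sup>2 \<partial>N) = (l2_norm N (\<lambda>x. u (s j) x - u n x))\<^sup>2"
          by (simp add: l2_norm_sq_integral)
        also have "\<dots> \<le> ((1/2)^k)\<^sup>2"
          using n0[of k "s j" n] n elim s_ge[of j] by (intro power_mono) auto
        finally show ?case by (simp add: ennreal_leI)
      qed
    qed
    finally have le: "(\<integral>\<^sup>+x. ennreal ((g x - u n x)\<^sup>2) \<partial>N) \<le> ennreal (((1/2)^k)\<^sup>2)" .
    have int: "integrable N (\<lambda>x. (g x - u n x)\<^sup>2)"
      by (rule integrableI_bounded) (use le in \<open>auto intro: le_less_trans[OF _ ennreal_less_top]\<close>)
    have "ennreal (\<integral>x. (g x - u n x)\<^sup>2 \<partial>N) \<le> ennreal (((1/2)^k)\<^sup>2)"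
      using le int by (simp add: nn_integral_eq_integral)
    then have "(\<integral>x. (g x - u n x)\<^sup>2 \<partial>N) \<le> ((1/2)^k)\<^sup>2"
      by (simp add: ennreal_le_iff)
    then have "(l2_norm N (\<lambda>x. g x - u n x))\<^sup>2 \<le> ((1/2)^k)\<^sup>2"
      by (simp add: l2_norm_sq_integral)
    then have "l2_norm N (\<lambda>x. g x - u n x) \<le> (1/2)^k"
      by (rule power2_le_imp_le) simp
    with int show ?thesis by (simp add: l2_def)
  qed
  have g: "l2 N g"
    using l2_add[OF conjunct1[OF bound[of 0 "n0 0"]] u[of "n0 0"]] by simp
  have "(\<lambda>n. l2_norm N (\<lambda>x. u n x - g x)) \<longlonglongrightarrow> 0"
  proof (rule LIMSEQ_I)
    fix e :: real assume "0 < e"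
    then obtain k where k: "(1/2)^k < e" using real_arch_pow_inv[of e "1/2"] by auto
    have "norm (l2_norm N (\<lambda>x. u n x - g x) - 0) < e" if "n0 k \<le> n" for n
      using conjunct2[OF bound[OF that]] k l2_norm_minus_commute[of N g "u n"] by simp
    then show "\<exists>no. \<forall>n\<ge>no. norm (l2_norm N (\<lambda>x. u n x - g x) - 0) < e" by blast
  qed
  with g u that show ?thesis by (simp add: l2_lim_def)
qed

lemma Riesz_Fischer:
  assumes fin: "finite_measure N" and e: "l2_orthonormal_basis N e"
    and a: "summable (\<lambda>i. (a i)\<^sup>2)"
  obtains g where "l2 N g" "\<And>i. l2_inner N g (e i) = a i"
proof -
  note e = l2_orthonormal_basisD[OF e]
  define u where "u n x = (\<Sum>i<n. a i * e i x)" for n x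
  have u: "l2 N (u n)" for n
    unfolding u_def[abs_def] by (intro l2_sum l2_scale e)
  have diff: "l2_norm N (\<lambda>x. u m x - u n x) = sqrt (\<Sum>i\<in>{n..<m}. (a i)\<^sup>2)" if "n \<le> m" for m n
  proof -
    have "(\<lambda>x. u m x - u n x) = (\<lambda>x. \<Sum>i<m. (if n \<le> i then a i else 0) * e i x)"
    proof
      fix x
      have "u m x = u n x + (\<Sum>i\<in>{n..<m}. a i * e i x)"
        unfolding u_def using that
        by (subst sum.union_disjoint[symmetric]) (auto intro!: sum.cong)
      moreover have "(\<Sum>i<m. (if n \<le> i then a i else 0) * e i x) = (\<Sum>i\<in>{n..<m}. a i * e i x)"
        by (rule sum.mono_neutral_cong_right) auto
      ultimately show "u m x - u n x = (\<Sum>i<m. (if n \<le> i then a i else 0) * e i x)" by simp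
    qed
    then have "(l2_norm N (\<lambda>x. u m x - u n x))\<^sup>2 = (\<Sum>i<m. (if n \<le> i then a i else 0)\<^sup>2)"
      using orthonormal_norm_combination[OF e(1,2)] by simp
    also have "\<dots> = (\<Sum>i\<in>{n..<m}. (a i)\<^sup>2)"
      by (rule sum.mono_neutral_cong_right) auto
    finally show ?thesis by (metis l2_norm_nonneg real_sqrt_unique)
  qed
  obtain g where g: "l2_lim N u g sequentially"
  proof (rule l2_complete[OF fin u])
    fix \<epsilon> :: real assume "0 < \<epsilon>"
    then obtain n0 where n0: "\<And>m n. n0 \<le> m \<Longrightarrow> norm (\<Sum>i\<in>{m..<n}. (a i)\<^sup>2) < \<epsilon>\<^sup>2"
      using a unfolding summable_Cauchy by (metis zero_less_power)
    have "l2_norm N (\<lambda>x. u m x - u n x) \<le> \<epsilon>" if "n0 \<le> m" "n0 \<le> n" "n \<le> m" for m n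
      using n0[OF that(2), of m] \<open>0 < \<epsilon>\<close> unfolding diff[OF that(3)]
      by (intro real_le_lsqrt) (auto intro!: sum_nonneg simp: abs_less_iff)
    then have "l2_norm N (\<lambda>x. u m x - u n x) \<le> \<epsilon>" if "n0 \<le> m" "n0 \<le> n" for m n
      using that l2_norm_minus_commute[of N "u m" "u n"] by (metis nat_le_linear)
    then show "\<exists>n0. \<forall>m\<ge>n0. \<forall>n\<ge>n0. l2_norm N (\<lambda>x. u m x - u n x) \<le> \<epsilon>" by blast
  qed
  show ?thesis
  proof
    show "l2 N g" by (rule l2_limD(1)[OF g])
    fix i
    have "\<forall>\<^sub>F n in sequentially. l2_inner N (u n) (e i) = a i"
      using eventually_gt_at_top[of i] unfolding u_def[abs_def]
      by eventually_elim (simp add: orthonormal_inner_combination[OF e(1,2)])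
    then have "(\<lambda>n. l2_inner N (u n) (e i)) \<longlonglongrightarrow> a i" by (rule tendsto_eventually)
    then show "l2_inner N g (e i) = a i"
      using LIMSEQ_unique[OF l2_lim_inner[OF g e(1)]] by blast
  qed
qed

section \<open>The strong law of large numbers\<close>

text \<open>The maximum of \<open>0\<close> and the first \<open>n\<close> partial sums of \<open>f\<close> along the stream. The recursion on the
  head of the stream exhibits its behaviour under the shift.\<close>

primrec running_max :: "('x \<Rightarrow> real) \<Rightarrow> nat \<Rightarrow> 'x stream \<Rightarrow> real" where
  "running_max f 0 s = 0"
| "running_max f (Suc n) s = max 0 (f (shd s) + running_max f n (stl s))"

lemma running_max_nonneg: "0 \<le> running_max f n s"
  by (cases n) auto

lemma running_max_mono: "running_max f n s \<le> running_max f (Suc n) s"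
proof (induction n arbitrary: s)
  case (Suc n)
  from Suc[of "stl s"] show ?case by (simp add: max_def) 
qed simp

lemma sum_le_running_max: "(\<Sum>k<n. f (s !! k)) \<le> running_max f n s"
proof (induction n arbitrary: s)
  case (Suc n)
  have "(\<Sum>k<Suc n. f (s !! k)) = f (shd s) + (\<Sum>k<n. f (stl s !! k))"
    by (subst sum.lessThan_Suc_shift) simp
  with Suc[of "stl s"] show ?case by simp
qed simp

lemma running_max_le_sum_abs: "running_max f n s \<le> (\<Sum>k<n. \<bar>f (s !! k)\<bar>)"
proof (induction n arbitrary: s)
  case (Suc n)
  have "(\<Sum>k<Suc n. \<bar>f (s !! k)\<bar>) = \<bar>f (shd s)\<bar> + (\<Sum>k<n. \<bar>f (stl s !! k)\<bar>)"
    by (subst sum.lessThan_Suc_shift) simp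
  moreover have "0 \<le> (\<Sum>k<n. \<bar>f (stl s !! k)\<bar>)" by (intro sum_nonneg) simp
  ultimately show ?case using Suc[of "stl s"] by simp
qed simp

lemma running_max_measurable [measurable]:
  assumes [measurable]: "f \<in> borel_measurable M"
  shows "running_max f n \<in> borel_measurable (stream_space M)"
proof (induction n)
  case (Suc n)
  note Suc [measurable]
  show ?case by simp
qed simp

definition running_max_bounded :: "('x \<Rightarrow> real) \<Rightarrow> 'x stream \<Rightarrow> bool" where
  "running_max_bounded f s \<longleftrightarrow> (\<exists>C::nat. \<forall>n. running_max f n s \<le> real C)"

lemma running_max_bounded_stl: "running_max_bounded f (stl s) \<longleftrightarrow> running_max_bounded f s"
proof
  assume "running_max_bounded f (stl s)"
  then obtain C :: nat where C: "\<And>n. running_max f n (stl s) \<le> C"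
    by (auto simp: running_max_bounded_def)
  obtain D :: nat where D: "\<bar>f (shd s)\<bar> + C \<le> D" using real_arch_simple by blast
  have "running_max f n s \<le> D" for n
    using C[of "n - 1"] D by (cases n) auto
  then show "running_max_bounded f s" by (auto simp: running_max_bounded_def)
next
  assume "running_max_bounded f s"
  then obtain C :: nat where C: "\<And>n. running_max f n s \<le> C"
    by (auto simp: running_max_bounded_def)
  obtain D :: nat where D: "\<bar>f (shd s)\<bar> + C \<le> D" using real_arch_simple by blast
  have "running_max f n (stl s) \<le> D" for n
    using C[of "Suc n"] D by auto
  then show "running_max_bounded f (stl s)" by (auto simp: running_max_bounded_def)
qed

lemma filterlim_running_max:
  assumes "\<not> running_max_bounded f s"
  shows "filterlim (\<lambda>n. running_max f n s) at_top sequentially"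
proof -
  have mono: "incseq (\<lambda>n. running_max f n s)"
    by (rule incseq_SucI) (rule running_max_mono)
  show ?thesis
    unfolding filterlim_at_top
  proof
    fix Z :: real
    obtain C :: nat where C: "Z \<le> C" using real_arch_simple by blast
    obtain n where n: "running_max f n s > C"
      using assms unfolding running_max_bounded_def by (auto simp: not_le)
    show "\<forall>\<^sub>F n in sequentially. Z \<le> running_max f n s"
      using eventually_ge_at_top[of n]
    proof eventually_elim
      case (elim m)
      from incseqD[OF mono elim] n C show ?case by simp
    qed
  qed
qed

context prob_space
begin

lemma distr_stream_shd_stl:
  "distr (stream_space M) (M \<Otimes>\<^sub>M stream_space M) (\<lambda>s. (shd s, stl s)) = M \<Otimes>\<^sub>M stream_space M"
    (is "?D = _")
proof -
  interpret T: prob_space "stream_space M" by (rule prob_space_stream_space)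
  show ?thesis
  proof (rule measure_eqI)
    fix A assume "A \<in> sets ?D"
    then have [measurable]: "A \<in> sets (M \<Otimes>\<^sub>M stream_space M)" by simp
    have "emeasure ?D A = (\<integral>\<^sup>+z. indicator A z \<partial>?D)" by simp
    also have "\<dots> = (\<integral>\<^sup>+s. indicator A (shd s, stl s) \<partial>stream_space M)"
      by (subst nn_integral_distr) auto
    also have "\<dots> = (\<integral>\<^sup>+t. \<integral>\<^sup>+s. indicator A (t, s) \<partial>stream_space M \<partial>M)"
      by (subst nn_integral_stream_space) auto
    also have "\<dots> = (\<integral>\<^sup>+z. indicator A z \<partial>(M \<Otimes>\<^sub>M stream_space M))"
      by (rule T.nn_integral_fst) simp
    finally show "emeasure ?D A = emeasure (M \<Otimes>\<^sub>M stream_space M) A" by simp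
  qed simp
qed

lemma distr_stream_shd: "distr (stream_space M) M shd = M"
proof -
  interpret T: prob_space "stream_space M" by (rule prob_space_stream_space)
  have "distr (stream_space M) M shd = distr (distr (stream_space M) (M \<Otimes>\<^sub>M stream_space M) (\<lambda>s. (shd s, stl s))) M fst"
    by (subst distr_distr) (auto simp: comp_def)
  then show ?thesis by (simp add: distr_stream_shd_stl T.distr_pair_fst)
qed

lemma distr_stream_stl: "distr (stream_space M) (stream_space M) stl = stream_space M"
proof (rule measure_eqI)
  fix A assume "A \<in> sets (distr (stream_space M) (stream_space M) stl)"
  then have [measurable]: "A \<in> sets (stream_space M)" by simp
  have "emeasure (distr (stream_space M) (stream_space M) stl) A
    = (\<integral>\<^sup>+s. indicator A s \<partial>distr (stream_space M) (stream_space M) stl)"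
    by simp
  also have "\<dots> = (\<integral>\<^sup>+s. indicator A (stl s) \<partial>stream_space M)"
    by (subst nn_integral_distr) auto
  also have "\<dots> = (\<integral>\<^sup>+t. \<integral>\<^sup>+s. indicator A s \<partial>stream_space M \<partial>M)"
    by (subst nn_integral_stream_space) auto
  finally show "emeasure (distr (stream_space M) (stream_space M) stl) A = emeasure (stream_space M) A"
    by (simp add: emeasure_space_1)
qed simp

lemma stream_integral_stl:
  fixes g :: "'a stream \<Rightarrow> real"
  assumes "g \<in> borel_measurable (stream_space M)"
  shows "(\<integral>s. g (stl s) \<partial>stream_space M) = (\<integral>s. g s \<partial>stream_space M)"
    and "integrable (stream_space M) (\<lambda>s. g (stl s)) \<longleftrightarrow> integrable (stream_space M) g"
  using integral_distr[of stl "stream_space M" "stream_space M" g]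
    integrable_distr_eq[of stl "stream_space M" "stream_space M" g] assms
  by (simp_all add: distr_stream_stl)

lemma stream_integrable_shd:
  fixes f :: "'a \<Rightarrow> real"
  assumes "integrable M f"
  shows "integrable (stream_space M) (\<lambda>s. f (shd s))"
  using integrable_distr_eq[of shd "stream_space M" M f] assms
  by (simp add: distr_stream_shd)

lemma stream_integrable_snth:
  fixes f :: "'a \<Rightarrow> real"
  assumes "integrable M f"
  shows "integrable (stream_space M) (\<lambda>s. f (s !! k))"
proof (induction k)
  case (Suc k)
  have [measurable]: "f \<in> borel_measurable M" using assms by auto
  show ?case using stream_integral_stl(2)[of "\<lambda>s. f (s !! k)"] Suc by simp
qed (use stream_integrable_shd[OF assms] in simp)

lemma running_max_integrable:
  assumes f: "integrable M f"
  shows "integrable (stream_space M) (running_max f n)"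
proof (rule Bochner_Integration.integrable_bound)
  have [measurable]: "f \<in> borel_measurable M" using assms by auto
  show "running_max f n \<in> borel_measurable (stream_space M)" by simp
  show "integrable (stream_space M) (\<lambda>s. \<Sum>k<n. \<bar>f (s !! k)\<bar>)"
    by (intro Bochner_Integration.integrable_sum integrable_abs stream_integrable_snth f)
  show "AE s in stream_space M. norm (running_max f n s) \<le> norm (\<Sum>k<n. \<bar>f (s !! k)\<bar>)"
    using running_max_le_sum_abs[of f n] running_max_nonneg[of f n] by (auto intro!: AE_I2)
qed

text \<open>Let \<open>A\<close> be the event that the partial sums are unbounded above. On \<open>A\<close> the increments
  \<open>running_max f (Suc n) s - running_max f n (stl s) = max (- running_max f n (stl s)) (f (shd s))\<close>
  converge to \<open>f (shd s)\<close>. Their integrals over \<open>A\<close> are nonnegative, because \<open>A\<close> and the law of the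
  stream are invariant under the shift and \<open>running_max f n s\<close> increases with \<open>n\<close>. So the limit,
  which is \<open>P(A) E f\<close> since \<open>A\<close> does not depend on the head of the stream, is nonnegative. With
  \<open>E f < 0\<close> this leaves \<open>P(A) = 0\<close>.\<close>

lemma AE_running_max_bounded:
  assumes f: "integrable M f" and neg: "(\<integral>x. f x \<partial>M) < 0"
  shows "AE s in stream_space M. running_max_bounded f s"
proof -
  interpret T: prob_space "stream_space M" by (rule prob_space_stream_space)
  interpret PT: pair_prob_space M "stream_space M" ..
  have [measurable]: "f \<in> borel_measurable M" using f by auto
  define I where "I s = (if running_max_bounded f s then 0 else 1::real)" for s
  have [measurable]: "Measurable.pred (stream_space M) (running_max_bounded f)"
    unfolding running_max_bounded_def by measurable
  have [measurable]: "I \<in> borel_measurable (stream_space M)" unfolding I_def by measurable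
  have I_stl: "I (stl s) = I s" for s by (simp add: I_def running_max_bounded_stl)
  have I01: "0 \<le> I s" "I s \<le> 1" for s by (simp_all add: I_def)
  have I_int: "integrable (stream_space M) I"
    by (rule T.integrable_const_bound[of _ 1]) (auto simp: I_def)
  have I_mult: "integrable (stream_space M) (\<lambda>s. I s * g s)"
    if "integrable (stream_space M) g" for g :: "_ \<Rightarrow> real"
    by (rule Bochner_Integration.integrable_bound[OF that]) (use that in \<open>auto simp: I_def\<close>)
  define d where "d n s = running_max f (Suc n) s - running_max f n (stl s)" for n s
  have d_eq: "d n s = max (- running_max f n (stl s)) (f (shd s))" for n s
    by (simp add: d_def)
  have R_int: "integrable (stream_space M) (running_max f n)" for n by (rule running_max_integrable[OF f])
  have R_stl: "integrable (stream_space M) (\<lambda>s. running_max f n (stl s))" for n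
    using stream_integral_stl(2) R_int by simp
  have pos: "0 \<le> (\<integral>s. I s * d n s \<partial>stream_space M)" for n
  proof -
    have "(\<integral>s. I s * d n s \<partial>stream_space M)
      = (\<integral>s. I s * running_max f (Suc n) s \<partial>stream_space M)
        - (\<integral>s. I (stl s) * running_max f n (stl s) \<partial>stream_space M)"
      unfolding d_def I_stl right_diff_distrib
      by (intro Bochner_Integration.integral_diff I_mult R_int R_stl)
    moreover have "(\<integral>s. I (stl s) * running_max f n (stl s) \<partial>stream_space M)
      = (\<integral>s. I s * running_max f n s \<partial>stream_space M)"
      by (rule stream_integral_stl(1)) simp
    moreover have "(\<integral>s. I s * running_max f n s \<partial>stream_space M)
      \<le> (\<integral>s. I s * running_max f (Suc n) s \<partial>stream_space M)"
      by (intro integral_mono I_mult R_int mult_left_mono running_max_mono I01)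
    ultimately show ?thesis by simp
  qed
  have lim: "(\<lambda>n. \<integral>s. I s * d n s \<partial>stream_space M) \<longlonglongrightarrow> (\<integral>s. I s * f (shd s) \<partial>stream_space M)"
  proof (rule integral_dominated_convergence)
    show "integrable (stream_space M) (\<lambda>s. \<bar>f (shd s)\<bar>)"
      by (intro integrable_abs stream_integrable_shd f)
    show "AE s in stream_space M. (\<lambda>n. I s * d n s) \<longlonglongrightarrow> I s * f (shd s)"
    proof (rule AE_I2)
      fix s
      show "(\<lambda>n. I s * d n s) \<longlonglongrightarrow> I s * f (shd s)"
      proof (cases "running_max_bounded f s")
        case False
        then have "filterlim (\<lambda>n. running_max f n (stl s)) at_top sequentially"
          by (simp add: filterlim_running_max running_max_bounded_stl)
        then have "\<forall>\<^sub>F n in sequentially. \<bar>f (shd s)\<bar> \<le> running_max f n (stl s)"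
          by (simp add: filterlim_at_top)
        then have "\<forall>\<^sub>F n in sequentially. I s * d n s = I s * f (shd s)"
          by eventually_elim (simp add: d_eq max_def abs_le_iff)
        then show ?thesis by (rule tendsto_eventually)
      qed (simp add: I_def)
    qed
    show "AE s in stream_space M. norm (I s * d n s) \<le> \<bar>f (shd s)\<bar>" for n
    proof (rule AE_I2)
      fix s
      show "norm (I s * d n s) \<le> \<bar>f (shd s)\<bar>"
        using running_max_nonneg[of f n "stl s"] by (auto simp: I_def d_eq max_def)
    qed
    show "(\<lambda>s. I s * d n s) \<in> borel_measurable (stream_space M)" for n
      unfolding d_def by measurable
  qed measurable
  have "0 \<le> (\<integral>s. I s * f (shd s) \<partial>stream_space M)"
    using LIMSEQ_le_const[OF lim] pos by blast
  also have "\<dots> = (\<integral>s. I (stl s) * f (shd s) \<partial>stream_space M)" by (simp add: I_stl)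
  also have "\<dots> = (\<integral>z. I (snd z) * f (fst z) \<partial>distr (stream_space M) (M \<Otimes>\<^sub>M stream_space M) (\<lambda>s. (shd s, stl s)))"
    by (subst integral_distr) auto
  also have "\<dots> = (\<integral>z. I (snd z) * f (fst z) \<partial>(M \<Otimes>\<^sub>M stream_space M))"
    by (simp add: distr_stream_shd_stl)
  also have "\<dots> = (\<integral>x. \<integral>s. I s * f x \<partial>stream_space M \<partial>M)"
  proof -
    have "integrable (M \<Otimes>\<^sub>M stream_space M) (\<lambda>z. f (fst z))"
      using integrable_distr_eq[of fst "M \<Otimes>\<^sub>M stream_space M" M f] f by (simp add: T.distr_pair_fst)
    then have "integrable (M \<Otimes>\<^sub>M stream_space M) (\<lambda>z. I (snd z) * f (fst z))"
      by (rule Bochner_Integration.integrable_bound) (auto simp: I_def)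
    from PT.integral_fst'[OF this] show ?thesis by simp
  qed
  also have "\<dots> = (\<integral>s. I s \<partial>stream_space M) * (\<integral>x. f x \<partial>M)" by simp
  finally have "(\<integral>s. I s \<partial>stream_space M) \<le> 0"
    using neg by (simp add: zero_le_mult_iff)
  moreover have "0 \<le> (\<integral>s. I s \<partial>stream_space M)" by (simp add: I01)
  ultimately have "(\<integral>s. I s \<partial>stream_space M) = 0" by simp
  then have "AE s in stream_space M. I s = 0"
    using I_int I01 by (subst (asm) integral_nonneg_eq_0_iff_AE) auto
  then show ?thesis by eventually_elim (simp add: I_def split: if_splits)
qed

text \<open>For \<open>b\<close> strictly between \<open>E f\<close> and \<open>a\<close>, the partial sums of \<open>f - b\<close> are bounded above by a
  constant, which division by \<open>n\<close> makes negligible.\<close>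

lemma AE_eventually_average_less:
  assumes f: "integrable M f" and less: "(\<integral>x. f x \<partial>M) < a"
  shows "AE s in stream_space M. \<forall>\<^sub>F n in sequentially. 1 / real n * (\<Sum>k<n. f (s !! k)) < a"
proof -
  define b where "b = ((\<integral>x. f x \<partial>M) + a) / 2"
  have b: "(\<integral>x. f x \<partial>M) < b" "b < a" using less by (auto simp: b_def)
  have "AE s in stream_space M. running_max_bounded (\<lambda>x. f x - b) s"
    using f b(1) by (intro AE_running_max_bounded) (auto simp: prob_space)
  then show ?thesis
  proof eventually_elim
    case (elim s)
    then obtain C :: nat where C: "\<And>n. running_max (\<lambda>x. f x - b) n s \<le> C"
      by (auto simp: running_max_bounded_def)
    have le: "(\<Sum>k<n. f (s !! k)) \<le> C + real n * b" for n
      using sum_le_running_max[of "\<lambda>x. f x - b" s n] C[of n] by (simp add: sum_subtractf)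
    obtain n0 :: nat where n0: "C / (a - b) < n0" using reals_Archimedean2 by blast
    have "1 / real n * (\<Sum>k<n. f (s !! k)) < a" if n: "Suc n0 \<le> n" for n
    proof -
      have "C / (a - b) < n" using n n0 by simp
      then have "C < real n * (a - b)" using b by (simp add: pos_divide_less_eq)
      then have "(\<Sum>k<n. f (s !! k)) < real n * a" using le[of n] by (simp add: algebra_simps)
      then show ?thesis using n by (simp add: field_simps)
    qed
    then show ?case by (auto simp: eventually_at_top_linorder)
  qed
qed

lemma AE_stream_average_tendsto:
  assumes f: "integrable M f"
  shows "AE s in stream_space M. (\<lambda>n. 1 / real n * (\<Sum>k<n. f (s !! k))) \<longlonglongrightarrow> (\<integral>x. f x \<partial>M)"
proof -
  have up: "AE s in stream_space M. \<forall>j::nat. \<forall>\<^sub>F n in sequentially.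
      1 / real n * (\<Sum>k<n. f (s !! k)) < (\<integral>x. f x \<partial>M) + 1 / real (Suc j)"
    unfolding AE_all_countable by (intro allI AE_eventually_average_less f) simp
  have "AE s in stream_space M. \<forall>j::nat. \<forall>\<^sub>F n in sequentially.
      1 / real n * (\<Sum>k<n. - f (s !! k)) < (\<integral>x. - f x \<partial>M) + 1 / real (Suc j)"
    unfolding AE_all_countable by (intro allI AE_eventually_average_less) (use f in auto)
  with up show ?thesis
  proof eventually_elim
    case (elim s)
    show ?case
    proof (rule LIMSEQ_I)
      fix r :: real assume "0 < r"
      then obtain j where j: "1 / real (Suc j) < r" using nat_approx_posE by blast
      have "\<forall>\<^sub>F n in sequentially. norm (1 / real n * (\<Sum>k<n. f (s !! k)) - (\<integral>x. f x \<partial>M)) < r"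
        using elim[THEN spec[of _ j]]
        by eventually_elim (use j in \<open>simp add: sum_negf abs_less_iff\<close>)
      then show "\<exists>no. \<forall>n\<ge>no. norm (1 / real n * (\<Sum>k<n. f (s !! k)) - (\<integral>x. f x \<partial>M)) < r"
        by (simp add: eventually_at_top_linorder)
    qed
  qed
qed

end

lemma strong_law_of_large_numbers:
  fixes Z :: "nat \<Rightarrow> 'q \<Rightarrow> 'z" and f :: "'z \<Rightarrow> real"
  assumes Q: "prob_space Q" and N: "prob_space N"
    and indep: "prob_space.indep_vars Q (\<lambda>_. N) Z UNIV"
    and law: "\<And>m. distr Q N (Z m) = N"
    and f: "integrable N f"
  shows "AE \<omega> in Q. (\<lambda>n. 1 / real n * (\<Sum>k<n. f (Z k \<omega>))) \<longlonglongrightarrow> (\<integral>z. f z \<partial>N)"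
proof -
  interpret Q: prob_space Q by (rule Q)
  interpret N: prob_space N by (rule N)
  have Z [measurable]: "Z m \<in> measurable Q N" for m
    using indep by (auto simp: Q.indep_vars_def)
  have [measurable]: "f \<in> borel_measurable N" using f by auto
  have PiM: "distr Q (\<Pi>\<^sub>M i\<in>UNIV. N) (\<lambda>\<omega> i. Z i \<omega>) = (\<Pi>\<^sub>M i\<in>UNIV. N)"
    using Q.indep_vars_iff_distr_eq_PiM[where I = UNIV and M' = "\<lambda>_. N" and X = Z] indep law by (simp add: restrict_UNIV)
  have [measurable]: "(\<lambda>\<omega> i. Z i \<omega>) \<in> measurable Q (\<Pi>\<^sub>M i\<in>UNIV. N)"
    by (rule measurable_PiM_single') (auto simp: measurable_space[OF Z] PiE_def)
  have "distr Q (stream_space N) (\<lambda>\<omega>. to_stream (\<lambda>i. Z i \<omega>))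
    = distr (distr Q (\<Pi>\<^sub>M i\<in>UNIV. N) (\<lambda>\<omega> i. Z i \<omega>)) (stream_space N) to_stream"
    by (subst distr_distr) (auto simp: comp_def)
  also have "\<dots> = stream_space N"
    unfolding PiM by (rule stream_space_eq_distr[symmetric])
  finally have distr: "distr Q (stream_space N) (\<lambda>\<omega>. to_stream (\<lambda>i. Z i \<omega>)) = stream_space N" .
  have AE: "AE s in distr Q (stream_space N) (\<lambda>\<omega>. to_stream (\<lambda>i. Z i \<omega>)).
      (\<lambda>n. 1 / real n * (\<Sum>k<n. f (s !! k))) \<longlonglongrightarrow> (\<integral>z. f z \<partial>N)"
    unfolding distr by (rule N.AE_stream_average_tendsto[OF f])
  have "(\<lambda>\<omega>. to_stream (\<lambda>i. Z i \<omega>)) \<in> measurable Q (stream_space N)"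
    by (rule measurable_stream_space2) (simp add: to_stream_def)
  from AE_distrD[OF this AE] show ?thesis by (simp add: to_stream_def)
qed

section \<open>Symmetric contraction semigroups\<close>

lemma exp_remainder_bounds:
  fixes y :: real
  shows "0 \<le> exp y - 1 - y" and "exp y - 1 - y \<le> y\<^sup>2 * exp \<bar>y\<bar>"
proof -
  show "0 \<le> exp y - 1 - y" using exp_ge_add_one_self[of y] by linarith
  have 1: "z * exp z - (exp z - 1) \<ge> 0" for z :: real
  proof -
    have "1 - z \<le> exp (- z)" using exp_ge_add_one_self[of "- z"] by linarith
    then have "(1 - z) * exp z \<le> exp (- z) * exp z" by (intro mult_right_mono) simp_all
    then show ?thesis by (simp add: exp_minus left_diff_distrib)
  qed
  have "exp y - 1 - y \<le> y * (exp y - 1)" using 1[of y] by (simp add: algebra_simps)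
  also have "\<dots> \<le> \<bar>y\<bar> * (\<bar>y\<bar> * exp \<bar>y\<bar>)"
  proof (cases "0 \<le> y")
    case True
    then show ?thesis using 1[of y] by (simp add: mult_left_mono)
  next
    case False
    have "1 - exp y \<le> - y" using exp_ge_add_one_self[of y] by linarith
    also have "- y = \<bar>y\<bar> * 1" using False by simp
    also have "\<dots> \<le> \<bar>y\<bar> * exp \<bar>y\<bar>" by (intro mult_left_mono) auto
    finally have "\<bar>y\<bar> * (1 - exp y) \<le> \<bar>y\<bar> * (\<bar>y\<bar> * exp \<bar>y\<bar>)" by (intro mult_left_mono) auto
    then show ?thesis using False by (simp add: algebra_simps)
  qed
  also have "\<dots> = y\<^sup>2 * exp \<bar>y\<bar>" by (simp add: power2_eq_square)
  finally show "exp y - 1 - y \<le> y\<^sup>2 * exp \<bar>y\<bar>" .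
qed

lemma square_times_exp_le:
  fixes l t :: real
  assumes "l \<le> 0" "0 < t"
  shows "l\<^sup>2 * exp (l * t / 2) \<le> 8 / t\<^sup>2"
proof -
  define x where "x = - (l * t / 2)"
  have x: "0 \<le> x" using assms by (simp add: x_def mult_nonpos_nonneg)
  have "x\<^sup>2 \<le> 2 * exp x"
    using exp_lower_Taylor_quadratic[OF x] x by simp
  then have "x\<^sup>2 * exp (- x) \<le> 2"
    by (simp add: exp_minus field_simps)
  moreover have "x\<^sup>2 * exp (- x) = (t\<^sup>2 / 4) * (l\<^sup>2 * exp (l * t / 2))"
    by (simp add: x_def power_mult_distrib power_divide)
  ultimately have "(t\<^sup>2 / 4) * (l\<^sup>2 * exp (l * t / 2)) \<le> 2" by simp
  then show ?thesis using \<open>0 < t\<close> by (simp add: field_simps)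
qed

text \<open>The bound is uniform in \<open>l\<close>: half of the exponential decay is given up to absorb the growth
  caused by \<open>\<bar>h\<bar> \<le> t / 2\<close>, the other half to absorb \<open>l\<^sup>2\<close>.\<close>

lemma exp_difference_quotient_bound:
  fixes l t h :: real
  assumes l: "l \<le> 0" and t: "0 < t" and h: "h \<noteq> 0" "\<bar>h\<bar> \<le> t / 2"
  shows "\<bar>(exp (l * (t + h)) - exp (l * t)) / h - l * exp (l * t)\<bar> \<le> \<bar>h\<bar> * (8 / t\<^sup>2)"
proof -
  have "(exp (l * (t + h)) - exp (l * t)) / h - l * exp (l * t)
      = exp (l * t) * ((exp (l * h) - 1 - l * h) / h)"
    using h by (simp add: field_simps exp_add)
  then have "\<bar>(exp (l * (t + h)) - exp (l * t)) / h - l * exp (l * t)\<bar>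
      = exp (l * t) * ((exp (l * h) - 1 - l * h) / \<bar>h\<bar>)"
    using exp_remainder_bounds(1)[of "l * h"] by (simp add: abs_mult)
  also have "\<dots> \<le> exp (l * t) * ((l * h)\<^sup>2 * exp \<bar>l * h\<bar> / \<bar>h\<bar>)"
    using exp_remainder_bounds(2)[of "l * h"] h by (intro mult_left_mono divide_right_mono) auto
  also have "(l * h)\<^sup>2 * exp \<bar>l * h\<bar> / \<bar>h\<bar> = \<bar>h\<bar> * (l\<^sup>2 * exp (- l * \<bar>h\<bar>))"
    using h l by (simp add: power2_eq_square abs_mult field_simps)
  also have "exp (l * t) * (\<bar>h\<bar> * (l\<^sup>2 * exp (- l * \<bar>h\<bar>))) = \<bar>h\<bar> * (l\<^sup>2 * exp (l * (t - \<bar>h\<bar>)))"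
    by (simp add: right_diff_distrib exp_diff exp_minus field_simps)
  also have "\<dots> \<le> \<bar>h\<bar> * (l\<^sup>2 * exp (l * t / 2))"
  proof -
    have "l * (t - \<bar>h\<bar>) \<le> l * (t / 2)" using l h by (intro mult_left_mono_neg) auto
    then show ?thesis by (intro mult_left_mono) auto
  qed
  also have "\<dots> \<le> \<bar>h\<bar> * (8 / t\<^sup>2)"
    using square_times_exp_le[OF l t] by (intro mult_left_mono) auto
  finally show ?thesis .
qed

locale symmetric_contraction_semigroup =
  fixes N :: "'x measure" and T :: "real \<Rightarrow> ('x \<Rightarrow> real) \<Rightarrow> 'x \<Rightarrow> real"
  assumes finite_N: "finite_measure N"
    and T_l2: "0 \<le> t \<Longrightarrow> l2 N f \<Longrightarrow> l2 N (T t f)"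
    and T_add: "0 \<le> t \<Longrightarrow> l2 N f \<Longrightarrow> l2 N g \<Longrightarrow>
      AE x in N. T t (\<lambda>x. f x + g x) x = T t f x + T t g x"
    and T_scale: "0 \<le> t \<Longrightarrow> l2 N f \<Longrightarrow> AE x in N. T t (\<lambda>x. a * f x) x = a * T t f x"
    and T_contraction: "0 \<le> t \<Longrightarrow> l2 N f \<Longrightarrow> l2_norm N (T t f) \<le> l2_norm N f"
    and T_symmetric: "0 \<le> t \<Longrightarrow> l2 N f \<Longrightarrow> l2 N g \<Longrightarrow>
      l2_inner N (T t f) g = l2_inner N f (T t g)"
    and T_semigroup: "l2_semigroup N T"
begin

lemma T_diff:
  assumes "0 \<le> t" "l2 N f" "l2 N g"
  shows "AE x in N. T t (\<lambda>x. f x - g x) x = T t f x - T t g x"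
  using T_add[OF assms(1,2) l2_scale[OF assms(3), of "-1"]] T_scale[OF assms(1,3), of "-1"]
  by eventually_elim simp

lemma T_0: "l2 N f \<Longrightarrow> AE x in N. T 0 f x = f x"
  using T_semigroup by (simp add: l2_semigroup_def)

lemma T_plus: "l2 N f \<Longrightarrow> 0 \<le> s \<Longrightarrow> 0 \<le> t \<Longrightarrow> AE x in N. T (s + t) f x = T s (T t f) x"
  using T_semigroup by (simp add: l2_semigroup_def)

lemma T_lim: "l2 N f \<Longrightarrow> l2_lim N (\<lambda>t. T t f) f (at_right 0)"
  using T_semigroup by (simp add: l2_semigroup_def)

lemma l2_norm_T_sq:
  assumes "0 \<le> t" "l2 N f"
  shows "l2_inner N (T t f) f = (l2_norm N (T (t / 2) f))\<^sup>2"
proof -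
  have t2: "0 \<le> t / 2" using assms by simp
  have "l2_inner N (T t f) f = l2_inner N (T (t / 2) (T (t / 2) f)) f"
    using T_plus[OF assms(2) t2 t2] T_l2 t2 assms
    by (intro l2_inner_cong_AE) (auto simp: l2_measurable)
  also have "\<dots> = l2_inner N (T (t / 2) f) (T (t / 2) f)"
    by (intro T_symmetric t2 T_l2 assms)
  finally show ?thesis by (simp add: l2_norm_sq)
qed

text \<open>The defect \<open>\<parallel>T h f - e\<^sup>\<lambda>\<^sup>h f\<parallel>\<close> is \<open>o(h)\<close> and, by contractivity, at most additive over
  consecutive steps; with \<open>n\<close> steps of length \<open>t / n\<close> it is at most \<open>n o(t / n)\<close>.\<close>

lemma T_eigenfunction:
  assumes gen: "l2_generator N T f (\<lambda>x. l * f x)" and l: "l \<le> 0" and t: "0 \<le> t"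
  shows "AE x in N. T t f x = exp (l * t) * f x"
proof (cases "t = 0")
  case True
  then show ?thesis using T_0[of f] gen by (simp add: l2_generator_def)
next
  case False
  with t have t: "0 < t" by simp
  have f: "l2 N f" using gen by (simp add: l2_generator_def)
  define d where "d h = l2_norm N (\<lambda>x. T h f x - exp (l * h) * f x)" for h
  have d_l2: "l2 N (\<lambda>x. T h f x - exp (l * h) * f x)" if "0 \<le> h" for h
    using that by (intro l2_diff l2_scale T_l2 f)
  have rhs: "((\<lambda>h. l2_norm N (\<lambda>x. (T h f x - f x) / h - l * f x)
      + \<bar>(exp (l * h) - 1) / h - l\<bar> * l2_norm N f) \<longlongrightarrow> 0 + 0 * l2_norm N f) (at_right 0)"
  proof (intro tendsto_intros)
    show "((\<lambda>h. l2_norm N (\<lambda>x. (T h f x - f x) / h - l * f x)) \<longlongrightarrow> 0) (at_right 0)"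
      using gen unfolding l2_generator_def l2_lim_def by simp
    have "((\<lambda>h. exp (l * h)) has_real_derivative l) (at 0)"
      by (auto intro!: derivative_eq_intros)
    then have "((\<lambda>h. (exp (l * h) - 1) / h) \<longlongrightarrow> l) (at 0)"
      by (simp add: has_field_derivative_iff)
    then have "((\<lambda>h. (exp (l * h) - 1) / h) \<longlongrightarrow> l) (at_right 0)"
      by (rule tendsto_mono[rotated]) (simp add: at_le)
    then show "((\<lambda>h. \<bar>(exp (l * h) - 1) / h - l\<bar>) \<longlongrightarrow> 0) (at_right 0)"
      by (simp add: LIM_zero_iff tendsto_rabs_zero)
  qed
  have "((\<lambda>h. d h / h) \<longlongrightarrow> 0) (at_right 0)"
  proof (rule Lim_null_comparison)
    show "((\<lambda>h. l2_norm N (\<lambda>x. (T h f x - f x) / h - l * f x)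
      + \<bar>(exp (l * h) - 1) / h - l\<bar> * l2_norm N f) \<longlongrightarrow> 0) (at_right 0)"
      using rhs by simp
    show "\<forall>\<^sub>F h in at_right 0. norm (d h / h) \<le> l2_norm N (\<lambda>x. (T h f x - f x) / h - l * f x)
      + \<bar>(exp (l * h) - 1) / h - l\<bar> * l2_norm N f"
      using eventually_at_right_less[of 0]
    proof eventually_elim
      case (elim h)
      define a where "a = (exp (l * h) - 1) / h - l"
      have l2: "l2 N (\<lambda>x. (T h f x - f x) / h - l * f x)"
        using l2_diff[OF l2_scale[OF l2_diff[OF T_l2[of h f] f], of "1 / h"] l2_scale[OF f, of l]] elim f
        by simp
      have "d h / h = l2_norm N (\<lambda>x. (1 / h) * (T h f x - exp (l * h) * f x))"
        unfolding l2_norm_scale d_def using elim by simp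
      also have "(\<lambda>x. (1 / h) * (T h f x - exp (l * h) * f x))
          = (\<lambda>x. ((T h f x - f x) / h - l * f x) - a * f x)"
        using elim by (auto simp: a_def field_simps)
      also have "l2_norm N \<dots> \<le> l2_norm N (\<lambda>x. (T h f x - f x) / h - l * f x) + l2_norm N (\<lambda>x. a * f x)"
        by (intro l2_norm_diff_le l2 l2_scale f)
      finally show ?case using elim unfolding l2_norm_scale a_def by (simp add: d_def)
    qed
  qed
  moreover have "filterlim (\<lambda>n. t / real (Suc n)) (at_right 0) sequentially"
  proof (rule tendsto_imp_filterlim_at_right)
    show "(\<lambda>n. t / real (Suc n)) \<longlonglongrightarrow> 0"
      using LIMSEQ_Suc[OF lim_const_over_n[of t]] by simp
  qed (use t in simp)
  ultimately have "(\<lambda>n. d (t / real (Suc n)) / (t / real (Suc n))) \<longlonglongrightarrow> 0"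
    by (rule filterlim_compose)
  then have lim: "(\<lambda>n. t * (d (t / real (Suc n)) / (t / real (Suc n)))) \<longlonglongrightarrow> 0"
    by (rule tendsto_mult_right_zero)
  have step: "d (real n * h) \<le> real n * d h" if h: "0 < h" for n h
  proof (induction n)
    case 0
    have "l2_norm N (\<lambda>x. T 0 f x - f x) = 0"
      using T_0[OF f] l2_norm_diff_eq_0_iff[OF T_l2[OF _ f] f, of 0] by simp
    then show ?case by (simp add: d_def)
  next
    case (Suc n)
    define s where "s = real n * h"
    have s: "0 \<le> s" using h by (simp add: s_def)
    define g where "g x = T h f x - exp (l * h) * f x" for x
    have g: "l2 N g" unfolding g_def[abs_def] using h by (intro d_l2) simp
    define k where "k x = T s f x - exp (l * s) * f x" for x
    have k: "l2 N k" unfolding k_def[abs_def] using s by (rule d_l2)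
    have Sn: "real (Suc n) * h = s + h" by (simp add: s_def algebra_simps)
    have h0: "0 \<le> h" using h by simp
    have "AE x in N. T (s + h) f x - exp (l * (s + h)) * f x = T s g x + exp (l * h) * k x"
      using T_plus[OF f s h0] T_diff[OF s T_l2[OF h0 f] l2_scale[OF f, of "exp (l * h)"]]
        T_scale[OF s f, of "exp (l * h)"] unfolding g_def[abs_def, symmetric]
      by eventually_elim (simp add: k_def distrib_left exp_add algebra_simps)
    then have "d (s + h) = l2_norm N (\<lambda>x. T s g x + exp (l * h) * k x)"
      unfolding d_def using s h g k f
      by (intro l2_norm_cong_AE l2_measurable l2_add l2_scale d_l2 T_l2) auto
    also have "\<dots> \<le> l2_norm N (T s g) + exp (l * h) * l2_norm N k"
      using l2_norm_add_le[OF T_l2[OF s g] l2_scale[OF k, of "exp (l * h)"]]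
      by (simp add: l2_norm_scale)
    also have "\<dots> \<le> l2_norm N g + 1 * l2_norm N k"
      using l h by (intro add_mono T_contraction s g mult_right_mono) (auto simp: mult_nonpos_nonneg)
    also have "\<dots> = d h + d s" by (simp add: d_def g_def[abs_def] k_def[abs_def])
    finally show ?case using Suc unfolding Sn by (simp add: s_def algebra_simps)
  qed
  have "d t \<le> t * (d (t / real (Suc n)) / (t / real (Suc n)))" for n
  proof -
    have "real (Suc n) * (t / real (Suc n)) = t" by simp
    moreover have "t * (y / (t / real (Suc n))) = real (Suc n) * y" for y
      using t by (simp del: of_nat_Suc add: field_simps)
    ultimately show ?thesis using step[of "t / real (Suc n)" "Suc n"] t
      by (simp add: mult.commute)
  qed
  then have "d t \<le> 0" using LIMSEQ_le_const[OF lim] by blast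
  moreover have "0 \<le> d t" by (simp add: d_def)
  ultimately have "d t = 0" by simp
  then show ?thesis
    unfolding d_def using t f by (subst (asm) l2_norm_diff_eq_0_iff) (auto intro: l2_scale T_l2)
qed

end

locale spectral_semigroup = symmetric_contraction_semigroup +
  fixes \<phi> :: "nat \<Rightarrow> 'a \<Rightarrow> real" and lam :: "nat \<Rightarrow> real"
  assumes basis: "l2_orthonormal_basis N \<phi>"
    and eigen: "l2_generator N T (\<phi> i) (\<lambda>x. lam i * \<phi> i x)"
    and lam_nonpos: "lam i \<le> 0"
begin

lemma T_coefficient:
  assumes t: "0 \<le> t" and f: "l2 N f"
  shows "l2_inner N (T t f) (\<phi> i) = exp (lam i * t) * l2_inner N f (\<phi> i)"
proof -
  note \<phi> = l2_orthonormal_basisD(1)[OF basis]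
  have "l2_inner N (T t f) (\<phi> i) = l2_inner N f (T t (\<phi> i))"
    by (intro T_symmetric t f \<phi>)
  also have "\<dots> = l2_inner N f (\<lambda>x. exp (lam i * t) * \<phi> i x)"
    using T_eigenfunction[OF eigen lam_nonpos t] f
    by (intro l2_inner_cong_AE l2_measurable l2_scale T_l2 t \<phi>) auto
  finally show ?thesis by (simp add: l2_inner_scale_right)
qed

text \<open>\<open>T (t / 2)\<close> is injective, since it multiplies Fourier coefficients by positive numbers.\<close>

lemma T_quadratic_form_pos:
  assumes t: "0 \<le> t" and f: "l2 N f" "l2_norm N f \<noteq> 0"
  shows "0 < l2_inner N (T t f) f"
proof -
  have t2: "0 \<le> t / 2" using t by simp
  have "l2_norm N (T (t / 2) f) \<noteq> 0"
  proof
    assume "l2_norm N (T (t / 2) f) = 0"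
    then have 0: "AE x in N. T (t / 2) f x = 0" using l2_norm_eq_0_iff T_l2[OF t2 f(1)] by blast
    have "l2_inner N f (\<phi> i) = 0" for i
    proof -
      note \<phi> = l2_orthonormal_basisD(1)[OF basis]
      have "l2_inner N (T (t / 2) f) (\<phi> i) = l2_inner N (\<lambda>x. 0) (\<phi> i)"
        using 0 \<phi> T_l2[OF t2 f(1)] by (intro l2_inner_cong_AE) (auto simp: l2_measurable)
      then show ?thesis using T_coefficient[OF t2 f(1), of i] by simp
    qed
    from l2_eq_0_if_coefficients_eq_0[OF basis f(1) this] show False
      using f l2_norm_eq_0_iff by blast
  qed
  then show ?thesis using l2_norm_T_sq[OF t f(1)] by simp
qed

text \<open>The coefficients \<open>e\<^sup>\<lambda>\<^sup>t \<langle>f, \<phi>\<^sub>i\<rangle>\<close> have difference quotients that converge at a rate uniform in \<open>i\<close>, because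
  for fixed \<open>t > 0\<close> the function \<open>\<lambda>\<^sup>2 e\<^sup>\<lambda>\<^sup>t\<close> is bounded over \<open>\<lambda> \<le> 0\<close>; the derivative is the element
  with the differentiated coefficients. In the difference quotients from the right, \<open>T h\<close> can be moved
  onto \<open>v\<close> by symmetry.\<close>

lemma T_differentiable:
  assumes t: "0 < t" and f: "l2 N f"
  obtains q where "l2_lim N (\<lambda>h x. (T (t + h) f x - T t f x) / h) q (at 0)"
    and "\<And>v w. l2_generator N T v w \<Longrightarrow> l2_inner N q v = l2_inner N (T t f) w"
proof -
  note \<phi> = l2_orthonormal_basisD(1)[OF basis]
  define c where "c i = l2_inner N f (\<phi> i)" for i
  have c: "(\<lambda>i. (c i)\<^sup>2) sums (l2_norm N f)\<^sup>2"
    unfolding c_def by (rule Parseval[OF basis f])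
  have "summable (\<lambda>i. (lam i * exp (lam i * t) * c i)\<^sup>2)"
  proof (rule summable_comparison_test')
    show "summable (\<lambda>i. (8 / t\<^sup>2) * (c i)\<^sup>2)"
      by (intro summable_mult sums_summable[OF c])
    fix i :: nat assume "0 \<le> i"
    have "(lam i * exp (lam i * t))\<^sup>2 = (lam i)\<^sup>2 * exp (lam i * t / 2) * exp (lam i * t * 3 / 2)"
      by (simp add: power_mult_distrib power2_eq_square flip: exp_add)
    also have "\<dots> \<le> (lam i)\<^sup>2 * exp (lam i * t / 2) * 1"
      using lam_nonpos[of i] t by (intro mult_left_mono) (auto simp: mult_nonpos_nonneg)
    also have "\<dots> \<le> 8 / t\<^sup>2" using square_times_exp_le[OF lam_nonpos t] by simp
    finally have "(lam i * exp (lam i * t))\<^sup>2 * (c i)\<^sup>2 \<le> 8 / t\<^sup>2 * (c i)\<^sup>2"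
      by (rule mult_right_mono) simp
    then show "norm ((lam i * exp (lam i * t) * c i)\<^sup>2) \<le> 8 / t\<^sup>2 * (c i)\<^sup>2"
      by (simp add: power_mult_distrib)
  qed
  from Riesz_Fischer[OF finite_N basis this]
  obtain q where q: "l2 N q" "\<And>i. l2_inner N q (\<phi> i) = lam i * exp (lam i * t) * c i"
    by blast
  define D where "D h x = (T (t + h) f x - T t f x) / h" for h x
  have D_eq: "D h = (\<lambda>x. (1 / h) * (T (t + h) f x - T t f x))" for h
    by (auto simp: D_def)
  have D_l2: "l2 N (D h)" if "\<bar>h\<bar> \<le> t / 2" for h
    unfolding D_eq using that t by (intro l2_scale l2_diff T_l2 f) auto
  have bound: "l2_norm N (\<lambda>x. D h x - q x) \<le> \<bar>h\<bar> * (8 / t\<^sup>2) * l2_norm N f"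
    if h: "h \<noteq> 0" "\<bar>h\<bar> \<le> t / 2" for h
  proof (rule power2_le_imp_le)
    have th: "0 \<le> t + h" "0 \<le> t" using h t by auto
    have coef: "l2_inner N (\<lambda>x. D h x - q x) (\<phi> i)
      = ((exp (lam i * (t + h)) - exp (lam i * t)) / h - lam i * exp (lam i * t)) * c i" for i
    proof -
      have "l2_inner N (\<lambda>x. D h x - q x) (\<phi> i) = l2_inner N (D h) (\<phi> i) - l2_inner N q (\<phi> i)"
        by (intro l2_inner_diff_left D_l2 h q \<phi>)
      also have "l2_inner N (D h) (\<phi> i) = (1 / h) * (exp (lam i * (t + h)) * c i - exp (lam i * t) * c i)"
        unfolding D_eq l2_inner_scale_left
        by (subst l2_inner_diff_left) (auto simp: T_coefficient th f T_l2 \<phi> c_def)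
      finally show ?thesis using h by (simp add: q field_simps)
    qed
    have lhs: "(\<lambda>i. (l2_inner N (\<lambda>x. D h x - q x) (\<phi> i))\<^sup>2) sums (l2_norm N (\<lambda>x. D h x - q x))\<^sup>2"
      by (intro Parseval[OF basis] l2_diff D_l2 h q)
    have rhs: "(\<lambda>i. (\<bar>h\<bar> * (8 / t\<^sup>2))\<^sup>2 * (c i)\<^sup>2) sums ((\<bar>h\<bar> * (8 / t\<^sup>2))\<^sup>2 * (l2_norm N f)\<^sup>2)"
      by (intro sums_mult c)
    have "(l2_inner N (\<lambda>x. D h x - q x) (\<phi> i))\<^sup>2 \<le> (\<bar>h\<bar> * (8 / t\<^sup>2))\<^sup>2 * (c i)\<^sup>2" for i
      unfolding coef power_mult_distrib[of _ "c i"]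
      using exp_difference_quotient_bound[OF lam_nonpos t h, of i]
      by (intro mult_right_mono power2_le_iff_abs_le[THEN iffD2]) auto
    then have "(l2_norm N (\<lambda>x. D h x - q x))\<^sup>2 \<le> (\<bar>h\<bar> * (8 / t\<^sup>2))\<^sup>2 * (l2_norm N f)\<^sup>2"
      by (rule sums_le[OF _ lhs rhs])
    then show "(l2_norm N (\<lambda>x. D h x - q x))\<^sup>2 \<le> (\<bar>h\<bar> * (8 / t\<^sup>2) * l2_norm N f)\<^sup>2"
      by (simp only: power_mult_distrib)
  qed simp
  have near: "\<forall>\<^sub>F h in at 0. h \<noteq> 0 \<and> \<bar>h\<bar> \<le> t / 2"
    unfolding eventually_at by (rule exI[of _ "t / 2"]) (use t in auto)
  have lim: "l2_lim N D q (at 0)"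
    unfolding l2_lim_def
  proof (intro conjI q)
    show "\<forall>\<^sub>F h in at 0. l2 N (D h)" using near by eventually_elim (simp add: D_l2)
    have "\<forall>\<^sub>F h in at 0. norm (l2_norm N (\<lambda>x. D h x - q x)) \<le> \<bar>h\<bar> * (8 / t\<^sup>2) * l2_norm N f"
      using near by eventually_elim (use bound in simp)
    moreover have "((\<lambda>h. \<bar>h\<bar> * (8 / t\<^sup>2) * l2_norm N f) \<longlongrightarrow> 0) (at 0)"
      by (intro tendsto_eq_intros) auto
    ultimately show "((\<lambda>h. l2_norm N (\<lambda>x. D h x - q x)) \<longlongrightarrow> 0) (at 0)"
      by (rule Lim_null_comparison)
  qed
  show ?thesis
  proof
    show "l2_lim N (\<lambda>h x. (T (t + h) f x - T t f x) / h) q (at 0)"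
      using lim by (simp add: D_def[abs_def])
    fix v w assume gen: "l2_generator N T v w"
    then have v: "l2 N v" and w: "l2_lim N (\<lambda>h x. (T h v x - v x) / h) w (at_right 0)"
      by (auto simp: l2_generator_def)
    have limq: "((\<lambda>h. l2_inner N (D h) v) \<longlongrightarrow> l2_inner N q v) (at_right 0)"
      using l2_lim_inner[OF lim v] by (rule tendsto_mono[rotated]) (simp add: at_le)
    have limw: "((\<lambda>h. l2_inner N (\<lambda>x. (T h v x - v x) / h) (T t f)) \<longlongrightarrow> l2_inner N w (T t f)) (at_right 0)"
      by (intro l2_lim_inner w T_l2 f) (use t in simp)
    have "\<forall>\<^sub>F h in at_right 0. l2_inner N (\<lambda>x. (T h v x - v x) / h) (T t f) = l2_inner N (D h) v"
      using eventually_at_right_less[of 0]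
    proof eventually_elim
      case (elim h)
      have th: "0 \<le> t" "0 \<le> h" "0 \<le> h + t" using t elim by auto
      have "l2_inner N (T (t + h) f) v = l2_inner N (T h (T t f)) v"
        using T_plus[OF f th(2,1)] T_l2 th f v
        by (intro l2_inner_cong_AE l2_measurable T_l2) (auto simp: add.commute)
      also have "\<dots> = l2_inner N (T t f) (T h v)"
        by (intro T_symmetric th T_l2 f v)
      finally have *: "l2_inner N (T (t + h) f) v = l2_inner N (T h v) (T t f)"
        by (simp add: l2_inner_commute)
      have "l2_inner N (\<lambda>x. (T h v x - v x) / h) (T t f)
        = (1 / h) * (l2_inner N (T h v) (T t f) - l2_inner N v (T t f))"
        using l2_inner_scale_left[of N "1 / h" "\<lambda>x. T h v x - v x" "T t f"]
        by (simp add: l2_inner_diff_left T_l2 th f v)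
      moreover have "l2_inner N (D h) v = (1 / h) * (l2_inner N (T (t + h) f) v - l2_inner N (T t f) v)"
        unfolding D_eq l2_inner_scale_left
        by (subst l2_inner_diff_left) (use th f v in \<open>auto intro: T_l2 simp: add.commute\<close>)
      ultimately show ?case by (simp add: * l2_inner_commute[of N v])
    qed
    with limw have "((\<lambda>h. l2_inner N (D h) v) \<longlongrightarrow> l2_inner N w (T t f)) (at_right 0)"
      by (rule Lim_transform_eventually)
    then show "l2_inner N q v = l2_inner N (T t f) w"
      using tendsto_unique[OF trivial_limit_at_right_real limq] by (simp add: l2_inner_commute)
  qed
qed

end

section \<open>The Koopman semigroup of a reversible flow\<close>

locale reversible_flow = N: prob_space N + P: prob_space P
  for N :: "'x measure" and P :: "'a measure" +
  fixes \<Phi> :: "real \<Rightarrow> 'x \<Rightarrow> 'a \<Rightarrow> 'x"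
  assumes flow_measurable: "0 \<le> t \<Longrightarrow> (\<lambda>(x, \<omega>). \<Phi> t x \<omega>) \<in> measurable (N \<Otimes>\<^sub>M P) N"
    and flow_invariant: "invariant_measure P \<Phi> N"
    and flow_reversible: "time_reversible P \<Phi> N"
begin

sublocale NP: pair_prob_space N P ..

lemma flow_measurable': "0 \<le> t \<Longrightarrow> (\<lambda>z. \<Phi> t (fst z) (snd z)) \<in> measurable (N \<Otimes>\<^sub>M P) N"
  using flow_measurable by (simp add: case_prod_beta')

lemma distr_flow: "0 \<le> t \<Longrightarrow> distr (N \<Otimes>\<^sub>M P) N (\<lambda>z. \<Phi> t (fst z) (snd z)) = N"
  using flow_invariant by (simp add: invariant_measure_def case_prod_beta')

lemma flow_integral:
  fixes f :: "'x \<Rightarrow> real"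
  assumes "0 \<le> t" "f \<in> borel_measurable N"
  shows "integrable (N \<Otimes>\<^sub>M P) (\<lambda>z. f (\<Phi> t (fst z) (snd z))) \<longleftrightarrow> integrable N f"
    and "(\<integral>z. f (\<Phi> t (fst z) (snd z)) \<partial>(N \<Otimes>\<^sub>M P)) = (\<integral>x. f x \<partial>N)"
  using integrable_distr_eq[OF flow_measurable'[OF assms(1)] assms(2)]
    integral_distr[OF flow_measurable'[OF assms(1)] assms(2)]
  by (simp_all add: distr_flow[OF assms(1)])

lemma flow_AE:
  assumes "0 \<le> t" "AE x in N. p x"
  shows "AE z in N \<Otimes>\<^sub>M P. p (\<Phi> t (fst z) (snd z))"
  using AE_distrD[OF flow_measurable'[OF assms(1)]] assms(2) distr_flow[OF assms(1)] by metis

lemma flow_l2: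
  assumes "0 \<le> t" "l2 N f"
  shows "l2 (N \<Otimes>\<^sub>M P) (\<lambda>z. f (\<Phi> t (fst z) (snd z)))"
proof -
  have f [measurable]: "f \<in> borel_measurable N" using assms(2) by (rule l2_measurable)
  have "(\<lambda>x. (f x)\<^sup>2) \<in> borel_measurable N" by simp
  from flow_integral(1)[OF assms(1) this] assms(2) measurable_compose[OF flow_measurable'[OF assms(1)] f]
  show ?thesis by (simp add: l2_def)
qed

lemma fst_integrable:
  fixes f :: "'x \<Rightarrow> real"
  assumes f: "integrable N f"
  shows "integrable (N \<Otimes>\<^sub>M P) (\<lambda>z. f (fst z))"
  using integrable_distr_eq[of fst "N \<Otimes>\<^sub>M P" N f] f by (simp add: P.distr_pair_fst)

lemma fst_integral:
  fixes f :: "'x \<Rightarrow> real"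
  assumes "f \<in> borel_measurable N"
  shows "(\<integral>z. f (fst z) \<partial>(N \<Otimes>\<^sub>M P)) = (\<integral>x. f x \<partial>N)"
  using integral_distr[of fst "N \<Otimes>\<^sub>M P" N f] assms by (simp add: P.distr_pair_fst)

lemma fst_l2:
  assumes "l2 N f"
  shows "l2 (N \<Otimes>\<^sub>M P) (\<lambda>z. f (fst z))"
  using fst_integrable[of "\<lambda>x. (f x)\<^sup>2"] assms by (auto simp: l2_def)

lemma reversal_integral:
  fixes f g :: "'x \<Rightarrow> real"
  assumes t: "0 \<le> t" and f [measurable]: "f \<in> borel_measurable N" and g [measurable]: "g \<in> borel_measurable N"
  shows "(\<integral>z. f (\<Phi> t (fst z) (snd z)) * g (fst z) \<partial>(N \<Otimes>\<^sub>M P))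
    = (\<integral>z. f (fst z) * g (\<Phi> t (fst z) (snd z)) \<partial>(N \<Otimes>\<^sub>M P))"
proof -
  note flow_measurable'[OF t, measurable]
  have "(\<integral>w. f (snd w) * g (fst w) \<partial>distr (N \<Otimes>\<^sub>M P) (N \<Otimes>\<^sub>M N) (\<lambda>z. (fst z, \<Phi> t (fst z) (snd z))))
     = (\<integral>w. f (snd w) * g (fst w) \<partial>distr (N \<Otimes>\<^sub>M P) (N \<Otimes>\<^sub>M N) (\<lambda>z. (\<Phi> t (fst z) (snd z), fst z)))"
    using flow_reversible t by (simp add: time_reversible_def case_prod_beta')
  then show ?thesis by (subst (asm) (1 2) integral_distr) auto
qed

lemma reversal_nn_integral:
  assumes t: "0 \<le> t" and f [measurable]: "f \<in> borel_measurable N" and g [measurable]: "g \<in> borel_measurable N"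
  shows "(\<integral>\<^sup>+z. f (\<Phi> t (fst z) (snd z)) * g (fst z) \<partial>(N \<Otimes>\<^sub>M P))
    = (\<integral>\<^sup>+z. f (fst z) * g (\<Phi> t (fst z) (snd z)) \<partial>(N \<Otimes>\<^sub>M P))"
proof -
  note flow_measurable'[OF t, measurable]
  have "(\<integral>\<^sup>+w. f (snd w) * g (fst w) \<partial>distr (N \<Otimes>\<^sub>M P) (N \<Otimes>\<^sub>M N) (\<lambda>z. (fst z, \<Phi> t (fst z) (snd z))))
     = (\<integral>\<^sup>+w. f (snd w) * g (fst w) \<partial>distr (N \<Otimes>\<^sub>M P) (N \<Otimes>\<^sub>M N) (\<lambda>z. (\<Phi> t (fst z) (snd z), fst z)))"
    using flow_reversible t by (simp add: time_reversible_def case_prod_beta')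
  then show ?thesis by (subst (asm) (1 2) nn_integral_distr) auto
qed

lemma koopman_measurable:
  assumes "0 \<le> t" "f \<in> borel_measurable N"
  shows "koopman P \<Phi> t f \<in> borel_measurable N"
proof -
  note flow_measurable[OF assms(1), measurable] assms(2) [measurable]
  have "(\<lambda>z. f ((\<lambda>(x, \<omega>). \<Phi> t x \<omega>) z)) \<in> borel_measurable (N \<Otimes>\<^sub>M P)" by measurable
  then have "(\<lambda>(x, \<omega>). f (\<Phi> t x \<omega>)) \<in> borel_measurable (N \<Otimes>\<^sub>M P)" by (simp add: case_prod_beta')
  then show ?thesis unfolding koopman_def[abs_def] by (rule P.borel_measurable_lebesgue_integral)
qed

lemma AE_koopman_integrable:
  fixes f :: "'x \<Rightarrow> real"
  assumes "0 \<le> t" "integrable N f"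
  shows "AE x in N. integrable P (\<lambda>\<omega>. f (\<Phi> t x \<omega>))"
  using NP.AE_integrable_fst'[of "\<lambda>z. f (\<Phi> t (fst z) (snd z))"] flow_integral(1)[of t f] assms by auto

lemma l2_imp_integrable: "l2 N f \<Longrightarrow> integrable N f"
  using l2_integrable_mult[of N f "\<lambda>x. 1"] by (simp add: l2_def)

text \<open>Jensen's inequality in \<open>\<omega>\<close>, in the form of the Cauchy-Schwarz inequality against the constant
  \<open>1\<close>, followed by invariance.\<close>

lemma koopman_l2_bound:
  assumes t: "0 \<le> t" and f: "l2 N f"
  shows "l2 N (koopman P \<Phi> t f)" and "l2_norm N (koopman P \<Phi> t f) \<le> l2_norm N f"
proof -
  note flow_measurable'[OF t, measurable]
  have [measurable]: "f \<in> borel_measurable N" using f by (rule l2_measurable)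
  have sq: "integrable N (\<lambda>x. (f x)\<^sup>2)" using f by (simp add: l2_def)
  define g where "g x = (\<integral>\<omega>. (f (\<Phi> t x \<omega>))\<^sup>2 \<partial>P)" for x
  have sq': "integrable (N \<Otimes>\<^sub>M P) (\<lambda>z. (f (\<Phi> t (fst z) (snd z)))\<^sup>2)"
    using flow_integral(1)[OF t, of "\<lambda>x. (f x)\<^sup>2"] sq by simp
  have g: "integrable N g" "(\<integral>x. g x \<partial>N) = (\<integral>x. (f x)\<^sup>2 \<partial>N)"
    using NP.integrable_fst'[OF sq'] NP.integral_fst'[OF sq'] flow_integral(2)[OF t, of "\<lambda>x. (f x)\<^sup>2"]
    by (simp_all add: g_def[abs_def])
  have le: "AE x in N. (koopman P \<Phi> t f x)\<^sup>2 \<le> g x"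
    using AE_koopman_integrable[OF t sq] AE_space
  proof eventually_elim
    case (elim x)
    have "(\<lambda>\<omega>. f (\<Phi> t (fst (x, \<omega>)) (snd (x, \<omega>)))) \<in> borel_measurable P"
      using elim(2) by measurable
    then have l2: "l2 P (\<lambda>\<omega>. f (\<Phi> t x \<omega>))" "l2 P (\<lambda>\<omega>. 1)"
      using elim(1) by (auto simp: l2_def)
    have "\<bar>koopman P \<Phi> t f x\<bar> \<le> l2_norm P (\<lambda>\<omega>. f (\<Phi> t x \<omega>))"
      using l2_Cauchy_Schwarz[OF l2] by (simp add: koopman_def l2_inner_def l2_norm_def P.prob_space)
    then have "(koopman P \<Phi> t f x)\<^sup>2 \<le> (l2_norm P (\<lambda>\<omega>. f (\<Phi> t x \<omega>)))\<^sup>2"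
      by (intro power2_le_iff_abs_le[THEN iffD2]) auto
    then show ?case by (simp add: l2_norm_sq_integral g_def)
  qed
  have [measurable]: "koopman P \<Phi> t f \<in> borel_measurable N" by (rule koopman_measurable[OF t]) simp
  show l2: "l2 N (koopman P \<Phi> t f)"
    unfolding l2_def
  proof
    show "integrable N (\<lambda>x. (koopman P \<Phi> t f x)\<^sup>2)"
      by (rule Bochner_Integration.integrable_bound[OF g(1)]) (use le in auto)
  qed simp
  have "(l2_norm N (koopman P \<Phi> t f))\<^sup>2 \<le> (\<integral>x. g x \<partial>N)"
    unfolding l2_norm_sq_integral using l2 g(1) le by (intro integral_mono_AE) (auto simp: l2_def)
  also have "\<dots> = (l2_norm N f)\<^sup>2" by (simp add: g(2) l2_norm_sq_integral)
  finally show "l2_norm N (koopman P \<Phi> t f) \<le> l2_norm N f"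
    by (rule power2_le_imp_le) simp
qed

lemma koopman_inner:
  assumes t: "0 \<le> t" and f: "l2 N f" and g: "l2 N g"
  shows "integrable (N \<Otimes>\<^sub>M P) (\<lambda>z. f (\<Phi> t (fst z) (snd z)) * g (fst z))"
    and "(\<integral>z. f (\<Phi> t (fst z) (snd z)) * g (fst z) \<partial>(N \<Otimes>\<^sub>M P)) = l2_inner N (koopman P \<Phi> t f) g"
  using l2_integrable_mult[OF flow_l2[OF t f] fst_l2[OF g]]
    NP.integral_fst'[OF l2_integrable_mult[OF flow_l2[OF t f] fst_l2[OF g]]]
  by (simp_all add: l2_inner_def koopman_def)

text \<open>Detailed balance exchanges the roles of the two endpoints of a trajectory.\<close>

lemma koopman_symmetric:
  assumes t: "0 \<le> t" and f: "l2 N f" and g: "l2 N g"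
  shows "l2_inner N (koopman P \<Phi> t f) g = l2_inner N f (koopman P \<Phi> t g)"
proof -
  show ?thesis
    using koopman_inner(2)[OF t f g] koopman_inner(2)[OF t g f]
      reversal_integral[OF t l2_measurable[OF f] l2_measurable[OF g]]
    by (simp add: l2_inner_commute[of N f] mult.commute)
qed

lemma symmetric_contraction_semigroup_koopman:
  assumes "l2_semigroup N (koopman P \<Phi>)"
  shows "symmetric_contraction_semigroup N (koopman P \<Phi>)"
proof
  fix t :: real and f g :: "'x \<Rightarrow> real" and a :: real
  assume t: "0 \<le> t" and f: "l2 N f"
  show "l2 N (koopman P \<Phi> t f)" "l2_norm N (koopman P \<Phi> t f) \<le> l2_norm N f"
    by (rule koopman_l2_bound[OF t f])+
  show "AE x in N. koopman P \<Phi> t (\<lambda>x. a * f x) x = a * koopman P \<Phi> t f x"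
    by (simp add: koopman_def)
  assume g: "l2 N g"
  show "l2_inner N (koopman P \<Phi> t f) g = l2_inner N f (koopman P \<Phi> t g)"
    by (rule koopman_symmetric[OF t f g])
  show "AE x in N. koopman P \<Phi> t (\<lambda>x. f x + g x) x = koopman P \<Phi> t f x + koopman P \<Phi> t g x"
    using AE_koopman_integrable[OF t l2_imp_integrable[OF f]] AE_koopman_integrable[OF t l2_imp_integrable[OF g]]
    by eventually_elim (simp add: koopman_def)
qed (use assms in \<open>auto intro: N.finite_measure_axioms\<close>)

lemma snapshot_average_tendsto:
  assumes data: "snapshot_data Q N P X \<Xi>" and f: "integrable (N \<Otimes>\<^sub>M P) f"
  shows "AE \<omega> in Q. (\<lambda>M. 1 / real M * (\<Sum>m<M. f (X m \<omega>, \<Xi> m \<omega>))) \<longlonglongrightarrow> (\<integral>z. f z \<partial>(N \<Otimes>\<^sub>M P))"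
  using data strong_law_of_large_numbers[OF _ NP.prob_space_axioms _ _ f, of Q "\<lambda>m \<omega>. (X m \<omega>, \<Xi> m \<omega>)"]
  by (simp add: snapshot_data_def)

text \<open>Reversibility moves a density \<open>f\<close> of the initial state with respect to \<open>N\<close> onto the state at
  time \<open>t\<close>, so that the density evolves under the Koopman operator itself.\<close>

lemma distr_density_flow:
  assumes t: "0 \<le> t" and f: "l2 N f" and nonneg: "AE x in N. 0 \<le> f x"
  shows "distr (density N (\<lambda>x. ennreal (f x)) \<Otimes>\<^sub>M P) N (\<lambda>(x, \<omega>). \<Phi> t x \<omega>)
    = density N (\<lambda>x. ennreal (koopman P \<Phi> t f x))"
    and "AE x in N. 0 \<le> koopman P \<Phi> t f x"
proof -
  note flow_measurable'[OF t, measurable] l2_measurable[OF f, measurable]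
  have [measurable]: "koopman P \<Phi> t f \<in> borel_measurable N" by (rule koopman_measurable[OF t]) simp
  have AE: "AE x in N. (\<integral>\<^sup>+\<omega>. ennreal (f (\<Phi> t x \<omega>)) \<partial>P) = ennreal (koopman P \<Phi> t f x) \<and> 0 \<le> koopman P \<Phi> t f x"
    using AE_koopman_integrable[OF t l2_imp_integrable[OF f]] NP.AE_pair[OF flow_AE[OF t nonneg]]
  proof eventually_elim
    case (elim x)
    then show ?case unfolding koopman_def
      by (intro conjI nn_integral_eq_integral integral_nonneg_AE) auto
  qed
  then show "AE x in N. 0 \<le> koopman P \<Phi> t f x" by auto
  have sets: "sets (density N (\<lambda>x. ennreal (f x)) \<Otimes>\<^sub>M P) = sets (N \<Otimes>\<^sub>M P)"
    by (intro sets_pair_measure_cong) auto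
  have meas: "(\<lambda>(x, \<omega>). \<Phi> t x \<omega>) \<in> measurable (density N (\<lambda>x. ennreal (f x)) \<Otimes>\<^sub>M P) N"
    using flow_measurable[OF t] measurable_cong_sets[OF sets refl] by blast
  show "distr (density N (\<lambda>x. ennreal (f x)) \<Otimes>\<^sub>M P) N (\<lambda>(x, \<omega>). \<Phi> t x \<omega>)
    = density N (\<lambda>x. ennreal (koopman P \<Phi> t f x))" (is "?D = ?E")
  proof (rule measure_eqI)
    fix A assume "A \<in> sets ?D"
    then have A [measurable]: "A \<in> sets N" by simp
    have "emeasure ?D A = (\<integral>\<^sup>+y. indicator A y \<partial>?D)" by simp
    also have "\<dots> = (\<integral>\<^sup>+z. indicator A (\<Phi> t (fst z) (snd z)) \<partial>(density N (\<lambda>x. ennreal (f x)) \<Otimes>\<^sub>M P))"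
      by (subst nn_integral_distr[OF meas]) (auto simp: case_prod_beta')
    also have "\<dots> = (\<integral>\<^sup>+x. \<integral>\<^sup>+\<omega>. indicator A (\<Phi> t x \<omega>) \<partial>P \<partial>density N (\<lambda>x. ennreal (f x)))"
    proof -
      have "(\<lambda>z. indicator A (\<Phi> t (fst z) (snd z)) :: ennreal)
          \<in> borel_measurable (density N (\<lambda>x. ennreal (f x)) \<Otimes>\<^sub>M P)"
        unfolding measurable_cong_sets[OF sets refl] by measurable
      from P.nn_integral_fst[OF this] show ?thesis by simp
    qed
    also have "\<dots> = (\<integral>\<^sup>+x. ennreal (f x) * (\<integral>\<^sup>+\<omega>. indicator A (\<Phi> t x \<omega>) \<partial>P) \<partial>N)"
    proof (rule nn_integral_density)
      have "(\<lambda>(x, \<omega>). indicator A (\<Phi> t x \<omega>) :: ennreal) \<in> borel_measurable (N \<Otimes>\<^sub>M P)"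
        unfolding case_prod_beta' by measurable
      then show "(\<lambda>x. \<integral>\<^sup>+\<omega>. indicator A (\<Phi> t x \<omega>) \<partial>P) \<in> borel_measurable N"
        by (rule P.borel_measurable_nn_integral)
    qed simp
    also have "\<dots> = (\<integral>\<^sup>+x. \<integral>\<^sup>+\<omega>. ennreal (f x) * indicator A (\<Phi> t x \<omega>) \<partial>P \<partial>N)"
    proof (rule nn_integral_cong)
      fix x assume "x \<in> space N"
      then have "(\<lambda>\<omega>. indicator A (\<Phi> t (fst (x, \<omega>)) (snd (x, \<omega>))) :: ennreal) \<in> borel_measurable P"
        by measurable
      then show "ennreal (f x) * (\<integral>\<^sup>+\<omega>. indicator A (\<Phi> t x \<omega>) \<partial>P)
        = (\<integral>\<^sup>+\<omega>. ennreal (f x) * indicator A (\<Phi> t x \<omega>) \<partial>P)"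
        by (simp add: nn_integral_cmult)
    qed
    also have "\<dots> = (\<integral>\<^sup>+z. ennreal (f (fst z)) * indicator A (\<Phi> t (fst z) (snd z)) \<partial>(N \<Otimes>\<^sub>M P))"
      using P.nn_integral_fst[of "\<lambda>z. ennreal (f (fst z)) * indicator A (\<Phi> t (fst z) (snd z))" N] by simp
    also have "\<dots> = (\<integral>\<^sup>+z. ennreal (f (\<Phi> t (fst z) (snd z))) * indicator A (fst z) \<partial>(N \<Otimes>\<^sub>M P))"
      by (rule reversal_nn_integral[OF t, symmetric]) auto
    also have "\<dots> = (\<integral>\<^sup>+x. \<integral>\<^sup>+\<omega>. ennreal (f (\<Phi> t x \<omega>)) * indicator A x \<partial>P \<partial>N)"
      using P.nn_integral_fst[of "\<lambda>z. ennreal (f (\<Phi> t (fst z) (snd z))) * indicator A (fst z)" N] by simp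
    also have "\<dots> = (\<integral>\<^sup>+x. ennreal (koopman P \<Phi> t f x) * indicator A x \<partial>N)"
    proof (rule nn_integral_cong_AE)
      show "AE x in N. (\<integral>\<^sup>+\<omega>. ennreal (f (\<Phi> t x \<omega>)) * indicator A x \<partial>P)
        = ennreal (koopman P \<Phi> t f x) * indicator A x"
        using AE by eventually_elim (auto simp: indicator_def)
    qed
    also have "\<dots> = emeasure ?E A" by (simp add: emeasure_density)
    finally show "emeasure ?D A = emeasure ?E A" .
  qed simp
qed

end

section \<open>Convergence of matrices and of their pseudoinverses\<close>

lemma mat_mult_entry:
  assumes "A \<in> carrier_mat n n" "B \<in> carrier_mat n n" "i < n" "j < n"
  shows "(A * B) $$ (i, j) = (\<Sum>l<n. A $$ (i, l) * B $$ (l, j))"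
  using assms by (simp add: scalar_prod_def lessThan_atLeast0)

lemma transpose_mult_vec_entry:
  assumes "B \<in> carrier_mat n n" "a \<in> carrier_vec n" "j < n"
  shows "vec_index (transpose_mat B *\<^sub>v a) j = (\<Sum>i<n. B $$ (i, j) * vec_index a i)"
  using assms by (simp add: scalar_prod_def lessThan_atLeast0)

lemma tendsto_det:
  fixes A :: "'k \<Rightarrow> real mat"
  assumes A: "\<And>k. A k \<in> carrier_mat n n" and B: "B \<in> carrier_mat n n"
    and lim: "\<And>i j. i < n \<Longrightarrow> j < n \<Longrightarrow> ((\<lambda>k. A k $$ (i, j)) \<longlongrightarrow> B $$ (i, j)) \<F>"
  shows "((\<lambda>k. det (A k)) \<longlongrightarrow> det B) \<F>"
  unfolding det_def'[OF A] det_def'[OF B]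
  by (intro tendsto_sum tendsto_mult tendsto_const tendsto_prod lim)
    (auto dest: permutes_in_image)

lemma tendsto_adj_mat:
  fixes A :: "'k \<Rightarrow> real mat"
  assumes A: "\<And>k. A k \<in> carrier_mat n n" and B: "B \<in> carrier_mat n n"
    and lim: "\<And>i j. i < n \<Longrightarrow> j < n \<Longrightarrow> ((\<lambda>k. A k $$ (i, j)) \<longlongrightarrow> B $$ (i, j)) \<F>"
    and ij: "i < n" "j < n"
  shows "((\<lambda>k. adj_mat (A k) $$ (i, j)) \<longlongrightarrow> adj_mat B $$ (i, j)) \<F>"
proof -
  have dims: "dim_row (A k) = n" "dim_col (A k) = n" "dim_row B = n" "dim_col B = n" for k
    using A[of k] B by auto
  have "((\<lambda>k. det (mat_delete (A k) j i)) \<longlongrightarrow> det (mat_delete B j i)) \<F>"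
    by (rule tendsto_det[where n = "n - 1"]) (auto simp: mat_delete_def dims intro!: lim)
  then have "((\<lambda>k. (-1) ^ (j + i) * det (mat_delete (A k) j i)) \<longlongrightarrow> (-1) ^ (j + i) * det (mat_delete B j i)) \<F>"
    by (intro tendsto_intros)
  then show ?thesis using ij by (simp add: adj_mat_def cofactor_def dims)
qed

lemma pinv_eq_inverse:
  assumes G: "G \<in> carrier_mat n n" and C: "C \<in> carrier_mat n n"
    and GC: "G * C = 1\<^sub>m n" and CG: "C * G = 1\<^sub>m n"
  shows "pinv G = C"
  unfolding pinv_def
proof (rule the_equality)
  show "C \<in> carrier_mat (dim_col G) (dim_row G) \<and> G * C * G = G \<and> C * G * C = C \<and>
    transpose_mat (G * C) = G * C \<and> transpose_mat (C * G) = C * G"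
    using G C by (simp add: GC CG)
  fix X assume "X \<in> carrier_mat (dim_col G) (dim_row G) \<and> G * X * G = G \<and> X * G * X = X \<and>
    transpose_mat (G * X) = G * X \<and> transpose_mat (X * G) = X * G"
  then have X: "X \<in> carrier_mat n n" and "G * X * G = G" using G by auto
  have "X = (C * G) * X * (G * C)" using X by (simp add: GC CG)
  also have "\<dots> = C * (G * X * G) * C"
    using G C X by (simp add: assoc_mult_mat[of _ n n _ n _ n])
  also have "\<dots> = C" using \<open>G * X * G = G\<close> C by (simp add: CG)
  finally show "X = C" .
qed

lemma mat_inv_one: "mat_inv (1\<^sub>m n) = 1\<^sub>m n"
  unfolding mat_inv_def by (rule the_equality) (auto simp: inverts_mat_def)

text \<open>The determinants tend to \<open>1\<close>, so the matrices are eventually invertible and the pseudoinverse is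
  the adjugate divided by the determinant, both of which are polynomials in the entries.\<close>

lemma tendsto_pinv_one:
  fixes G :: "'k \<Rightarrow> real mat"
  assumes G: "\<And>k. G k \<in> carrier_mat n n"
    and lim: "\<And>i j. i < n \<Longrightarrow> j < n \<Longrightarrow> ((\<lambda>k. G k $$ (i, j)) \<longlongrightarrow> (if i = j then 1 else 0)) \<F>"
  shows "\<forall>\<^sub>F k in \<F>. pinv (G k) \<in> carrier_mat n n"
    and "i < n \<Longrightarrow> j < n \<Longrightarrow> ((\<lambda>k. pinv (G k) $$ (i, j)) \<longlongrightarrow> (if i = j then 1 else 0)) \<F>"
proof -
  have lim': "((\<lambda>k. G k $$ (i, j)) \<longlongrightarrow> 1\<^sub>m n $$ (i, j)) \<F>" if "i < n" "j < n" for i j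
    using lim[OF that] that by simp
  have adj1: "adj_mat (1\<^sub>m n) = (1\<^sub>m n :: real mat)"
  proof -
    have "(1 :: real) \<cdot>\<^sub>m 1\<^sub>m n = 1\<^sub>m n" by (rule eq_matI) auto
    then show ?thesis using adj_mat[of "1\<^sub>m n :: real mat" n] by simp
  qed
  have det: "((\<lambda>k. det (G k)) \<longlongrightarrow> 1) \<F>"
    using tendsto_det[OF G one_carrier_mat lim'] by simp
  then have ev: "\<forall>\<^sub>F k in \<F>. det (G k) \<noteq> 0"
    by (rule tendsto_imp_eventually_ne) simp
  have inv: "pinv (G k) = (1 / det (G k)) \<cdot>\<^sub>m adj_mat (G k)" if "det (G k) \<noteq> 0" for k
  proof (rule pinv_eq_inverse[OF G])
    note adj = adj_mat[OF G[of k]]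
    show "(1 / det (G k)) \<cdot>\<^sub>m adj_mat (G k) \<in> carrier_mat n n" using adj by simp
    show "G k * ((1 / det (G k)) \<cdot>\<^sub>m adj_mat (G k)) = 1\<^sub>m n"
      using that adj by (subst mult_smult_distrib[OF G adj(1)]) (auto intro!: eq_matI)
    show "((1 / det (G k)) \<cdot>\<^sub>m adj_mat (G k)) * G k = 1\<^sub>m n"
      using that adj by (subst mult_smult_assoc_mat[OF adj(1) G]) (auto intro!: eq_matI)
  qed
  show "\<forall>\<^sub>F k in \<F>. pinv (G k) \<in> carrier_mat n n"
    using ev by eventually_elim (use adj_mat(1)[OF G] in \<open>simp add: inv\<close>)
  assume ij: "i < n" "j < n"
  have "((\<lambda>k. 1 / det (G k) * adj_mat (G k) $$ (i, j)) \<longlongrightarrow> 1 / 1 * adj_mat (1\<^sub>m n) $$ (i, j)) \<F>"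
    by (intro tendsto_mult tendsto_divide tendsto_const det tendsto_adj_mat[OF G one_carrier_mat lim'] ij) auto
  moreover have "\<forall>\<^sub>F k in \<F>. 1 / det (G k) * adj_mat (G k) $$ (i, j) = pinv (G k) $$ (i, j)"
    using ev by eventually_elim (use ij in \<open>simp add: inv carrier_matD[OF adj_mat(1)[OF G]]\<close>)
  ultimately show "((\<lambda>k. pinv (G k) $$ (i, j)) \<longlongrightarrow> (if i = j then 1 else 0)) \<F>"
    using ij by (auto simp: adj1 elim: Lim_transform_eventually)
qed

section \<open>Operators on the span of the dictionary\<close>

lemma dict_comb_eq:
  "a \<in> carrier_vec n \<Longrightarrow> dict_comb \<psi> a = (\<lambda>x. \<Sum>i<n. vec_index a i * \<psi> i x)"
  by (auto simp: dict_comb_def)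

lemma combination_in_dict_span: "(\<lambda>x. \<Sum>i<n. c i * \<psi> i x) \<in> dict_span \<psi> n"
proof -
  have "(\<lambda>x. \<Sum>i<n. c i * \<psi> i x) = dict_comb \<psi> (Matrix.vec n c)"
    by (simp add: dict_comb_eq[of _ n])
  then show ?thesis by (auto simp: dict_span_def)
qed

lemma dict_spanE:
  assumes "g \<in> dict_span \<psi> n"
  obtains a where "a \<in> carrier_vec n" "g = dict_comb \<psi> a"
  using assms by (auto simp: dict_span_def)

context
  fixes N :: "'x measure" and \<psi> :: "nat \<Rightarrow> 'x \<Rightarrow> real"
  assumes basis: "l2_orthonormal_basis N \<psi>"
begin

lemmas \<psi> = l2_orthonormal_basisD[OF basis]

lemma dict_comb_l2: "l2 N (dict_comb \<psi> a)"
  unfolding dict_comb_def[abs_def] by (intro l2_sum l2_scale \<psi>)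

lemma dict_span_l2: "g \<in> dict_span \<psi> n \<Longrightarrow> l2 N g"
  by (auto simp: dict_span_def dict_comb_l2)

lemma dict_comb_coefficient:
  assumes "a \<in> carrier_vec n" "j < n"
  shows "l2_inner N (dict_comb \<psi> a) (\<psi> j) = vec_index a j"
  using orthonormal_inner_combination[of n N \<psi> j "vec_index a"] assms \<psi> by (simp add: dict_comb_eq)

lemma dict_comb_inject:
  assumes "a \<in> carrier_vec n" "b \<in> carrier_vec n" "dict_comb \<psi> a = dict_comb \<psi> b"
  shows "a = b"
  using assms dict_comb_coefficient[of a n] dict_comb_coefficient[of b n] by (intro eq_vecI) auto

lemma dict_operator_comb:
  assumes "a \<in> carrier_vec n"
  shows "dict_operator \<psi> n B (dict_comb \<psi> a) = dict_comb \<psi> (transpose_mat B *\<^sub>v a)"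
proof -
  have "(THE b. b \<in> carrier_vec n \<and> dict_comb \<psi> b = dict_comb \<psi> a) = a"
    using assms dict_comb_inject by (intro the_equality) auto
  then show ?thesis by (simp add: dict_operator_def)
qed

lemma dict_comb_norm_sq:
  assumes "a \<in> carrier_vec n"
  shows "(l2_norm N (dict_comb \<psi> a))\<^sup>2 = (\<Sum>i<n. (vec_index a i)\<^sup>2)"
  using orthonormal_norm_combination[of n N \<psi> "vec_index a"] assms \<psi> by (simp add: dict_comb_eq)

lemma inner_dict_comb:
  assumes "a \<in> carrier_vec n" "l2 N g"
  shows "l2_inner N g (dict_comb \<psi> a) = (\<Sum>i<n. vec_index a i * l2_inner N g (\<psi> i))"
  unfolding dict_comb_eq[OF assms(1)] using assms \<psi>(1)
  by (subst l2_inner_sum_right) (auto simp: l2_inner_scale_right intro: l2_scale)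

lemma inner_dict_span_cong:
  assumes "l2 N f" "l2 N g" "\<And>j. j < n \<Longrightarrow> l2_inner N f (\<psi> j) = l2_inner N g (\<psi> j)"
    and "h \<in> dict_span \<psi> n"
  shows "l2_inner N f h = l2_inner N g h"
  using assms by (auto simp: dict_span_def inner_dict_comb)

lemma dict_span_expansion:
  assumes "g \<in> dict_span \<psi> n"
  shows "g = (\<lambda>x. \<Sum>i<n. l2_inner N g (\<psi> i) * \<psi> i x)"
proof -
  obtain a where a: "a \<in> carrier_vec n" "g = dict_comb \<psi> a" using assms by (rule dict_spanE)
  have "g = (\<lambda>x. \<Sum>i<n. vec_index a i * \<psi> i x)" by (simp only: a(2) dict_comb_eq[OF a(1)])
  also have "\<dots> = (\<lambda>x. \<Sum>i<n. l2_inner N g (\<psi> i) * \<psi> i x)"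
    by (intro ext sum.cong refl) (simp add: a(2) dict_comb_coefficient[OF a(1)])
  finally show ?thesis .
qed

lemma basis_in_dict_span: "j < n \<Longrightarrow> \<psi> j \<in> dict_span \<psi> n"
proof -
  assume "j < n"
  then have "(\<lambda>x. \<Sum>i<n. (if i = j then 1 else 0) * \<psi> i x) = \<psi> j"
    by (auto simp: if_distrib[where f = "\<lambda>c. c * _"] cong: if_cong)
  then show ?thesis using combination_in_dict_span[where n = n and c = "\<lambda>i. if i = j then 1 else 0" and \<psi> = \<psi>]
    by simp
qed

lemma dict_proj_eq:
  assumes g: "l2 N g"
  shows "dict_proj N \<psi> n g = (\<lambda>x. \<Sum>i<n. l2_inner N g (\<psi> i) * \<psi> i x)" (is "_ = ?f")
  unfolding dict_proj_def
proof (rule the_equality)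
  have f: "?f \<in> dict_span \<psi> n" by (rule combination_in_dict_span)
  have coef: "l2_inner N ?f (\<psi> j) = l2_inner N g (\<psi> j)" if "j < n" for j
    using that \<psi> by (intro orthonormal_inner_combination) auto
  show "?f \<in> dict_span \<psi> n \<and> (\<forall>h\<in>dict_span \<psi> n. l2_inner N (\<lambda>x. g x - ?f x) h = 0)"
    using inner_dict_span_cong[OF dict_span_l2[OF f] g coef] f
    by (auto simp: l2_inner_diff_left[OF g dict_span_l2[OF f] dict_span_l2])
  fix f' assume f': "f' \<in> dict_span \<psi> n \<and> (\<forall>h\<in>dict_span \<psi> n. l2_inner N (\<lambda>x. g x - f' x) h = 0)"
  have "l2_inner N f' (\<psi> j) = l2_inner N g (\<psi> j)" if "j < n" for j
    using f' basis_in_dict_span[OF that] l2_inner_diff_left[OF g dict_span_l2 \<psi>(1), of f' n j] by auto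
  then show "f' = ?f" using dict_span_expansion[of f' n] f' by simp
qed

lemma gal_G_eq_one: "matrix_of n (gal_G N \<psi>) = 1\<^sub>m n"
  by (rule eq_matI) (auto simp: matrix_of_def gal_G_def \<psi>)

lemma galerkin_eq_dict_operator: "galerkin N K \<psi> n = dict_operator \<psi> n (matrix_of n (gal_A N K \<psi>))"
  unfolding galerkin_def gal_G_eq_one mat_inv_one by (simp add: matrix_of_def)

text \<open>In the coordinates of the orthonormal dictionary the difference of two dictionary operators is a
  matrix, whose operator norm is at most its Hilbert-Schmidt norm.\<close>

lemma dict_operator_diff_norm:
  assumes B: "B \<in> carrier_mat n n" and C: "C \<in> carrier_mat n n" and g: "g \<in> dict_span \<psi> n"
  shows "l2_norm N (\<lambda>x. dict_operator \<psi> n B g x - dict_operator \<psi> n C g x)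
    \<le> sqrt (\<Sum>j<n. \<Sum>i<n. (B $$ (i, j) - C $$ (i, j))\<^sup>2) * l2_norm N g"
proof -
  obtain a where a: "a \<in> carrier_vec n" "g = dict_comb \<psi> a" using g by (rule dict_spanE)
  have Ba: "transpose_mat B *\<^sub>v a \<in> carrier_vec n" and Ca: "transpose_mat C *\<^sub>v a \<in> carrier_vec n"
    using B C a by auto
  define d where "d = transpose_mat B *\<^sub>v a - transpose_mat C *\<^sub>v a"
  have d: "d \<in> carrier_vec n" unfolding d_def by (rule minus_carrier_vec[OF Ba Ca])
  have d_entry: "vec_index d j = (\<Sum>i<n. (B $$ (i, j) - C $$ (i, j)) * vec_index a i)" if "j < n" for j
  proof -
    have "vec_index d j = vec_index (transpose_mat B *\<^sub>v a) j - vec_index (transpose_mat C *\<^sub>v a) j"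
      unfolding d_def using that carrier_vecD[OF Ca] by (intro index_minus_vec) simp
    then show ?thesis
      by (simp only: transpose_mult_vec_entry[OF B a(1) that] transpose_mult_vec_entry[OF C a(1) that]
          left_diff_distrib sum_subtractf)
  qed
  have "(\<lambda>x. dict_operator \<psi> n B g x - dict_operator \<psi> n C g x) = dict_comb \<psi> d"
    unfolding a(2) dict_operator_comb[OF a(1)] dict_comb_eq[OF Ba] dict_comb_eq[OF Ca] dict_comb_eq[OF d]
    by (simp add: d_entry transpose_mult_vec_entry[OF B a(1)] transpose_mult_vec_entry[OF C a(1)]
        left_diff_distrib sum_subtractf del: index_mult_mat_vec)
  then have "(l2_norm N (\<lambda>x. dict_operator \<psi> n B g x - dict_operator \<psi> n C g x))\<^sup>2
    = (\<Sum>j<n. (\<Sum>i<n. (B $$ (i, j) - C $$ (i, j)) * vec_index a i)\<^sup>2)"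
    by (simp add: dict_comb_norm_sq[OF d] d_entry)
  also have "\<dots> \<le> (\<Sum>j<n. (\<Sum>i<n. (B $$ (i, j) - C $$ (i, j))\<^sup>2) * (\<Sum>i<n. (vec_index a i)\<^sup>2))"
    by (intro sum_mono Cauchy_Schwarz_ineq_sum)
  also have "\<dots> = (sqrt (\<Sum>j<n. \<Sum>i<n. (B $$ (i, j) - C $$ (i, j))\<^sup>2) * l2_norm N g)\<^sup>2"
    by (simp add: power_mult_distrib a dict_comb_norm_sq[OF a(1)] sum_nonneg flip: sum_distrib_right)
  finally show ?thesis
    by (rule power2_le_imp_le) (simp add: sum_nonneg)
qed

lemma dict_operator_lim_edmd:
  assumes A: "\<And>i j. (\<lambda>M. emp_A \<psi> M x y i j) \<longlonglongrightarrow> gal_A N K \<psi> i j"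
    and G: "\<And>i j. (\<lambda>M. emp_G \<psi> M x i j) \<longlonglongrightarrow> gal_G N \<psi> i j"
  shows "dict_operator_lim N \<psi> n (\<lambda>M. edmd \<psi> M n x y) (galerkin N K \<psi> n)"
proof -
  define B where "B M = matrix_of n (emp_A \<psi> M x y) * pinv (matrix_of n (emp_G \<psi> M x))" for M
  define C where "C = matrix_of n (gal_A N K \<psi>)"
  have C: "C \<in> carrier_mat n n" by (simp add: C_def matrix_of_def)
  have Gl: "((\<lambda>M. matrix_of n (emp_G \<psi> M x) $$ (i, j)) \<longlonglongrightarrow> (if i = j then 1 else 0))"
    if "i < n" "j < n" for i j
    using G[of i j] that by (simp add: matrix_of_def gal_G_def \<psi>)
  have Gc: "matrix_of n (emp_G \<psi> M x) \<in> carrier_mat n n" for M by (simp add: matrix_of_def)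
  have Ac: "matrix_of n (emp_A \<psi> M x y) \<in> carrier_mat n n" for M by (simp add: matrix_of_def)
  have pinv: "\<forall>\<^sub>F M in sequentially. pinv (matrix_of n (emp_G \<psi> M x)) \<in> carrier_mat n n"
    "\<And>i j. i < n \<Longrightarrow> j < n \<Longrightarrow>
      (\<lambda>M. pinv (matrix_of n (emp_G \<psi> M x)) $$ (i, j)) \<longlonglongrightarrow> (if i = j then 1 else 0)"
    using tendsto_pinv_one[of "\<lambda>M. matrix_of n (emp_G \<psi> M x)" n sequentially] Gc Gl by blast+
  have B: "\<forall>\<^sub>F M in sequentially. B M \<in> carrier_mat n n"
    using pinv(1) unfolding B_def by eventually_elim (rule mult_carrier_mat[OF Ac])
  have lim: "(\<lambda>M. B M $$ (i, j)) \<longlonglongrightarrow> C $$ (i, j)" if ij: "i < n" "j < n" for i j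
  proof -
    have "(\<lambda>M. \<Sum>l<n. emp_A \<psi> M x y i l * pinv (matrix_of n (emp_G \<psi> M x)) $$ (l, j))
      \<longlonglongrightarrow> (\<Sum>l<n. gal_A N K \<psi> i l * (if l = j then 1 else 0))"
      by (intro tendsto_sum tendsto_mult A pinv(2)) (use ij in auto)
    moreover have "\<forall>\<^sub>F M in sequentially.
      (\<Sum>l<n. emp_A \<psi> M x y i l * pinv (matrix_of n (emp_G \<psi> M x)) $$ (l, j)) = B M $$ (i, j)"
      using pinv(1)
      by eventually_elim (simp add: B_def mat_mult_entry[OF Ac _ ij], simp add: matrix_of_def ij)
    ultimately have "(\<lambda>M. B M $$ (i, j)) \<longlonglongrightarrow> (\<Sum>l<n. gal_A N K \<psi> i l * (if l = j then 1 else 0))"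
      by (rule Lim_transform_eventually)
    then show ?thesis
      using ij by (simp add: C_def matrix_of_def if_distrib[where f = "\<lambda>c. _ * c"] cong: if_cong)
  qed
  have "(\<lambda>M. sqrt (\<Sum>j<n. \<Sum>i<n. (B M $$ (i, j) - C $$ (i, j))\<^sup>2))
      \<longlonglongrightarrow> sqrt (\<Sum>j<n. \<Sum>i<n. (C $$ (i, j) - C $$ (i, j))\<^sup>2)"
    by (intro tendsto_intros lim) auto
  then have small: "(\<lambda>M. sqrt (\<Sum>j<n. \<Sum>i<n. (B M $$ (i, j) - C $$ (i, j))\<^sup>2)) \<longlonglongrightarrow> 0"
    by simp
  show ?thesis
    unfolding dict_operator_lim_def
  proof (intro allI impI)
    fix \<epsilon> :: real assume "0 < \<epsilon>"
    from order_tendstoD(2)[OF small this] B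
    show "\<forall>\<^sub>F M in sequentially. \<forall>g\<in>dict_span \<psi> n.
        l2_norm N (\<lambda>z. edmd \<psi> M n x y g z - galerkin N K \<psi> n g z) \<le> \<epsilon> * l2_norm N g"
    proof eventually_elim
      case (elim M)
      show ?case
      proof
        fix g assume g: "g \<in> dict_span \<psi> n"
        show "l2_norm N (\<lambda>z. edmd \<psi> M n x y g z - galerkin N K \<psi> n g z) \<le> \<epsilon> * l2_norm N g"
          using dict_operator_diff_norm[OF elim(2) C g] mult_right_mono[OF less_imp_le[OF elim(1)] l2_norm_nonneg[of N g]]
          by (simp add: edmd_def galerkin_eq_dict_operator B_def C_def)
      qed
    qed
  qed
qed

end

section \<open>The Galerkin operator\<close>

context symmetric_contraction_semigroup
begin

lemma T_combination:
  assumes t: "0 \<le> t" and f: "\<And>i. l2 N (f i)"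
  shows "AE x in N. T t (\<lambda>x. \<Sum>i<(n::nat). a i * f i x) x = (\<Sum>i<n. a i * T t (f i) x)"
proof (induction n)
  case 0
  show ?case using T_scale[OF t l2_zero, of 0] by simp
next
  case (Suc n)
  have l2: "l2 N (\<lambda>x. \<Sum>i<n. a i * f i x)" "l2 N (\<lambda>x. a n * f n x)"
    by (intro l2_sum l2_scale f)+
  from Suc T_add[OF t l2] T_scale[OF t f, of "a n" n] show ?case
    by eventually_elim simp
qed

text \<open>That is, \<open>P\<^sub>n T t\<close> for the orthogonal projection \<open>P\<^sub>n\<close> onto the span.\<close>

lemma galerkin_eq:
  assumes t: "0 \<le> t" and basis: "l2_orthonormal_basis N \<psi>" and g: "g \<in> dict_span \<psi> n"
  shows "galerkin N (T t) \<psi> n g = (\<lambda>x. \<Sum>j<n. l2_inner N (T t g) (\<psi> j) * \<psi> j x)"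
proof -
  note \<psi> = l2_orthonormal_basisD(1)[OF basis]
  obtain a where a: "a \<in> carrier_vec n" "g = dict_comb \<psi> a" using g by (rule dict_spanE)
  define A where "A = matrix_of n (gal_A N (T t) \<psi>)"
  have A: "A \<in> carrier_mat n n" by (simp add: A_def matrix_of_def)
  have coef: "vec_index (transpose_mat A *\<^sub>v a) j = l2_inner N (T t g) (\<psi> j)" if "j < n" for j
  proof -
    have "l2_inner N (T t g) (\<psi> j) = l2_inner N (\<lambda>x. \<Sum>i<n. vec_index a i * T t (\<psi> i) x) (\<psi> j)"
      using T_combination[OF t \<psi>, where n = n and a = "vec_index a"] dict_span_l2[OF basis g]
      unfolding a(2) dict_comb_eq[OF a(1)]
      by (intro l2_inner_cong_AE l2_measurable l2_sum l2_scale T_l2 t \<psi>) auto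
    also have "\<dots> = (\<Sum>i<n. A $$ (i, j) * vec_index a i)"
      using that by (subst l2_inner_sum_left)
        (auto simp: l2_inner_scale_left A_def matrix_of_def gal_A_def mult.commute intro!: l2_scale T_l2 t \<psi>)
    finally show ?thesis by (simp only: transpose_mult_vec_entry[OF A a(1) that])
  qed
  have "transpose_mat A *\<^sub>v a \<in> carrier_vec n" using A a by simp
  then show ?thesis
    unfolding galerkin_eq_dict_operator[OF basis] a(2) dict_operator_comb[OF basis a(1)] A_def[symmetric]
    by (subst dict_comb_eq) (auto simp: coef a(2)[symmetric] simp del: index_mult_mat_vec)
qed

text \<open>Orthogonal projections and \<open>T t\<close> are contractions, so the error of \<open>P\<^sub>n T t P\<^sub>n g\<close> is at most the
  sum of the projection errors of \<open>g\<close> and of \<open>T t g\<close>.\<close>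

lemma galerkin_strong_limit:
  assumes t: "0 \<le> t" and basis: "l2_orthonormal_basis N \<psi>" and g: "l2 N g"
  shows "l2_lim N (\<lambda>n. galerkin N (T t) \<psi> n (dict_proj N \<psi> n g)) (T t g) sequentially"
proof -
  note \<psi> = l2_orthonormal_basisD[OF basis]
  define P where "P n f x = (\<Sum>i<n. l2_inner N f (\<psi> i) * \<psi> i x)" for n f x
  have P_l2: "l2 N (P n f)" for n f
    unfolding P_def[abs_def] by (intro l2_sum l2_scale \<psi>)
  have P_norm: "l2_norm N (P n f) \<le> l2_norm N f" if "l2 N f" for n f
  proof (rule power2_le_imp_le)
    show "(l2_norm N (P n f))\<^sup>2 \<le> (l2_norm N f)\<^sup>2"
      using Bessel_inequality[of n N \<psi> f] orthonormal_norm_combination[of n N \<psi> "\<lambda>i. l2_inner N f (\<psi> i)"]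
        that \<psi>(1,2) by (simp add: P_def[abs_def])
  qed simp
  have P_lim: "(\<lambda>n. l2_norm N (\<lambda>x. P n f x - f x)) \<longlonglongrightarrow> 0" if "l2 N f" for f
    using \<psi>(3)[OF that] by (simp add: l2_lim_def P_def[abs_def])
  have eq: "galerkin N (T t) \<psi> n (dict_proj N \<psi> n g) = P n (T t (P n g))" for n
    unfolding dict_proj_eq[OF basis g] galerkin_eq[OF t basis combination_in_dict_span]
    by (simp add: P_def[abs_def])
  have Tg: "l2 N (T t g)" and TP: "l2 N (T t (P n g))" for n
    by (intro T_l2 t g P_l2)+
  have bound: "l2_norm N (\<lambda>x. P n (T t (P n g)) x - T t g x)
      \<le> l2_norm N (\<lambda>x. P n g x - g x) + l2_norm N (\<lambda>x. P n (T t g) x - T t g x)" for n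
  proof -
    have d: "l2 N (\<lambda>x. T t (P n g) x - T t g x)" by (intro l2_diff TP Tg)
    have "P n (\<lambda>x. T t (P n g) x - T t g x) = (\<lambda>x. P n (T t (P n g)) x - P n (T t g) x)"
      by (rule ext) (simp add: P_def[of _ "\<lambda>x. _ x - _ x"] P_def[of n "T t (P n g)"] P_def[of n "T t g"]
        l2_inner_diff_left[OF TP Tg \<psi>(1)] left_diff_distrib sum_subtractf)
    then have "l2_norm N (\<lambda>x. P n (T t (P n g)) x - P n (T t g) x) \<le> l2_norm N (\<lambda>x. T t (P n g) x - T t g x)"
      using P_norm[OF d, of n] by simp
    also have "\<dots> = l2_norm N (T t (\<lambda>x. P n g x - g x))"
      using T_diff[OF t P_l2 g, of n g]
      by (intro l2_norm_cong_AE l2_measurable d T_l2 t l2_diff P_l2 g) auto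
    also have "\<dots> \<le> l2_norm N (\<lambda>x. P n g x - g x)"
      by (intro T_contraction t l2_diff P_l2 g)
    finally show ?thesis using l2_norm_diff_triangle[OF P_l2 P_l2 Tg, of n "T t (P n g)" n "T t g"] by simp
  qed
  have lim: "(\<lambda>n. l2_norm N (\<lambda>x. P n (T t (P n g)) x - T t g x)) \<longlonglongrightarrow> 0"
  proof (rule Lim_null_comparison)
    show "(\<lambda>n. l2_norm N (\<lambda>x. P n g x - g x) + l2_norm N (\<lambda>x. P n (T t g) x - T t g x)) \<longlonglongrightarrow> 0"
      using tendsto_add[OF P_lim[OF g] P_lim[OF Tg]] by simp
  qed (use bound in simp)
  then show ?thesis
    unfolding eq l2_lim_def using Tg P_l2 by simp
qed

end

context spectral_semigroup
begin

text \<open>The Galerkin operator is the compression of \<open>T t\<close> to the span. It is therefore symmetric, and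
  its Rayleigh quotients are those of \<open>T t\<close>.\<close>

lemma galerkin_eigenpairs:
  assumes t: "0 \<le> t" and basis: "l2_orthonormal_basis N \<psi>"
    and ep: "dict_eigenpairs N \<psi> n (galerkin N (T t) \<psi> n) \<mu> f"
  shows "i < n \<Longrightarrow> l2 N (f i)"
    and "i < n \<Longrightarrow> j < n \<Longrightarrow> l2_inner N (f i) (f j) = (if i = j then 1 else 0)"
    and "i < n \<Longrightarrow> 0 < \<mu> i" and "i < n \<Longrightarrow> \<mu> i \<le> 1"
proof -
  note \<psi> = l2_orthonormal_basisD[OF basis]
  have f: "f i \<in> dict_span \<psi> n" "l2_norm N (f i) = 1"
    "galerkin N (T t) \<psi> n (f i) = (\<lambda>x. \<mu> i * f i x)" if "i < n" for i
    using ep that by (auto simp: dict_eigenpairs_def)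
  have f_l2: "l2 N (f i)" if "i < n" for i using dict_span_l2[OF basis f(1)[OF that]] .
  have one: "l2_inner N (f i) (f i) = 1" if "i < n" for i
    using f(2)[OF that] l2_norm_sq[of N "f i"] by simp
  have eig: "\<mu> i * l2_inner N (f i) (f j) = l2_inner N (T t (f i)) (f j)" if ij: "i < n" "j < n" for i j
  proof -
    have "l2_inner N (\<lambda>x. \<mu> i * f i x) (f j) = l2_inner N (T t (f i)) (f j)"
    proof (rule inner_dict_span_cong[OF basis _ _ _ f(1)[OF ij(2)]])
      show "l2_inner N (\<lambda>x. \<mu> i * f i x) (\<psi> k) = l2_inner N (T t (f i)) (\<psi> k)" if "k < n" for k
        unfolding f(3)[OF ij(1), symmetric] galerkin_eq[OF t basis f(1)[OF ij(1)]]
        using that \<psi> by (intro orthonormal_inner_combination) auto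
    qed (intro l2_scale T_l2 t f_l2 ij)+
    then show ?thesis by (simp add: l2_inner_scale_left)
  qed
  show "l2 N (f i)" if "i < n" by (rule f_l2[OF that])
  show "l2_inner N (f i) (f j) = (if i = j then 1 else 0)" if ij: "i < n" "j < n"
  proof (cases "i = j")
    case False
    have "\<mu> i * l2_inner N (f i) (f j) = \<mu> j * l2_inner N (f i) (f j)"
      using eig[OF ij] eig[OF ij(2,1)] T_symmetric[OF t f_l2[OF ij(1)] f_l2[OF ij(2)]]
      by (simp add: l2_inner_commute[of N "f j"] l2_inner_commute[of N _ "f i"])
    moreover have "\<mu> i = \<mu> j \<Longrightarrow> l2_inner N (f i) (f j) = 0"
      using ep ij False by (auto simp: dict_eigenpairs_def)
    ultimately show ?thesis using False by auto
  qed (use one ij in simp)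
  show "0 < \<mu> i" if i: "i < n"
    using eig[OF i i] one[OF i] T_quadratic_form_pos[OF t f_l2[OF i]] f(2)[OF i] by simp
  show "\<mu> i \<le> 1" if i: "i < n"
  proof -
    have "\<mu> i \<le> l2_norm N (T t (f i)) * l2_norm N (f i)"
      using eig[OF i i] one[OF i] l2_Cauchy_Schwarz[OF T_l2[OF t f_l2[OF i]] f_l2[OF i]] by simp
    also have "\<dots> \<le> 1" using T_contraction[OF t f_l2[OF i]] f(2)[OF i] by simp
    finally show ?thesis .
  qed
qed

end

section \<open>Weighted spaces\<close>

lemma weighted_borel: "borel_measurable (weighted S w) = borel_measurable (restrict_space lborel S)"
  by (simp add: weighted_def cong: measurable_cong_sets)

context
  fixes S :: "(real^'d::finite) set" and w :: "real^'d \<Rightarrow> real"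
  assumes w_meas [measurable]: "w \<in> borel_measurable (restrict_space lborel S)"
    and w_pos: "\<And>x. x \<in> S \<Longrightarrow> 0 < w x"
begin

lemma AE_w_pos: "AE x in restrict_space lborel S. 0 < w x"
  using AE_space[of "restrict_space lborel S"] by eventually_elim (simp add: space_restrict_space w_pos)

lemma AE_weighted: "(AE x in weighted S w. p x) \<longleftrightarrow> (AE x in restrict_space lborel S. p x)"
proof -
  have "(AE x in weighted S w. p x) \<longleftrightarrow> (AE x in restrict_space lborel S. 0 < ennreal (w x) \<longrightarrow> p x)"
    unfolding weighted_def by (rule AE_density) simp
  also have "\<dots> \<longleftrightarrow> (AE x in restrict_space lborel S. p x)"
    using AE_w_pos by (auto elim: AE_mp simp: ennreal_less_zero_iff)
  finally show ?thesis .
qed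

lemma integrable_weighted_iff:
  fixes f :: "real^'d \<Rightarrow> real"
  assumes "f \<in> borel_measurable (restrict_space lborel S)"
  shows "integrable (weighted S w) f \<longleftrightarrow> integrable (restrict_space lborel S) (\<lambda>x. w x * f x)"
  unfolding weighted_def using AE_w_pos assms by (subst integrable_density) auto

lemma integral_weighted:
  fixes f :: "real^'d \<Rightarrow> real"
  assumes "f \<in> borel_measurable (restrict_space lborel S)"
  shows "(\<integral>x. f x \<partial>weighted S w) = (\<integral>x. w x * f x \<partial>restrict_space lborel S)"
  unfolding weighted_def using AE_w_pos assms by (subst integral_density) auto

end

text \<open>Multiplication by \<open>w\<close> is an isometry of \<open>L\<^sup>2(S; w)\<close> onto \<open>L\<^sup>2(S; 1/w)\<close>; every statement about
  densities reduces through it to one about the invariant measure.\<close>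

context
  fixes S :: "(real^'d::finite) set" and w :: "real^'d \<Rightarrow> real"
  assumes w_meas [measurable]: "w \<in> borel_measurable (restrict_space lborel S)"
    and w_pos: "\<And>x. x \<in> S \<Longrightarrow> 0 < w x"
begin

lemma inverse_weight: "(\<lambda>x. 1 / w x) \<in> borel_measurable (restrict_space lborel S)"
  "x \<in> S \<Longrightarrow> 0 < 1 / w x"
  by (auto simp: w_pos)

lemma l2_inner_inverse_weight:
  assumes f: "f \<in> borel_measurable (restrict_space lborel S)" and h: "h \<in> borel_measurable (restrict_space lborel S)"
  shows "l2_inner (weighted S (\<lambda>x. 1 / w x)) (\<lambda>x. f x * w x) h = l2_inner (weighted S w) f (\<lambda>x. h x / w x)"
proof -
  note f [measurable] h [measurable]
  have "l2_inner (weighted S (\<lambda>x. 1 / w x)) (\<lambda>x. f x * w x) h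
    = (\<integral>x. 1 / w x * (f x * w x * h x) \<partial>restrict_space lborel S)"
    unfolding l2_inner_def by (rule integral_weighted[OF inverse_weight]) auto
  also have "\<dots> = (\<integral>x. w x * (f x * (h x / w x)) \<partial>restrict_space lborel S)"
    by (rule Bochner_Integration.integral_cong) auto
  also have "\<dots> = l2_inner (weighted S w) f (\<lambda>x. h x / w x)"
    unfolding l2_inner_def by (rule integral_weighted[OF w_meas w_pos, symmetric]) auto
  finally show ?thesis .
qed

lemma l2_times_weight:
  assumes "l2 (weighted S w) f"
  shows "l2 (weighted S (\<lambda>x. 1 / w x)) (\<lambda>x. f x * w x)"
proof -
  have [measurable]: "f \<in> borel_measurable (restrict_space lborel S)"
    using assms by (simp add: l2_def weighted_borel)
  have "integrable (restrict_space lborel S) (\<lambda>x. w x * (f x)\<^sup>2)"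
    using assms integrable_weighted_iff[OF w_meas w_pos, of "\<lambda>x. (f x)\<^sup>2"] by (simp add: l2_def)
  then have "integrable (restrict_space lborel S) (\<lambda>x. 1 / w x * (f x * w x)\<^sup>2)"
    by (rule Bochner_Integration.integrable_cong[THEN iffD1, rotated -1])
      (auto simp: space_restrict_space power2_eq_square dest: w_pos)
  then show ?thesis
    using integrable_weighted_iff[OF inverse_weight, of "\<lambda>x. (f x * w x)\<^sup>2"] by (simp add: l2_def weighted_borel)
qed

lemma l2_divide_weight:
  assumes "l2 (weighted S (\<lambda>x. 1 / w x)) h"
  shows "l2 (weighted S w) (\<lambda>x. h x / w x)"
proof -
  have [measurable]: "h \<in> borel_measurable (restrict_space lborel S)"
    using assms by (simp add: l2_def weighted_borel)
  have "integrable (restrict_space lborel S) (\<lambda>x. 1 / w x * (h x)\<^sup>2)"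
    using assms integrable_weighted_iff[OF inverse_weight, of "\<lambda>x. (h x)\<^sup>2"] by (simp add: l2_def)
  then have "integrable (restrict_space lborel S) (\<lambda>x. w x * (h x / w x)\<^sup>2)"
    by (rule Bochner_Integration.integrable_cong[THEN iffD1, rotated -1])
      (auto simp: space_restrict_space power2_eq_square dest: w_pos)
  then show ?thesis
    using integrable_weighted_iff[OF w_meas w_pos, of "\<lambda>x. (h x / w x)\<^sup>2"] by (simp add: l2_def weighted_borel)
qed

lemma l2_norm_times_weight:
  assumes "f \<in> borel_measurable (restrict_space lborel S)"
  shows "l2_norm (weighted S (\<lambda>x. 1 / w x)) (\<lambda>x. f x * w x) = l2_norm (weighted S w) f"
proof -
  note assms [measurable]
  have "l2_inner (weighted S w) f (\<lambda>x. f x * w x / w x) = l2_inner (weighted S w) f f"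
    unfolding l2_inner_def
    by (rule Bochner_Integration.integral_cong)
      (auto simp: weighted_def space_restrict_space dest: w_pos)
  then show ?thesis by (simp add: l2_norm_def l2_inner_inverse_weight)
qed

lemma l2_lim_times_weight:
  assumes u: "l2_lim (weighted S w) u f \<F>"
  shows "l2_lim (weighted S (\<lambda>x. 1 / w x)) (\<lambda>n x. u n x * w x) (\<lambda>x. f x * w x) \<F>"
  unfolding l2_lim_def
proof (intro conjI)
  show "l2 (weighted S (\<lambda>x. 1 / w x)) (\<lambda>x. f x * w x)"
    by (rule l2_times_weight[OF l2_limD(1)[OF u]])
  show "\<forall>\<^sub>F n in \<F>. l2 (weighted S (\<lambda>x. 1 / w x)) (\<lambda>x. u n x * w x)"
    using l2_limD(2)[OF u] by eventually_elim (rule l2_times_weight)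
  have "\<forall>\<^sub>F n in \<F>. l2_norm (weighted S w) (\<lambda>x. u n x - f x)
    = l2_norm (weighted S (\<lambda>x. 1 / w x)) (\<lambda>x. u n x * w x - f x * w x)"
    using l2_limD(2)[OF u]
  proof eventually_elim
    case (elim n)
    from l2_diff[OF elim l2_limD(1)[OF u]]
    have "(\<lambda>x. u n x - f x) \<in> borel_measurable (restrict_space lborel S)" by (simp add: l2_def weighted_borel)
    from l2_norm_times_weight[OF this] show ?case by (simp add: left_diff_distrib)
  qed
  from Lim_transform_eventually[OF l2_limD(3)[OF u] this]
  show "((\<lambda>n. l2_norm (weighted S (\<lambda>x. 1 / w x)) (\<lambda>x. u n x * w x - f x * w x)) \<longlongrightarrow> 0) \<F>" .
qed

lemma spectral_density_l2:
  assumes "\<And>i. i < n \<Longrightarrow> l2 (weighted S w) (f i)"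
  shows "l2 (weighted S (\<lambda>x. 1 / w x)) (spectral_density n a l f w t)"
proof -
  have "l2 (weighted S w) (\<lambda>x. \<Sum>i<n. a i * exp (l i * t) * f i x)"
    using assms by (intro l2_sum l2_scale) auto
  from l2_times_weight[OF this] show ?thesis
    by (simp add: spectral_density_def[abs_def] sum_distrib_right)
qed

lemma spectral_density_inner:
  assumes f: "\<And>i. i < n \<Longrightarrow> l2 (weighted S w) (f i)" and h: "l2 (weighted S (\<lambda>x. 1 / w x)) h"
  shows "l2_inner (weighted S (\<lambda>x. 1 / w x)) (spectral_density n a l f w t) h
    = (\<Sum>i<n. a i * (exp (l i * t) * l2_inner (weighted S w) (f i) (\<lambda>x. h x / w x)))"
proof -
  have l2: "l2 (weighted S w) (\<lambda>x. \<Sum>i<n. a i * exp (l i * t) * f i x)"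
    using f by (intro l2_sum l2_scale) auto
  have "l2_inner (weighted S (\<lambda>x. 1 / w x)) (spectral_density n a l f w t) h
    = l2_inner (weighted S w) (\<lambda>x. \<Sum>i<n. a i * exp (l i * t) * f i x) (\<lambda>x. h x / w x)"
    using l2_inner_inverse_weight[of "\<lambda>x. \<Sum>i<n. a i * exp (l i * t) * f i x" h] l2 h
    by (simp add: spectral_density_def[abs_def] sum_distrib_right l2_def weighted_borel)
  also have "\<dots> = (\<Sum>i<n. a i * exp (l i * t) * l2_inner (weighted S w) (f i) (\<lambda>x. h x / w x))"
    using f l2_divide_weight[OF h]
    by (subst l2_inner_sum_left) (auto intro: l2_scale simp: l2_inner_scale_left)
  finally show ?thesis by (simp add: mult.assoc)
qed

end

section \<open>Weak convergence of the spectral approximation\<close>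

text \<open>A dominated convergence theorem for series with a square-summable factor: by the Cauchy-Schwarz
  inequality the tail beyond \<open>m\<close> is at most \<open>B\<close> times the \<open>\<ell>\<^sup>2\<close>-norm of the tail of \<open>c\<close>, uniformly
  in \<open>k\<close>.\<close>

lemma tendsto_sum_if_l2_bounded:
  fixes c :: "nat \<Rightarrow> real" and a :: "nat \<Rightarrow> nat \<Rightarrow> real"
  assumes c: "summable (\<lambda>i. (c i)\<^sup>2)"
    and bound: "\<And>k. (\<Sum>i<r k. (a k i)\<^sup>2) \<le> B\<^sup>2"
    and lim: "\<And>i. (\<lambda>k. a k i) \<longlonglongrightarrow> a' i"
    and s: "(\<lambda>i. c i * a' i) sums s"
    and r: "filterlim r at_top sequentially"
  shows "(\<lambda>k. \<Sum>i<r k. c i * a k i) \<longlonglongrightarrow> s"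
proof (rule LIMSEQ_I)
  fix e :: real assume e: "0 < e"
  define \<delta> where "\<delta> = e / (3 * (\<bar>B\<bar> + 1))"
  have \<delta>: "0 < \<delta>" using e by (simp add: \<delta>_def)
  obtain m1 where m1: "\<And>m n. m1 \<le> m \<Longrightarrow> norm (\<Sum>i\<in>{m..<n}. (c i)\<^sup>2) < \<delta>\<^sup>2"
    using c \<delta> unfolding summable_Cauchy by (metis zero_less_power)
  obtain m2 where m2: "\<And>m. m2 \<le> m \<Longrightarrow> norm ((\<Sum>i<m. c i * a' i) - s) < e / 3"
    using LIMSEQ_D[OF s[unfolded sums_def], of "e / 3"] e by auto
  define m where "m = max m1 m2"
  have "(\<lambda>k. \<Sum>i<m. c i * a k i) \<longlonglongrightarrow> (\<Sum>i<m. c i * a' i)"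
    by (intro tendsto_intros lim)
  then have "\<forall>\<^sub>F k in sequentially. norm ((\<Sum>i<m. c i * a k i) - (\<Sum>i<m. c i * a' i)) < e / 3"
    using e tendstoD[of "\<lambda>k. \<Sum>i<m. c i * a k i" _ sequentially "e / 3"] by (simp add: dist_norm)
  moreover have "\<forall>\<^sub>F k in sequentially. m \<le> r k"
    using r by (simp add: filterlim_at_top)
  ultimately have "\<forall>\<^sub>F k in sequentially. norm ((\<Sum>i<r k. c i * a k i) - s) < e"
  proof eventually_elim
    case (elim k)
    have "(\<Sum>i<r k. c i * a k i) = (\<Sum>i<m. c i * a k i) + (\<Sum>i\<in>{m..<r k}. c i * a k i)"
      using elim(2) by (subst sum.union_disjoint[symmetric]) (auto intro!: sum.cong)
    moreover have "\<bar>\<Sum>i\<in>{m..<r k}. c i * a k i\<bar> \<le> \<delta> * \<bar>B\<bar>"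
    proof (rule power2_le_iff_abs_le[THEN iffD1])
      have "(\<Sum>i\<in>{m..<r k}. c i * a k i)\<^sup>2
        \<le> (\<Sum>i\<in>{m..<r k}. (c i)\<^sup>2) * (\<Sum>i\<in>{m..<r k}. (a k i)\<^sup>2)"
        by (rule Cauchy_Schwarz_ineq_sum)
      also have "\<dots> \<le> \<delta>\<^sup>2 * B\<^sup>2"
      proof (rule mult_mono)
        show "(\<Sum>i\<in>{m..<r k}. (c i)\<^sup>2) \<le> \<delta>\<^sup>2" using m1[of m "r k"] by (simp add: m_def)
        have "(\<Sum>i\<in>{m..<r k}. (a k i)\<^sup>2) \<le> (\<Sum>i<r k. (a k i)\<^sup>2)" by (rule sum_mono2) auto
        with bound[of k] show "(\<Sum>i\<in>{m..<r k}. (a k i)\<^sup>2) \<le> B\<^sup>2" by simp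
      qed (auto intro: sum_nonneg)
      finally show "(\<Sum>i\<in>{m..<r k}. c i * a k i)\<^sup>2 \<le> (\<delta> * \<bar>B\<bar>)\<^sup>2" by (simp add: power_mult_distrib)
    qed (use \<delta> in simp)
    moreover have "\<delta> * \<bar>B\<bar> < e / 3"
    proof -
      have "\<delta> * \<bar>B\<bar> < \<delta> * (\<bar>B\<bar> + 1)" using \<delta> by simp
      also have "\<dots> = e / 3" by (simp add: \<delta>_def field_simps)
      finally show ?thesis .
    qed
    moreover have "norm ((\<Sum>i<m. c i * a' i) - s) < e / 3" by (rule m2) (simp add: m_def)
    ultimately show ?case using elim(1) unfolding real_norm_def by linarith
  qed
  then show "\<exists>no. \<forall>n\<ge>no. norm ((\<Sum>i<r n. c i * a n i) - s) < e"
    by (simp add: eventually_at_top_linorder)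
qed

lemma weak_l2_limD:
  assumes "weak_l2_lim N u f"
  shows "l2 N f" "l2 N h \<Longrightarrow> (\<lambda>n. l2_inner N (u n) h) \<longlonglongrightarrow> l2_inner N f h"
  using assms by (auto simp: weak_l2_lim_def)

context spectral_semigroup
begin

lemma eigenbasis_expansion:
  assumes t: "0 \<le> t" and f: "l2 N f"
  shows "l2_lim N (\<lambda>n x. \<Sum>i<n. l2_inner N f (\<phi> i) * exp (lam i * t) * \<phi> i x) (T t f) sequentially"
  using l2_orthonormal_basisD(3)[OF basis T_l2[OF t f]]
  by (simp add: T_coefficient[OF t f] mult.commute)

context
  fixes \<tau> :: real and \<psi> :: "nat \<Rightarrow> 'a \<Rightarrow> real" and r :: "nat \<Rightarrow> nat"
    and \<mu>N :: "nat \<Rightarrow> nat \<Rightarrow> real" and \<phi>N :: "nat \<Rightarrow> nat \<Rightarrow> 'a \<Rightarrow> real"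
  assumes \<tau>: "0 < \<tau>" and dictionary: "l2_orthonormal_basis N \<psi>"
    and r: "strict_mono r"
    and eigenpairs: "\<And>k. dict_eigenpairs N \<psi> (r k) (galerkin N (T \<tau>) \<psi> (r k)) (\<mu>N k) (\<phi>N k)"
    and eigenvalues: "\<And>i. (\<lambda>k. \<mu>N k i) \<longlonglongrightarrow> exp (lam i * \<tau>)"
    and eigenfunctions: "\<And>i. weak_l2_lim N (\<lambda>k. \<phi>N k i) (\<phi> i)"
begin

text \<open>Since the Galerkin eigenvalues lie in \<open>(0,1]\<close>, their logarithms are genuine and not positive.\<close>

lemma approx_factor_bounds:
  assumes "0 \<le> t" "i < r k"
  shows "0 < exp (ln (\<mu>N k i) / \<tau> * t)" "exp (ln (\<mu>N k i) / \<tau> * t) \<le> 1"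
proof -
  have "0 < \<mu>N k i" "\<mu>N k i \<le> 1"
    using galerkin_eigenpairs(3,4)[OF less_imp_le[OF \<tau>] dictionary eigenpairs assms(2)] by auto
  then have "ln (\<mu>N k i) / \<tau> * t \<le> 0"
    using \<tau> assms(1) by (intro mult_nonpos_nonneg divide_nonpos_pos) auto
  then show "exp (ln (\<mu>N k i) / \<tau> * t) \<le> 1" by simp
qed simp

lemma approx_coefficients_bound:
  assumes t: "0 \<le> t" and g: "l2 N g"
  shows "(\<Sum>i<r k. (exp (ln (\<mu>N k i) / \<tau> * t) * l2_inner N (\<phi>N k i) g)\<^sup>2) \<le> (l2_norm N g)\<^sup>2"
proof -
  note on = galerkin_eigenpairs[OF less_imp_le[OF \<tau>] dictionary eigenpairs]
  have "(\<Sum>i<r k. (exp (ln (\<mu>N k i) / \<tau> * t) * l2_inner N (\<phi>N k i) g)\<^sup>2)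
    \<le> (\<Sum>i<r k. (l2_inner N g (\<phi>N k i))\<^sup>2)"
  proof (rule sum_mono)
    fix i assume "i \<in> {..<r k}"
    then have "(exp (ln (\<mu>N k i) / \<tau> * t))\<^sup>2 \<le> 1\<^sup>2"
      using approx_factor_bounds[OF t, of i k] by (intro power_mono) auto
    then have "(exp (ln (\<mu>N k i) / \<tau> * t))\<^sup>2 * (l2_inner N g (\<phi>N k i))\<^sup>2 \<le> 1 * (l2_inner N g (\<phi>N k i))\<^sup>2"
      by (intro mult_right_mono) auto
    then show "(exp (ln (\<mu>N k i) / \<tau> * t) * l2_inner N (\<phi>N k i) g)\<^sup>2 \<le> (l2_inner N g (\<phi>N k i))\<^sup>2"
      by (simp add: power_mult_distrib l2_inner_commute)
  qed
  also have "\<dots> \<le> (l2_norm N g)\<^sup>2" by (intro Bessel_inequality on g)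
  finally show ?thesis .
qed

lemma approx_spectral_limit:
  assumes t: "0 \<le> t" and f: "l2 N f" and g: "l2 N g"
  shows "(\<lambda>k. \<Sum>i<r k. l2_inner N f (\<phi> i) * (exp (ln (\<mu>N k i) / \<tau> * t) * l2_inner N (\<phi>N k i) g))
    \<longlonglongrightarrow> l2_inner N (T t f) g"
proof (rule tendsto_sum_if_l2_bounded)
  note \<phi> = l2_orthonormal_basisD(1)[OF basis]
  show "summable (\<lambda>i. (l2_inner N f (\<phi> i))\<^sup>2)" by (rule sums_summable[OF Parseval[OF basis f]])
  show "(\<Sum>i<r k. (exp (ln (\<mu>N k i) / \<tau> * t) * l2_inner N (\<phi>N k i) g)\<^sup>2) \<le> (l2_norm N g)\<^sup>2" for k
    by (rule approx_coefficients_bound[OF t g])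
  show "(\<lambda>k. exp (ln (\<mu>N k i) / \<tau> * t) * l2_inner N (\<phi>N k i) g)
    \<longlonglongrightarrow> exp (lam i * t) * l2_inner N (\<phi> i) g" for i
  proof (intro tendsto_mult tendsto_exp weak_l2_limD(2)[OF eigenfunctions g] tendsto_const)
    have "(\<lambda>k. ln (\<mu>N k i)) \<longlonglongrightarrow> ln (exp (lam i * \<tau>))" by (intro tendsto_ln eigenvalues) simp
    then show "(\<lambda>k. ln (\<mu>N k i) / \<tau>) \<longlonglongrightarrow> lam i"
      using tendsto_divide[OF _ tendsto_const[of \<tau>]] \<tau> by fastforce
  qed
  show "(\<lambda>i. l2_inner N f (\<phi> i) * (exp (lam i * t) * l2_inner N (\<phi> i) g)) sums l2_inner N (T t f) g"
  proof -
    have "l2_inner N (\<lambda>x. \<Sum>i<n. l2_inner N f (\<phi> i) * exp (lam i * t) * \<phi> i x) g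
      = (\<Sum>i<n. l2_inner N f (\<phi> i) * (exp (lam i * t) * l2_inner N (\<phi> i) g))" for n
    proof -
      have "l2_inner N (\<lambda>x. \<Sum>i<n. l2_inner N f (\<phi> i) * exp (lam i * t) * \<phi> i x) g
        = (\<Sum>i<n. l2_inner N (\<lambda>x. l2_inner N f (\<phi> i) * exp (lam i * t) * \<phi> i x) g)"
        by (intro l2_inner_sum_left l2_scale \<phi> g)
      then show ?thesis by (simp add: l2_inner_scale_left mult.assoc)
    qed
    with l2_lim_inner[OF eigenbasis_expansion[OF t f] g] show ?thesis by (simp add: sums_def)
  qed
  show "filterlim r at_top sequentially" by (rule filterlim_subseq[OF r])
qed

text \<open>Errors in the coefficients are harmless once their sum tends to zero, because each of the factors
  \<open>exp (ln (\<mu>N k i) / \<tau> * t) * l2_inner N (\<phi>N k i) g\<close> is at most \<open>\<parallel>g\<parallel>\<close> in absolute value.\<close>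

lemma approx_spectral_limit_perturbed:
  assumes t: "0 \<le> t" and f: "l2 N f" and g: "l2 N g"
    and close: "\<And>k. (\<Sum>i<r k. \<bar>d k i - l2_inner N f (\<phi> i)\<bar>) \<le> 1 / real (Suc k)"
  shows "(\<lambda>k. \<Sum>i<r k. d k i * (exp (ln (\<mu>N k i) / \<tau> * t) * l2_inner N (\<phi>N k i) g))
    \<longlonglongrightarrow> l2_inner N (T t f) g"
proof -
  define a where "a k i = exp (ln (\<mu>N k i) / \<tau> * t) * l2_inner N (\<phi>N k i) g" for k i
  have a_le: "\<bar>a k i\<bar> \<le> l2_norm N g" if "i < r k" for k i
  proof (rule power2_le_iff_abs_le[THEN iffD1])
    have "(a k i)\<^sup>2 \<le> (\<Sum>i<r k. (a k i)\<^sup>2)" using that by (intro member_le_sum) auto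
    also have "\<dots> \<le> (l2_norm N g)\<^sup>2" unfolding a_def by (rule approx_coefficients_bound[OF t g])
    finally show "(a k i)\<^sup>2 \<le> (l2_norm N g)\<^sup>2" .
  qed simp
  have "(\<lambda>k. (\<Sum>i<r k. (d k i - l2_inner N f (\<phi> i)) * a k i)) \<longlonglongrightarrow> 0"
  proof (rule Lim_null_comparison)
    have "norm (\<Sum>i<r k. (d k i - l2_inner N f (\<phi> i)) * a k i) \<le> 1 / real (Suc k) * l2_norm N g" for k
    proof -
      have "norm (\<Sum>i<r k. (d k i - l2_inner N f (\<phi> i)) * a k i)
        \<le> (\<Sum>i<r k. \<bar>d k i - l2_inner N f (\<phi> i)\<bar> * l2_norm N g)"
        by (rule sum_norm_le) (auto simp: abs_mult intro!: mult_left_mono a_le)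
      also have "\<dots> \<le> 1 / real (Suc k) * l2_norm N g"
        unfolding sum_distrib_right[symmetric] by (intro mult_right_mono close) simp
      finally show ?thesis .
    qed
    then show "\<forall>\<^sub>F k in sequentially. norm (\<Sum>i<r k. (d k i - l2_inner N f (\<phi> i)) * a k i)
      \<le> 1 / real (Suc k) * l2_norm N g" by simp
    show "(\<lambda>k. 1 / real (Suc k) * l2_norm N g) \<longlonglongrightarrow> 0"
      using tendsto_mult_left_zero[OF LIMSEQ_Suc[OF lim_1_over_n], of "l2_norm N g"] by simp
  qed
  from tendsto_add[OF this approx_spectral_limit[OF t f g, folded a_def]] show ?thesis
    unfolding a_def[symmetric] by (simp add: left_diff_distrib sum_subtractf)
qed

end

end

section \<open>Convergence of the data-driven densities\<close>

theorem theorem4p3: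
  fixes S :: "(real^'d::finite) set"
    and b :: "real^'d \<Rightarrow> real^'d"
    and \<sigma> :: "real^'d \<Rightarrow> real^'w::finite^'d"
    and P :: "'a measure" and F :: "real \<Rightarrow> 'a measure"
    and W :: "real \<Rightarrow> 'a \<Rightarrow> real^'w"
    and \<Phi> :: "real \<Rightarrow> real^'d \<Rightarrow> 'a \<Rightarrow> real^'d"
    and p\<^sub>s p\<^sub>0 :: "real^'d \<Rightarrow> real"
    and \<Delta>t :: real
    and \<psi> \<phi> :: "nat \<Rightarrow> real^'d \<Rightarrow> real" and lam :: "nat \<Rightarrow> real"
    and Q :: "'q measure" and X :: "nat \<Rightarrow> 'q \<Rightarrow> real^'d" and \<Xi> :: "nat \<Rightarrow> 'q \<Rightarrow> 'a"
    and r :: "nat \<Rightarrow> nat" and \<mu>N :: "nat \<Rightarrow> nat \<Rightarrow> real" and \<phi>N :: "nat \<Rightarrow> nat \<Rightarrow> real^'d \<Rightarrow> real"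
  defines "\<nu> \<equiv> weighted S p\<^sub>s"
    and "\<nu>inv \<equiv> weighted S (\<lambda>x. 1 / p\<^sub>s x)"
    and "K \<equiv> koopman P \<Phi> \<Delta>t"
    and "Y \<equiv> \<lambda>m \<omega>. \<Phi> \<Delta>t (X m \<omega>) (\<Xi> m \<omega>)"
    and "c \<equiv> \<lambda>i. density_coeff S p\<^sub>s p\<^sub>0 (\<phi> i)"
    and "pN \<equiv> \<lambda>M k t \<omega>. spectral_density (r k) (\<lambda>i. mc_coeff M (\<lambda>m. X m \<omega>) p\<^sub>s p\<^sub>0 (\<phi> i))
                  (\<lambda>i. ln (\<mu>N k i) / \<Delta>t) (\<phi>N k) p\<^sub>s t"
  assumes diffusion: "reversible_diffusion S b \<sigma> P F W \<Phi> p\<^sub>s"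
    and \<Delta>t: "0 < \<Delta>t"
    and K_bounded: "l2_bounded_operator \<nu> K"
    and dictionary: "l2_orthonormal_basis \<nu> \<psi>"
    and lam_decreasing: "decseq lam"
    and lam_nonpos: "\<And>i. lam i \<le> 0"
    and lam_discrete: "discrete_spectrum lam"
    and eigenbasis: "l2_orthonormal_basis \<nu> \<phi>"
    and eigenfunctions: "\<And>i. l2_generator \<nu> (koopman P \<Phi>) (\<phi> i) (\<lambda>x. lam i * \<phi> i x)"
    and p0_l2: "l2 \<nu>inv p\<^sub>0"
    and p0_nonneg: "AE x in restrict_space lborel S. 0 \<le> p\<^sub>0 x"
    and p0_prob: "prob_space (weighted S p\<^sub>0)"
    and data: "snapshot_data Q \<nu> P X \<Xi>"
    and subsequence: "strict_mono r"
    and approx_eigenpairs: "\<And>k. dict_eigenpairs \<nu> \<psi> (r k) (galerkin \<nu> K \<psi> (r k)) (\<mu>N k) (\<phi>N k)"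
    and approx_eigenvalues: "\<And>i. (\<lambda>k. \<mu>N k i) \<longlonglongrightarrow> exp (lam i * \<Delta>t)"
    and approx_eigenfunctions: "\<And>i. weak_l2_lim \<nu> (\<lambda>k. \<phi>N k i) (\<phi> i)"
  shows "(\<forall>i j. AE \<omega> in Q.
           (\<lambda>M. emp_A \<psi> M (\<lambda>m. X m \<omega>) (\<lambda>m. Y m \<omega>) i j) \<longlonglongrightarrow> gal_A \<nu> K \<psi> i j) \<and>
         (\<forall>i j. AE \<omega> in Q. (\<lambda>M. emp_G \<psi> M (\<lambda>m. X m \<omega>) i j) \<longlonglongrightarrow> gal_G \<nu> \<psi> i j) \<and>
         (\<forall>N. AE \<omega> in Q.
           dict_operator_lim \<nu> \<psi> N (\<lambda>M. edmd \<psi> M N (\<lambda>m. X m \<omega>) (\<lambda>m. Y m \<omega>)) (galerkin \<nu> K \<psi> N)) \<and>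
         (\<forall>g. l2 \<nu> g \<longrightarrow> l2_lim \<nu> (\<lambda>N. galerkin \<nu> K \<psi> N (dict_proj \<nu> \<psi> N g)) (K g) sequentially) \<and>
         (\<exists>p. (\<forall>t\<ge>0. l2_lim \<nu>inv (\<lambda>n. spectral_density n c lam \<phi> p\<^sub>s t) (p t) sequentially) \<and>
           evolved_density S P \<Phi> p\<^sub>0 p \<and>
           solves_fokker_planck S b \<sigma> p\<^sub>s p\<^sub>0 p \<and>
           (AE \<omega> in Q.
              (\<exists>q. (\<forall>k. \<forall>t>0. weak_l2_lim \<nu>inv (\<lambda>M. pN M k t \<omega>) (q k t)) \<and>
                   (\<forall>t>0. weak_l2_lim \<nu>inv (\<lambda>k. q k t) (p t))) \<and>
              (\<exists>M\<^sub>0. \<forall>m. (\<forall>k. M\<^sub>0 k \<le> m k) \<longrightarrow>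
                   (\<forall>t>0. weak_l2_lim \<nu>inv (\<lambda>k. pN (m k) k t \<omega>) (p t)))))"
proof -
  interpret reversible_diffusion S b \<sigma> P F W \<Phi> p\<^sub>s by (rule diffusion)
  define M0 where "M0 = restrict_space (lborel :: (real^'d) measure) S"
  have space_M0: "space M0 = S" by (simp add: M0_def space_restrict_space)
  have ps [measurable]: "p\<^sub>s \<in> borel_measurable M0" using p\<^sub>s_measurable by (simp add: M0_def)
  note w = p\<^sub>s_measurable p\<^sub>s_pos
  have \<nu>_eq: "\<nu> = density M0 (\<lambda>x. ennreal (p\<^sub>s x))" by (simp add: \<nu>_def weighted_def M0_def)
  have borel_\<nu>: "borel_measurable \<nu> = borel_measurable M0" "borel_measurable \<nu>inv = borel_measurable M0"
    by (simp_all add: \<nu>_def \<nu>inv_def weighted_borel M0_def)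
  have AE_\<nu>: "(AE x in \<nu>. p x) \<longleftrightarrow> (AE x in M0. p x)" for p
    unfolding \<nu>_def M0_def by (rule AE_weighted[OF w])
  interpret R: reversible_flow \<nu> P \<Phi>
  proof (intro reversible_flow.intro reversible_flow_axioms.intro)
    show "prob_space \<nu>" using prob_p\<^sub>s by (simp add: \<nu>_def)
    show "prob_space P" using brownian by (simp add: brownian_motion_def)
    show "invariant_measure P \<Phi> \<nu>" "time_reversible P \<Phi> \<nu>"
      using invariant detailed_balance by (simp_all add: \<nu>_def)
    show "(\<lambda>(x, \<omega>). \<Phi> t x \<omega>) \<in> measurable (\<nu> \<Otimes>\<^sub>M P) \<nu>" if "0 \<le> t" for t
      using flow_measurable[OF that] by (simp add: \<nu>_def)
  qed
  interpret T: spectral_semigroup \<nu> "koopman P \<Phi>" \<phi> lam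
    using R.symmetric_contraction_semigroup_koopman koopman_semigroup eigenbasis eigenfunctions lam_nonpos
    by (intro spectral_semigroup.intro spectral_semigroup_axioms.intro) (simp_all add: \<nu>_def)
  have \<Delta>t0: "0 \<le> \<Delta>t" using \<Delta>t by simp
  note \<psi> = l2_orthonormal_basisD(1)[OF dictionary] and \<phi> = l2_orthonormal_basisD(1)[OF eigenbasis]

  have A: "AE \<omega> in Q. (\<lambda>M. emp_A \<psi> M (\<lambda>m. X m \<omega>) (\<lambda>m. Y m \<omega>) i j) \<longlonglongrightarrow> gal_A \<nu> K \<psi> i j" for i j
    using R.snapshot_average_tendsto[OF data R.koopman_inner(1)[OF \<Delta>t0 \<psi> \<psi>, of i j]]
    by (simp add: emp_A_def Y_def gal_A_def K_def R.koopman_inner(2)[OF \<Delta>t0 \<psi> \<psi>])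
  have G: "AE \<omega> in Q. (\<lambda>M. emp_G \<psi> M (\<lambda>m. X m \<omega>) i j) \<longlonglongrightarrow> gal_G \<nu> \<psi> i j" for i j
  proof -
    note int = l2_integrable_mult[OF \<psi> \<psi>, of i j]
    from R.snapshot_average_tendsto[OF data R.fst_integrable[OF int]] R.fst_integral[of "\<lambda>x. \<psi> i x * \<psi> j x"] int
    show ?thesis by (simp add: emp_G_def gal_G_def l2_inner_def borel_measurable_integrable)
  qed
  have edmd: "AE \<omega> in Q. dict_operator_lim \<nu> \<psi> N (\<lambda>M. edmd \<psi> M N (\<lambda>m. X m \<omega>) (\<lambda>m. Y m \<omega>)) (galerkin \<nu> K \<psi> N)" for N
  proof -
    have "AE \<omega> in Q. \<forall>i j. (\<lambda>M. emp_A \<psi> M (\<lambda>m. X m \<omega>) (\<lambda>m. Y m \<omega>) i j) \<longlonglongrightarrow> gal_A \<nu> K \<psi> i j"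
      "AE \<omega> in Q. \<forall>i j. (\<lambda>M. emp_G \<psi> M (\<lambda>m. X m \<omega>) i j) \<longlonglongrightarrow> gal_G \<nu> \<psi> i j"
      by (simp_all add: AE_all_countable A G)
    then show ?thesis
      by eventually_elim (rule dict_operator_lim_edmd[OF dictionary], auto)
  qed
  have strong: "l2_lim \<nu> (\<lambda>N. galerkin \<nu> K \<psi> N (dict_proj \<nu> \<psi> N g)) (K g) sequentially" if "l2 \<nu> g" for g
    unfolding K_def by (rule T.galerkin_strong_limit[OF \<Delta>t0 dictionary that])

  \<comment> \<open>the density of the initial law relative to the invariant measure\<close>
  define f0 where "f0 x = p\<^sub>0 x / p\<^sub>s x" for x
  have p0_meas [measurable]: "p\<^sub>0 \<in> borel_measurable M0" using l2_measurable[OF p0_l2] by (simp add: borel_\<nu>)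
  have f0: "l2 \<nu> f0"
    using l2_divide_weight[OF w p0_l2[unfolded \<nu>inv_def]] by (simp add: f0_def[abs_def] \<nu>_def)
  have [measurable]: "f0 \<in> borel_measurable M0" using l2_measurable[OF f0] by (simp add: borel_\<nu>)
  have f0_ps: "f0 x * p\<^sub>s x = p\<^sub>0 x" if "x \<in> S" for x
    using p\<^sub>s_pos[OF that] by (simp add: f0_def)
  have c: "c i = l2_inner \<nu> f0 (\<phi> i)" for i
  proof -
    have "c i = l2_inner \<nu>inv (\<lambda>x. \<phi> i x * p\<^sub>s x) p\<^sub>0"
      by (simp add: c_def density_coeff_def \<nu>inv_def l2_inner_commute)
    also have "\<dots> = l2_inner \<nu> (\<phi> i) f0"
      using l2_inner_inverse_weight[OF w, of "\<phi> i" p\<^sub>0] l2_measurable[OF \<phi>, of i] p0_meas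
      by (simp add: \<nu>_def \<nu>inv_def f0_def[abs_def] weighted_borel M0_def)
    finally show ?thesis by (simp add: l2_inner_commute)
  qed
  define p where "p t x = koopman P \<Phi> t f0 x * p\<^sub>s x" for t x
  have Tf: "l2 \<nu> (koopman P \<Phi> t f0)" if "0 \<le> t" for t by (rule T.T_l2[OF that f0])
  have p_l2: "l2 \<nu>inv (p t)" if "0 \<le> t" for t
    using l2_times_weight[OF w Tf[OF that, unfolded \<nu>_def]] by (simp add: p_def[abs_def] \<nu>inv_def)

  have expansion: "l2_lim \<nu>inv (\<lambda>n. spectral_density n c lam \<phi> p\<^sub>s t) (p t) sequentially" if t: "0 \<le> t" for t
    using l2_lim_times_weight[OF w T.eigenbasis_expansion[OF t f0, unfolded \<nu>_def]]
    by (simp add: spectral_density_def[abs_def] p_def[abs_def] c \<nu>_def \<nu>inv_def sum_distrib_right)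

  have weighted_times: "weighted S (\<lambda>x. f x * p\<^sub>s x) = density \<nu> (\<lambda>x. ennreal (f x))"
    if "f \<in> borel_measurable M0" for f
  proof -
    note that [measurable]
    have "density \<nu> (\<lambda>x. ennreal (f x)) = density M0 (\<lambda>x. ennreal (p\<^sub>s x) * ennreal (f x))"
      unfolding \<nu>_eq by (rule density_density_eq) auto
    also have "\<dots> = density M0 (\<lambda>x. ennreal (f x * p\<^sub>s x))"
    proof (rule density_cong)
      show "AE x in M0. ennreal (p\<^sub>s x) * ennreal (f x) = ennreal (f x * p\<^sub>s x)"
        using p\<^sub>s_pos by (intro AE_I2) (simp add: space_M0 mult.commute ennreal_mult'' less_imp_le)
    qed auto
    finally show ?thesis by (simp add: weighted_def M0_def)
  qed
  have evolved: "evolved_density S P \<Phi> p\<^sub>0 p"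
    unfolding evolved_density_def
  proof (intro allI impI conjI)
    fix t :: real assume t: "0 \<le> t"
    have nonneg: "AE x in \<nu>. 0 \<le> f0 x"
      using p0_nonneg AE_space[of M0] unfolding AE_\<nu> M0_def[symmetric]
      by eventually_elim (simp add: f0_def space_M0 p\<^sub>s_pos less_imp_le)
    have "AE x in M0. 0 \<le> p t x"
      using R.distr_density_flow(2)[OF t f0 nonneg] AE_space[of M0] unfolding AE_\<nu>
      by eventually_elim (simp add: p_def space_M0 p\<^sub>s_pos less_imp_le)
    then show "AE x in restrict_space lborel S. 0 \<le> p t x" unfolding M0_def .
    have "weighted S p\<^sub>0 = weighted S (\<lambda>x. f0 x * p\<^sub>s x)"
      unfolding weighted_def M0_def[symmetric]
      by (rule density_cong) (auto simp: space_M0 f0_ps intro!: AE_I2)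
    also have "\<dots> = density \<nu> (\<lambda>x. ennreal (f0 x))"
      by (rule weighted_times) (use l2_measurable[OF f0] in \<open>simp add: borel_\<nu>\<close>)
    finally have "distr (weighted S p\<^sub>0 \<Otimes>\<^sub>M P) M0 (\<lambda>(x, \<omega>). \<Phi> t x \<omega>)
      = distr (density \<nu> (\<lambda>x. ennreal (f0 x)) \<Otimes>\<^sub>M P) \<nu> (\<lambda>(x, \<omega>). \<Phi> t x \<omega>)"
      by (intro distr_cong) (simp_all add: \<nu>_eq)
    also have "\<dots> = density \<nu> (\<lambda>x. ennreal (koopman P \<Phi> t f0 x))"
      by (rule R.distr_density_flow(1)[OF t f0 nonneg])
    also have "\<dots> = weighted S (p t)"
      unfolding p_def[abs_def]
      by (rule weighted_times[symmetric]) (use l2_measurable[OF Tf[OF t]] in \<open>simp add: borel_\<nu>\<close>)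
    finally show "distr (weighted S p\<^sub>0 \<Otimes>\<^sub>M P) (restrict_space lborel S) (\<lambda>(x, \<omega>). \<Phi> t x \<omega>) = weighted S (p t)"
      unfolding M0_def .
  qed

  have fokker_planck: "solves_fokker_planck S b \<sigma> p\<^sub>s p\<^sub>0 p"
    unfolding solves_fokker_planck_def \<nu>inv_def[symmetric]
  proof (intro conjI allI impI p_l2)
    have "AE x in M0. p 0 x = p\<^sub>0 x"
      using T.T_0[OF f0] AE_space[of M0] unfolding AE_\<nu>
      by eventually_elim (simp add: p_def space_M0 f0_ps)
    then show "AE x in restrict_space lborel S. p 0 x = p\<^sub>0 x" unfolding M0_def .
    have lim: "l2_lim \<nu>inv p (\<lambda>x. f0 x * p\<^sub>s x) (at_right 0)"
      using l2_lim_times_weight[OF w T.T_lim[OF f0, unfolded \<nu>_def]]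
      by (simp add: p_def[abs_def] \<nu>_def \<nu>inv_def)
    show "l2_lim \<nu>inv p p\<^sub>0 (at_right 0)"
    proof (rule l2_lim_cong_AE[OF lim _ p0_l2])
      show "\<forall>\<^sub>F t in at_right 0. l2 \<nu>inv (p t) \<and> (AE x in \<nu>inv. p t x = p t x)"
        using l2_limD(2)[OF lim] by eventually_elim simp
      show "AE x in \<nu>inv. p\<^sub>0 x = f0 x * p\<^sub>s x"
        by (rule AE_I2) (simp add: \<nu>inv_def weighted_def space_restrict_space f0_ps)
    qed
    fix t :: real assume t: "0 < t"
    obtain q where q: "l2_lim \<nu> (\<lambda>h x. (koopman P \<Phi> (t + h) f0 x - koopman P \<Phi> t f0 x) / h) q (at 0)"
      and adj: "\<And>v w. l2_generator \<nu> (koopman P \<Phi>) v w \<Longrightarrow> l2_inner \<nu> q v = l2_inner \<nu> (koopman P \<Phi> t f0) w"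
      using T.T_differentiable[OF t f0] by blast
    have q_l2: "l2 \<nu> q" by (rule l2_limD(1)[OF q])
    have "l2_lim \<nu>inv (\<lambda>h x. (p (t + h) x - p t x) / h) (\<lambda>x. q x * p\<^sub>s x) (at 0)"
      using l2_lim_times_weight[OF w q[unfolded \<nu>_def]]
      by (simp add: p_def[abs_def] \<nu>inv_def left_diff_distrib diff_divide_distrib)
    moreover have "fokker_planck_operator S b \<sigma> (p t) (\<lambda>x. q x * p\<^sub>s x)"
      unfolding fokker_planck_operator_def
    proof
      fix v assume v: "v \<in> test_functions S"
      have gen: "l2_generator \<nu> (koopman P \<Phi>) v (generator b \<sigma> v)"
        using koopman_generator[OF v] by (simp add: \<nu>_def)
      then have l2: "l2 \<nu> v" "l2 \<nu> (generator b \<sigma> v)"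
        by (auto simp: l2_generator_def l2_lim_def)
      have *: "integrable (restrict_space lborel S) (\<lambda>x. f x * p\<^sub>s x * g x)
          \<and> (\<integral>x. f x * p\<^sub>s x * g x \<partial>restrict_space lborel S) = l2_inner \<nu> f g"
        if "l2 \<nu> f" "l2 \<nu> g" for f g
      proof -
        have meas: "(\<lambda>x. f x * g x) \<in> borel_measurable (restrict_space lborel S)"
          using l2_measurable[OF that(1)] l2_measurable[OF that(2)] by (simp add: borel_\<nu> M0_def)
        show ?thesis
          using l2_integrable_mult[OF that] integrable_weighted_iff[OF w meas] integral_weighted[OF w meas]
          by (simp add: \<nu>_def l2_inner_def mult.assoc mult.left_commute)
      qed
      show "integrable (restrict_space lborel S) (\<lambda>x. q x * p\<^sub>s x * v x) \<and>
        integrable (restrict_space lborel S) (\<lambda>x. p t x * generator b \<sigma> v x) \<and>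
        (\<integral>x. q x * p\<^sub>s x * v x \<partial>restrict_space lborel S) =
        (\<integral>x. p t x * generator b \<sigma> v x \<partial>restrict_space lborel S)"
        using *[OF q_l2 l2(1)] *[OF Tf[OF less_imp_le[OF t]] l2(2)] adj[OF gen] by (simp add: p_def)
    qed
    ultimately show "\<exists>q. l2_lim \<nu>inv (\<lambda>h x. (p (t + h) x - p t x) / h) q (at 0) \<and>
        fokker_planck_operator S b \<sigma> (p t) q" by blast
  qed

  have mc: "AE \<omega> in Q. \<forall>i. (\<lambda>M. mc_coeff M (\<lambda>m. X m \<omega>) p\<^sub>s p\<^sub>0 (\<phi> i)) \<longlonglongrightarrow> c i"
    unfolding AE_all_countable
  proof
    fix i
    note int = l2_integrable_mult[OF \<phi> f0, of i]
    from R.snapshot_average_tendsto[OF data R.fst_integrable[OF int]] R.fst_integral[of "\<lambda>x. \<phi> i x * f0 x"] int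
    show "AE \<omega> in Q. (\<lambda>M. mc_coeff M (\<lambda>m. X m \<omega>) p\<^sub>s p\<^sub>0 (\<phi> i)) \<longlonglongrightarrow> c i"
      by (simp add: mc_coeff_def f0_def[symmetric] c l2_inner_def borel_measurable_integrable mult.commute)
  qed
  have eigenpairs: "dict_eigenpairs \<nu> \<psi> (r k) (galerkin \<nu> (koopman P \<Phi> \<Delta>t) \<psi> (r k)) (\<mu>N k) (\<phi>N k)" for k
    using approx_eigenpairs by (simp add: K_def)
  note approx = \<Delta>t dictionary subsequence eigenpairs approx_eigenvalues approx_eigenfunctions
  have \<phi>N: "l2 (weighted S p\<^sub>s) (\<phi>N k i)" if "i < r k" for k i
    using T.galerkin_eigenpairs(1)[OF \<Delta>t0 dictionary eigenpairs that] by (simp add: \<nu>_def)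
  define sd where "sd k a t = spectral_density (r k) a (\<lambda>i. ln (\<mu>N k i) / \<Delta>t) (\<phi>N k) p\<^sub>s t" for k a t
  have sd_l2: "l2 \<nu>inv (sd k a t)" for k a t
    unfolding sd_def \<nu>inv_def by (rule spectral_density_l2[OF w \<phi>N])
  have sd_inner: "l2_inner \<nu>inv (sd k a t) h
      = (\<Sum>i<r k. a i * (exp (ln (\<mu>N k i) / \<Delta>t * t) * l2_inner \<nu> (\<phi>N k i) (\<lambda>x. h x / p\<^sub>s x)))"
    if "l2 \<nu>inv h" for k a t h
    using that unfolding sd_def \<nu>inv_def \<nu>_def by (intro spectral_density_inner[OF w \<phi>N])
  have p_inner: "l2_inner \<nu>inv (p t) h = l2_inner \<nu> (koopman P \<Phi> t f0) (\<lambda>x. h x / p\<^sub>s x)"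
    if "0 \<le> t" "l2 \<nu>inv h" for t h
    using l2_inner_inverse_weight[OF w, of "koopman P \<Phi> t f0" h] l2_measurable[OF Tf[OF that(1)]]
      l2_measurable[OF that(2)]
    by (simp add: p_def[abs_def] \<nu>_def \<nu>inv_def weighted_borel)
  have weak: "weak_l2_lim \<nu>inv (\<lambda>k. sd k (d k) t) (p t)"
    if t: "0 < t" and close: "\<And>k. (\<Sum>i<r k. \<bar>d k i - c i\<bar>) \<le> 1 / real (Suc k)" for d t
    unfolding weak_l2_lim_def
  proof (intro conjI allI impI)
    show "l2 \<nu>inv (p t)" using t by (simp add: p_l2)
    show "\<forall>\<^sub>F k in sequentially. l2 \<nu>inv (sd k (d k) t)" by (simp add: sd_l2)
    fix h assume h: "l2 \<nu>inv h"
    have t0: "0 \<le> t" using t by simp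
    have "l2 \<nu> (\<lambda>x. h x / p\<^sub>s x)" using l2_divide_weight[OF w h[unfolded \<nu>inv_def]] by (simp add: \<nu>_def)
    from T.approx_spectral_limit_perturbed[OF approx t0 f0 this close[unfolded c]]
    show "(\<lambda>k. l2_inner \<nu>inv (sd k (d k) t) h) \<longlonglongrightarrow> l2_inner \<nu>inv (p t) h"
      by (simp add: sd_inner[OF h] p_inner[OF t0 h])
  qed
  have pN: "pN M k t \<omega> = sd k (\<lambda>i. mc_coeff M (\<lambda>m. X m \<omega>) p\<^sub>s p\<^sub>0 (\<phi> i)) t" for M k t \<omega>
    by (simp add: pN_def sd_def)
  have densities: "AE \<omega> in Q.
      (\<exists>q. (\<forall>k. \<forall>t>0. weak_l2_lim \<nu>inv (\<lambda>M. pN M k t \<omega>) (q k t)) \<and>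
           (\<forall>t>0. weak_l2_lim \<nu>inv (\<lambda>k. q k t) (p t))) \<and>
      (\<exists>M\<^sub>0. \<forall>m. (\<forall>k. M\<^sub>0 k \<le> m k) \<longrightarrow> (\<forall>t>0. weak_l2_lim \<nu>inv (\<lambda>k. pN (m k) k t \<omega>) (p t)))"
    using mc
  proof eventually_elim
    case (elim \<omega>)
    define a where "a M i = mc_coeff M (\<lambda>m. X m \<omega>) p\<^sub>s p\<^sub>0 (\<phi> i)" for M i
    have a: "(\<lambda>M. a M i) \<longlonglongrightarrow> c i" for i using elim by (simp add: a_def)
    have pN_a: "pN M k t \<omega> = sd k (a M) t" for M k t by (simp add: pN a_def[abs_def])
    have fixed_k: "weak_l2_lim \<nu>inv (\<lambda>M. pN M k t \<omega>) (sd k c t)" for k t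
      unfolding weak_l2_lim_def pN_a
      by (intro conjI allI impI sd_l2 always_eventually) (auto simp: sd_inner intro!: tendsto_intros a)
    have "weak_l2_lim \<nu>inv (\<lambda>k. sd k c t) (p t)" if "0 < t" for t
      by (rule weak[OF that]) simp
    with fixed_k have iterated: "\<exists>q. (\<forall>k. \<forall>t>0. weak_l2_lim \<nu>inv (\<lambda>M. pN M k t \<omega>) (q k t)) \<and>
           (\<forall>t>0. weak_l2_lim \<nu>inv (\<lambda>k. q k t) (p t))"
      by (intro exI[of _ "\<lambda>k t. sd k c t"]) blast
    \<comment> \<open>only finitely many coefficients enter for each \<open>k\<close>, so one sample size controls them all\<close>
    have "\<exists>M\<^sub>0. \<forall>M\<ge>M\<^sub>0. (\<Sum>i<r k. \<bar>a M i - c i\<bar>) \<le> 1 / real (Suc k)" for k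
    proof -
      have "(\<lambda>M. \<Sum>i<r k. \<bar>a M i - c i\<bar>) \<longlonglongrightarrow> (\<Sum>i<r k. \<bar>c i - c i\<bar>)"
        by (intro tendsto_intros a)
      then have "(\<lambda>M. \<Sum>i<r k. \<bar>a M i - c i\<bar>) \<longlonglongrightarrow> 0" by simp
      from order_tendstoD(2)[OF this, of "1 / real (Suc k)"]
      have "\<forall>\<^sub>F M in sequentially. (\<Sum>i<r k. \<bar>a M i - c i\<bar>) < 1 / real (Suc k)" by simp
      then show ?thesis by (auto simp: eventually_at_top_linorder intro: less_imp_le)
    qed
    then obtain M\<^sub>0 where M\<^sub>0: "\<And>k M. M\<^sub>0 k \<le> M \<Longrightarrow> (\<Sum>i<r k. \<bar>a M i - c i\<bar>) \<le> 1 / real (Suc k)"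
      by metis
    have "weak_l2_lim \<nu>inv (\<lambda>k. pN (m k) k t \<omega>) (p t)" if "\<And>k. M\<^sub>0 k \<le> m k" "0 < t" for m t
      unfolding pN_a by (rule weak[OF that(2)]) (rule M\<^sub>0[OF that(1)])
    with iterated show ?case by (intro conjI exI[of _ M\<^sub>0]) blast+
  qed

  show ?thesis
    using A G edmd strong expansion evolved fokker_planck densities by blast
qed

end
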